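(* Let $p,q\in(0,\infty)$, let $\phi$ be a normal function on $[0,1)$, let $\mu$ be a weight, let $n\in\mathbb{N}_0$, let $g\in H(\mathbb{D})$, and let $\varphi$ be an analytic self-map of $\mathbb{D}$. If the operator $C_{\varphi,g}^n : H(p,q,\phi)\to\mathcal{Z}_\mu$ is bounded, then $$\|C_{\varphi,g}^n\|_{e,\,H(p,q,\phi)\to\mathcal{Z}_\mu}\approx \max\left\{\limsup_{|\varphi(z)|\to 1}\frac{\mu(|z|)\,|\varphi'(z)g(z)|}{\phi(|\varphi(z)|)(1-|\varphi(z)|^2)^{1/q+n+1}},\ \limsup_{|\varphi(z)|\to 1}\frac{\mu(|z|)\,|g'(z)|}{\phi(|\varphi(z)|)(1-|\varphi(z)|^2)^{1/q+n}}\right\}.$$ Here $X\approx Y$ means that there are constants $C_1,C_2>0$, depending only on $p,q,\phi,n$, such that $C_1Y\le X\le C_2Y$.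
   Context: $\mathbb{D}$ is the open unit disc in $\mathbb{C}$, $H(\mathbb{D})$ is the space of analytic functions on $\mathbb{D}$, and an analytic self-map of $\mathbb{D}$ is an analytic function $\varphi:\mathbb{D}\to\mathbb{D}$. Normal function: a positive continuous function $\phi$ on $[0,1)$ for which there are constants $b>a>0$ such that $\phi(r)/(1-r)^a$ is non-increasing on $[0,1)$ and tends to $0$ as $r\to1^-$, and $\phi(r)/(1-r)^b$ is non-decreasing on $[0,1)$ and tends to $\infty$ as $r\to1^-$. Mixed-norm space: for $0<p,q<\infty$ and $\phi$ normal, $H(p,q,\phi)$ is the space of all $f\in H(\mathbb{D})$ with $$\|f\|_{p,q,\phi}^p=\int_0^1 M_q^p(f,r)\frac{\phi^p(r)}{1-r}\,dr<\infty,\qquad M_q(f,r)=\left(\frac1{2\pi}\int_0^{2\pi}|f(re^{i\theta})|^q\,d\theta\right)^{1/q}.$$ (In general $\|\cdot\|_{p,q,\phi}$ is only a quasi-norm.) Weight: a positive continuous function $\mu$ on $\mathbb{D}$ (only the values $\mu(|z|)$ are used). Weighted Zygmund space: $\mathcal{Z}_\mu$ is the space of $f\in H(\mathbb{D})$ with $\sup_{z\in\mathbb{D}}\mu(|z|)|f''(z)|<\infty$, with norm $\|f\|_{\mathcal{Z}_\mu}=|f(0)|+|f'(0)|+\sup_{z\in\mathbb{D}}\mu(|z|)|f''(z)|$. Generalized integration operator: for $n\in\mathbb{N}_0=\{0,1,2,\dots\}$, $(C_{\varphi,g}^nf)(z)=\int_0^z f^{(n)}(\varphi(\xi))g(\xi)\,d\xi$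 for $f\in H(\mathbb{D})$, $z\in\mathbb{D}$. For a linear operator $T:X\to Y$, $\|T\|=\sup_{\|f\|_X\le1}\|Tf\|_Y$; $T$ is bounded if $\|T\|<\infty$ and compact if it maps bounded sets to relatively compact sets. The essential norm is $\|T\|_{e,X\to Y}=\inf\{\|T-S\|: S \text{ is a compact linear operator from } X \text{ to } Y\}$. $\limsup_{|\varphi(z)|\to1}F(z)$ means $\lim_{\delta\to1^-}\sup\{F(z): z\in\mathbb{D},\ \delta<|\varphi(z)|<1\}$ for nonnegative $F$, with the supremum over the empty set equal to $0$ (so the limsup is $0$ if $\sup_{z\in\mathbb{D}}|\varphi(z)|<1$). *)

theory Defs
  imports "HOL-Complex_Analysis.Complex_Analysis"
begin

abbreviation unit_disc :: "complex set" where
  "unit_disc \<equiv> ball 0 1"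

(* A function on the disc is represented by its extension by 0 to the whole plane, so that
   equality of elements of H(D) is equality of HOL functions. *)
definition HD :: "(complex \<Rightarrow> complex) set" where
  "HD = {f. f holomorphic_on unit_disc \<and> (\<forall>z. z \<notin> unit_disc \<longrightarrow> f z = 0)}"

definition analytic_self_map :: "(complex \<Rightarrow> complex) \<Rightarrow> bool" where
  "analytic_self_map \<phi> \<longleftrightarrow> \<phi> holomorphic_on unit_disc \<and> \<phi> ` unit_disc \<subseteq> unit_disc"

definition normal_function :: "(real \<Rightarrow> real) \<Rightarrow> bool" where
  "normal_function \<phi> \<longleftrightarrow>
     continuous_on {0..<1} \<phi> \<and> (\<forall>r\<in>{0..<1}. \<phi> r > 0) \<and>
     (\<exists>a b. 0 < a \<and> a < b \<and>
        antimono_on {0..<1} (\<lambda>r. \<phi> r / (1 - r) powr a) \<and>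
        ((\<lambda>r. \<phi> r / (1 - r) powr a) \<longlongrightarrow> 0) (at_left 1) \<and>
        mono_on {0..<1} (\<lambda>r. \<phi> r / (1 - r) powr b) \<and>
        filterlim (\<lambda>r. \<phi> r / (1 - r) powr b) at_top (at_left 1))"

definition weight :: "(complex \<Rightarrow> real) \<Rightarrow> bool" where
  "weight \<mu> \<longleftrightarrow> continuous_on unit_disc \<mu> \<and> (\<forall>z\<in>unit_disc. \<mu> z > 0)"

definition integral_mean :: "real \<Rightarrow> (complex \<Rightarrow> complex) \<Rightarrow> real \<Rightarrow> real" where
  "integral_mean q f r =
     (1 / (2 * pi) * (LBINT t:{0..2 * pi}. cmod (f (of_real r * exp (\<i> * of_real t))) powr q))
       powr (1 / q)"

definition mixed_norm_integrand ::
    "real \<Rightarrow> real \<Rightarrow> (real \<Rightarrow> real) \<Rightarrow> (complex \<Rightarrow> complex) \<Rightarrow> real \<Rightarrow> real" where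
  "mixed_norm_integrand p q \<phi> f r = integral_mean q f r powr p * (\<phi> r powr p / (1 - r))"

(* The integrand is nonnegative and measurable, so integrability says that the integral is finite. *)
definition mixed_norm_space ::
    "real \<Rightarrow> real \<Rightarrow> (real \<Rightarrow> real) \<Rightarrow> (complex \<Rightarrow> complex) set" where
  "mixed_norm_space p q \<phi> =
     {f \<in> HD. set_integrable lborel {0..<1} (mixed_norm_integrand p q \<phi> f)}"

definition mixed_norm ::
    "real \<Rightarrow> real \<Rightarrow> (real \<Rightarrow> real) \<Rightarrow> (complex \<Rightarrow> complex) \<Rightarrow> real" where
  "mixed_norm p q \<phi> f = (LBINT r:{0..<1}. mixed_norm_integrand p q \<phi> f r) powr (1 / p)"

definition zygmund_space :: "(complex \<Rightarrow> real) \<Rightarrow> (complex \<Rightarrow> complex) set" where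
  "zygmund_space \<mu> =
     {f \<in> HD. bdd_above ((\<lambda>z. \<mu> (of_real (cmod z)) * cmod ((deriv ^^ 2) f z)) ` unit_disc)}"

(* Meaningful only on zygmund_space \<mu>, where the supremum is finite. *)
definition zygmund_norm :: "(complex \<Rightarrow> real) \<Rightarrow> (complex \<Rightarrow> complex) \<Rightarrow> real" where
  "zygmund_norm \<mu> f = cmod (f 0) + cmod (deriv f 0) +
     (SUP z\<in>unit_disc. \<mu> (of_real (cmod z)) * cmod ((deriv ^^ 2) f z))"

definition gen_integration_op ::
    "nat \<Rightarrow> (complex \<Rightarrow> complex) \<Rightarrow> (complex \<Rightarrow> complex) \<Rightarrow> (complex \<Rightarrow> complex) \<Rightarrow> complex \<Rightarrow> complex"
  where
  "gen_integration_op n \<phi> g f z =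
     (if z \<in> unit_disc
      then contour_integral (linepath 0 z) (\<lambda>\<xi>. (deriv ^^ n) f (\<phi> \<xi>) * g \<xi>)
      else 0)"

type_synonym funop = "(complex \<Rightarrow> complex) \<Rightarrow> complex \<Rightarrow> complex"

(* In the following, X and Y are complex vector spaces of functions with (quasi-)norms NX and NY;
   the values of an operator outside X play no role. *)
definition linear_operator ::
    "(complex \<Rightarrow> complex) set \<Rightarrow> (complex \<Rightarrow> complex) set \<Rightarrow> funop \<Rightarrow> bool" where
  "linear_operator X Y T \<longleftrightarrow>
     (\<forall>f\<in>X. T f \<in> Y) \<and>
     (\<forall>f\<in>X. \<forall>h\<in>X. T (\<lambda>z. f z + h z) = (\<lambda>z. T f z + T h z)) \<and>
     (\<forall>c. \<forall>f\<in>X. T (\<lambda>z. c * f z) = (\<lambda>z. c * T f z))"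

definition operator_norm ::
    "(complex \<Rightarrow> complex) set \<Rightarrow> ((complex \<Rightarrow> complex) \<Rightarrow> real) \<Rightarrow>
     ((complex \<Rightarrow> complex) \<Rightarrow> real) \<Rightarrow> funop \<Rightarrow> ennreal" where
  "operator_norm X NX NY T = (SUP f\<in>{f \<in> X. NX f \<le> 1}. ennreal (NY (T f)))"

definition bounded_operator ::
    "(complex \<Rightarrow> complex) set \<Rightarrow> ((complex \<Rightarrow> complex) \<Rightarrow> real) \<Rightarrow>
     (complex \<Rightarrow> complex) set \<Rightarrow> ((complex \<Rightarrow> complex) \<Rightarrow> real) \<Rightarrow> funop \<Rightarrow> bool" where
  "bounded_operator X NX Y NY T \<longleftrightarrow> linear_operator X Y T \<and> operator_norm X NX NY T < \<infinity>"

(* Metric_space asks for symmetry and nonnegativity on the whole type, so the distance is set to 0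
   outside of Y. *)
definition norm_dist ::
    "(complex \<Rightarrow> complex) set \<Rightarrow> ((complex \<Rightarrow> complex) \<Rightarrow> real) \<Rightarrow>
     (complex \<Rightarrow> complex) \<Rightarrow> (complex \<Rightarrow> complex) \<Rightarrow> real" where
  "norm_dist Y N f h = (if f \<in> Y \<and> h \<in> Y then N (\<lambda>z. f z - h z) else 0)"

definition relatively_compact ::
    "(complex \<Rightarrow> complex) set \<Rightarrow> ((complex \<Rightarrow> complex) \<Rightarrow> real) \<Rightarrow> (complex \<Rightarrow> complex) set \<Rightarrow> bool" where
  "relatively_compact Y NY K \<longleftrightarrow>
     compactin (Metric_space.mtopology Y (norm_dist Y NY))
       (Metric_space.mtopology Y (norm_dist Y NY) closure_of K)"

definition compact_operator ::
    "(complex \<Rightarrow> complex) set \<Rightarrow> ((complex \<Rightarrow> complex) \<Rightarrow> real) \<Rightarrow>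
     (complex \<Rightarrow> complex) set \<Rightarrow> ((complex \<Rightarrow> complex) \<Rightarrow> real) \<Rightarrow> funop \<Rightarrow> bool" where
  "compact_operator X NX Y NY S \<longleftrightarrow>
     linear_operator X Y S \<and>
     (\<forall>B\<subseteq>X. (\<exists>M. \<forall>f\<in>B. NX f \<le> M) \<longrightarrow> relatively_compact Y NY (S ` B))"

definition essential_norm ::
    "(complex \<Rightarrow> complex) set \<Rightarrow> ((complex \<Rightarrow> complex) \<Rightarrow> real) \<Rightarrow>
     (complex \<Rightarrow> complex) set \<Rightarrow> ((complex \<Rightarrow> complex) \<Rightarrow> real) \<Rightarrow> funop \<Rightarrow> ennreal" where
  "essential_norm X NX Y NY T =
     (INF S\<in>{S. compact_operator X NX Y NY S}. operator_norm X NX NY (\<lambda>f z. T f z - S f z))"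

(* limsup of F(z) as |\<phi>(z)| tends to 1; suprema are taken in ennreal, where SUP over {} is 0. *)
definition boundary_limsup :: "(complex \<Rightarrow> complex) \<Rightarrow> (complex \<Rightarrow> real) \<Rightarrow> ennreal" where
  "boundary_limsup \<phi> F =
     Lim (at_left (1::real))
       (\<lambda>\<delta>. SUP z\<in>{z \<in> unit_disc. \<delta> < cmod (\<phi> z) \<and> cmod (\<phi> z) < 1}. ennreal (F z))"

(* The topology used in relatively_compact is the intended one. *)
lemma Metric_space_zygmund:
  assumes "weight \<mu>"
  shows "Metric_space (zygmund_space \<mu>) (norm_dist (zygmund_space \<mu>) (zygmund_norm \<mu>))"
proof -
  let ?Z = "zygmund_space \<mu>"
  let ?d = "norm_dist ?Z (zygmund_norm \<mu>)"
  define W where "W \<equiv> \<lambda>z::complex. \<mu> (of_real (cmod z))"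
  have W: "W z > 0" if "z \<in> unit_disc" for z
    using assms that by (auto simp: weight_def W_def)
  have sub: "f holomorphic_on unit_disc" "\<And>z. z \<notin> unit_disc \<Longrightarrow> f z = 0" if "f \<in> ?Z" for f
    using that by (auto simp: zygmund_space_def HD_def)
  have holD: "(deriv ^^ k) (\<lambda>w. f w - h w) z = (deriv ^^ k) f z - (deriv ^^ k) h z"
    if "f \<in> ?Z" "h \<in> ?Z" "z \<in> unit_disc" for f h z k
    using higher_deriv_diff[OF sub(1)[OF that(1)] sub(1)[OF that(2)] open_ball that(3)] .
  define s where "s \<equiv> \<lambda>f h z. W z * cmod ((deriv ^^ 2) f z - (deriv ^^ 2) h z)"
  have tri: "s f h z \<le> s f k z + s k h z" if "z \<in> unit_disc" for f h k z
  proof -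
    have "cmod ((deriv ^^ 2) f z - (deriv ^^ 2) h z) \<le>
        cmod ((deriv ^^ 2) f z - (deriv ^^ 2) k z) + cmod ((deriv ^^ 2) k z - (deriv ^^ 2) h z)"
      by norm
    from mult_left_mono[OF this, of "W z"] show ?thesis
      using W[OF that] by (simp add: s_def distrib_left)
  qed
  have bdd: "bdd_above (s f h ` unit_disc)" if f: "f \<in> ?Z" and h: "h \<in> ?Z" for f h
  proof -
    obtain A where A: "\<And>z. z \<in> unit_disc \<Longrightarrow> W z * cmod ((deriv ^^ 2) f z) \<le> A"
      using f unfolding zygmund_space_def bdd_above_def W_def by blast
    obtain B where B: "\<And>z. z \<in> unit_disc \<Longrightarrow> W z * cmod ((deriv ^^ 2) h z) \<le> B"
      using h unfolding zygmund_space_def bdd_above_def W_def by blast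
    have "s f h z \<le> A + B" if z: "z \<in> unit_disc" for z
    proof -
      have "s f h z \<le> W z * (cmod ((deriv ^^ 2) f z) + cmod ((deriv ^^ 2) h z))"
        unfolding s_def using W[OF z] by (intro mult_left_mono norm_triangle_ineq4) auto
      then show ?thesis using A[OF z] B[OF z] by (simp add: distrib_left)
    qed
    then show ?thesis by (intro bdd_aboveI2) auto
  qed
  have d: "?d f h = cmod (f 0 - h 0) + cmod (deriv f 0 - deriv h 0) + (SUP z\<in>unit_disc. s f h z)"
    if "f \<in> ?Z" "h \<in> ?Z" for f h
  proof -
    have "deriv (\<lambda>w. f w - h w) 0 = deriv f 0 - deriv h 0"
      using holD[OF that, of 0 1] by simp
    moreover have "(SUP z\<in>unit_disc. W z * cmod ((deriv ^^ 2) (\<lambda>w. f w - h w) z))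
        = (SUP z\<in>unit_disc. s f h z)"
      by (rule SUP_cong[OF refl]) (use holD[OF that] in \<open>simp only: s_def\<close>)
    ultimately show ?thesis
      using that by (simp add: norm_dist_def zygmund_norm_def W_def)
  qed
  have sup_ge: "s f h z \<le> (SUP z\<in>unit_disc. s f h z)"
    if "f \<in> ?Z" "h \<in> ?Z" "z \<in> unit_disc" for f h z
    using cSUP_upper[OF that(3) bdd[OF that(1,2)]] .
  have s_nonneg: "0 \<le> s f h z" if "z \<in> unit_disc" for f h z
    using W[OF that] by (simp add: s_def)
  have sup_nonneg: "0 \<le> (SUP z\<in>unit_disc. s f h z)" if "f \<in> ?Z" "h \<in> ?Z" for f h
    using sup_ge[OF that, of 0] s_nonneg[of 0 f h] by simp
  have d0: "?d f h = 0" if "\<not> (f \<in> ?Z \<and> h \<in> ?Z)" for f h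
    using that by (auto simp: norm_dist_def)
  show ?thesis
  proof
    fix f h
    show "0 \<le> ?d f h"
      by (cases "f \<in> ?Z \<and> h \<in> ?Z") (auto simp: d d0 sup_nonneg)
    have "s f h = s h f"
      by (simp add: s_def norm_minus_commute)
    then show "?d f h = ?d h f"
      by (cases "f \<in> ?Z \<and> h \<in> ?Z") (auto simp: d d0 norm_minus_commute)
  next
    fix f h assume fh: "f \<in> ?Z" "h \<in> ?Z"
    show "?d f h = 0 \<longleftrightarrow> f = h"
    proof
      assume "f = h"
      then have "s f h = (\<lambda>z. 0)" by (simp add: s_def)
      then show "?d f h = 0" using fh \<open>f = h\<close> by (simp add: d)
    next
      assume "?d f h = 0"
      then have 0: "f 0 = h 0" "deriv f 0 = deriv h 0" and S: "(SUP z\<in>unit_disc. s f h z) = 0"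
        using sup_nonneg[OF fh] norm_ge_zero[of "f 0 - h 0"] norm_ge_zero[of "deriv f 0 - deriv h 0"]
        unfolding d[OF fh] by (smt (verit) eq_iff_diff_eq_0 norm_le_zero_iff)+
      have 2: "deriv (deriv f) z - deriv (deriv h) z = 0" if "z \<in> unit_disc" for z
      proof -
        have "s f h z = 0"
          using sup_ge[OF fh that] s_nonneg[OF that, of f h] S by simp
        then show ?thesis using W[OF that] by (simp add: s_def numeral_2_eq_2)
      qed
      have hol: "deriv f holomorphic_on unit_disc" "deriv h holomorphic_on unit_disc"
        using fh sub(1) by (auto intro: holomorphic_deriv)
      have const: "F z = F 0"
        if z: "z \<in> unit_disc" and F: "\<And>w. w \<in> unit_disc \<Longrightarrow> (F has_field_derivative 0) (at w)"
        for F :: "complex \<Rightarrow> complex" and z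
      proof -
        obtain c where "\<And>w. w \<in> unit_disc \<Longrightarrow> F w = c"
          using has_field_derivative_zero_constant[of unit_disc F] F
          by (meson convex_ball has_field_derivative_at_within)
        then show ?thesis using z by simp
      qed
      have 1: "deriv f z - deriv h z = 0" if "z \<in> unit_disc" for z
        using const[OF that, of "\<lambda>w. deriv f w - deriv h w"] 0 2
          DERIV_diff[OF holomorphic_derivI[OF hol(1) open_ball] holomorphic_derivI[OF hol(2) open_ball]]
        by auto
      have "f z - h z = 0" if "z \<in> unit_disc" for z
        using const[OF that, of "\<lambda>w. f w - h w"] 0 1
          DERIV_diff[OF holomorphic_derivI[OF sub(1)[OF fh(1)] open_ball]
            holomorphic_derivI[OF sub(1)[OF fh(2)] open_ball]]
        by auto
      then show "f = h"
        using sub(2) fh by (metis eq_iff_diff_eq_0 ext)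
    qed
  next
    fix f k h assume fkh: "f \<in> ?Z" "k \<in> ?Z" "h \<in> ?Z"
    have "(SUP z\<in>unit_disc. s f h z) \<le> (SUP z\<in>unit_disc. s f k z) + (SUP z\<in>unit_disc. s k h z)"
    proof (rule cSUP_least)
      fix z :: complex assume z: "z \<in> unit_disc"
      show "s f h z \<le> (SUP z\<in>unit_disc. s f k z) + (SUP z\<in>unit_disc. s k h z)"
        using tri[OF z, of f h k] sup_ge[OF fkh(1,2) z] sup_ge[OF fkh(2,3) z] by linarith
    qed simp
    moreover have "cmod (f 0 - h 0) \<le> cmod (f 0 - k 0) + cmod (k 0 - h 0)"
      "cmod (deriv f 0 - deriv h 0) \<le> cmod (deriv f 0 - deriv k 0) + cmod (deriv k 0 - deriv h 0)"
      by norm+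
    ultimately show "?d f h \<le> ?d f k + ?d k h"
      using fkh by (simp add: d)
  qed
qed

end

theory Submission
  imports Defs
begin

text \<open>
  Since \<open>(T f)'' = f\<^sup>(\<^sup>n\<^sup>+\<^sup>1\<^sup>)(\<psi>) \<psi>' g + f\<^sup>(\<^sup>n\<^sup>)(\<psi>) g'\<close>, everything rests on the sharp pointwise growth of
  \<open>f\<^sup>(\<^sup>k\<^sup>)\<close> for \<open>f\<close> in the mixed-norm space. For the upper estimate \<open>T\<close> is compared with the operators
  \<open>f \<mapsto> T (f (r \<cdot>))\<close>, which are compact by Montel's theorem; the difference is small where \<open>|\<psi>|\<close> stays away from
  \<open>1\<close>, and is controlled by the growth estimate elsewhere. For the lower estimate \<open>T - S\<close> is applied to
  differences of the normalised kernels \<open>(1 - |u|\<^sup>2) powr (N - 1/q) / (\<phi>(|u|) (1 - cnj u z) ^ N)\<close> at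
  \<open>u = \<psi> z\<close>, \<open>|\<psi> z| \<rightarrow> 1\<close>; two values of \<open>N\<close> separate the two summands of \<open>(T f)''\<close>.
\<close>

section \<open>Means over circles\<close>

text \<open>The exponents p and q may be smaller than 1. The mixed norm is then only a quasi-norm,
  so neither Minkowski's inequality nor duality is at hand, and compactness has to be exploited
  through convergent subsequences. The implied constants may depend on p, q, \<phi> and n alone.
  They come from the growth estimate and from kernel bounds that hold before a weight or a symbol is
  chosen. Boundedness of T enters qualitatively: tested on kernels, it shows that
  \<open>W z * cmod (deriv \<psi> z * g z)\<close> and \<open>W z * cmod (deriv g z)\<close> are
  bounded, and that both tend to 0 as |\<psi> z| tends to 1. The first fact makes the dilated
  operators compact and the region away from the boundary harmless; the second removes the
  contribution of a fixed kernel. On the diagonal u = \<psi> z the exponent N enters (T f)'' only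
  through a harmless factor and the coefficient N + n of one summand, so subtraction for consecutive
  N isolates that summand.\<close>

lemma circle_Cauchy:
  assumes F: "F holomorphic_on ball 0 1" and s: "cmod w < s" "s < 1"
  shows "((\<lambda>t. F (of_real s * exp (\<i> * of_real t)) *
            (of_real s * exp (\<i> * of_real t) / (of_real s * exp (\<i> * of_real t) - w)))
          has_integral of_real (2 * pi) * F w) {0..2 * pi}"
proof -
  have "F holomorphic_on cball 0 s"
    using F s by (auto elim!: holomorphic_on_subset)
  from Cauchy_integral_circlepath_simple[OF this, of w]
  have "((\<lambda>u. F u / (u - w)) has_contour_integral (2 * of_real pi * \<i> * F w)) (part_circlepath 0 s 0 (2 * pi))"
    using s by (simp add: circlepath_def)
  then have "((\<lambda>t. F (0 + s * cis t) / (0 + s * cis t - w) * s * \<i> * cis t) has_integral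
      (2 * of_real pi * \<i> * F w)) {0..2 * pi}"
    by (subst (asm) has_contour_integral_part_circlepath_iff) auto
  \<comment> \<open>On the circle dz = i z dt, so the factor -i turns the contour integral into an
    integral over the angle.\<close>
  from has_integral_mult_right[OF this, of "-\<i>"] show ?thesis
    by (simp add: cis_conv_exp field_simps)
qed

lemma circle_mem_disc:
  assumes "0 \<le> r" "r < 1"
  shows "of_real r * exp (\<i> * of_real t) \<in> unit_disc"
  using assms by (simp add: norm_mult)

lemma continuous_on_circle_powr:
  fixes f :: "complex \<Rightarrow> complex" and q :: real
  assumes f: "continuous_on unit_disc f" and q: "q > 0"
  shows "continuous_on ({0..<1} \<times> {a..b}) (\<lambda>(r, t). cmod (f (of_real r * exp (\<i> * of_real t))) powr q)"
  unfolding case_prod_beta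
proof (intro continuous_on_powr' continuous_on_norm continuous_on_const ballI)
  show "continuous_on ({0..<1} \<times> {a..b}) (\<lambda>x. f (of_real (fst x) * exp (\<i> * of_real (snd x))))"
    by (rule continuous_on_compose2[OF f])
       (auto intro!: continuous_intros simp: norm_mult)
qed (use q in auto)

lemma circle_set_integrable:
  fixes f :: "complex \<Rightarrow> complex" and q :: real
  assumes f: "continuous_on unit_disc f" and q: "q > 0" and r: "0 \<le> r" "r < 1"
  shows "set_integrable lborel {0..2 * pi} (\<lambda>t. cmod (f (of_real r * exp (\<i> * of_real t))) powr q)"
proof (rule borel_integrable_atLeastAtMost')
  have "continuous_on {0..2 * pi} ((\<lambda>(r, t). cmod (f (of_real r * exp (\<i> * of_real t))) powr q) \<circ> Pair r)"
    by (intro continuous_on_compose continuous_on_subset[OF continuous_on_circle_powr[OF f q, of 0 "2 * pi"]]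
        continuous_intros) (use r in auto)
  then show "continuous_on {0..2 * pi} (\<lambda>t. cmod (f (of_real r * exp (\<i> * of_real t))) powr q)"
    by (simp add: o_def)
qed

text \<open>Supplies the measurability of the mixed-norm integrand that the domination criterion
  \<open>X_dominated\<close> needs.\<close>

lemma continuous_on_integral_mean:
  assumes f: "continuous_on unit_disc f" and q: "q > 0"
  shows "continuous_on {0..<1} (integral_mean q f)"
proof -
  let ?J = "\<lambda>r. LBINT t:{0..2 * pi}. cmod (f (of_real r * exp (\<i> * of_real t))) powr q"
  have "continuous_on {0..<1} (\<lambda>r. integral (cbox 0 (2 * pi)) (\<lambda>t. cmod (f (of_real r * exp (\<i> * of_real t))) powr q))"
    by (intro integral_continuous_on_param) (use continuous_on_circle_powr[OF f q] in simp)
  then have "continuous_on {0..<1} ?J"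
    by (rule continuous_on_eq)
       (simp add: set_borel_integral_eq_integral(2)[OF circle_set_integrable[OF f q]])
  moreover have "0 \<le> ?J r" for r
    by (auto simp: set_lebesgue_integral_def intro!: Bochner_Integration.integral_nonneg)
  ultimately show ?thesis
    unfolding integral_mean_def using q
    by (intro continuous_on_powr' continuous_intros) auto
qed

lemma integral_mean_powr_q:
  assumes "q > 0"
  shows "integral_mean q f r powr q =
    1 / (2 * pi) * (LBINT t:{0..2 * pi}. cmod (f (of_real r * exp (\<i> * of_real t))) powr q)"
proof -
  have "0 \<le> (LBINT t:{0..2 * pi}. cmod (f (of_real r * exp (\<i> * of_real t))) powr q)"
    by (auto simp: set_lebesgue_integral_def intro!: Bochner_Integration.integral_nonneg)
  then show ?thesis
    using assms by (simp add: integral_mean_def powr_powr)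
qed

lemma integral_mean_nonneg: "0 \<le> integral_mean q f r"
  by (simp add: integral_mean_def)

lemma integral_mean_mono_powr:
  assumes "p > 0" "q > 0" "integral_mean q f r powr q \<le> B"
  shows "integral_mean q f r powr p \<le> B powr (p / q)"
proof -
  have "integral_mean q f r powr p = (integral_mean q f r powr q) powr (p / q)"
    using assms by (simp add: powr_powr)
  also have "\<dots> \<le> B powr (p / q)"
    using assms by (intro powr_mono2) auto
  finally show ?thesis .
qed

text \<open>Cauchy's formula for \<open>f ^ m\<close>; choosing the integer \<open>m > q\<close> reduces all exponents \<open>q > 0\<close>
  to the case of absolute values.\<close>

lemma Cauchy_power_bound:
  fixes f :: "complex \<Rightarrow> complex" and q A s :: real
  assumes f: "f holomorphic_on unit_disc" and q: "0 < q" "q < real m"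
    and s: "cmod w < s" "s < 1" and A: "\<And>z. cmod z = s \<Longrightarrow> cmod (f z) \<le> A"
  shows "cmod (f w) ^ m \<le> A powr (real m - q) / (s - cmod w) * integral_mean q f s powr q"
proof -
  let ?z = "\<lambda>t::real. of_real s * exp (\<i> * of_real t) :: complex"
  let ?g = "\<lambda>t. f (?z t) ^ m * (?z t / (?z t - w))"
  let ?h = "\<lambda>t. cmod (f (?z t)) powr q"
  have s0: "0 < s" using s(1) norm_ge_zero[of w] by linarith
  have A0: "0 \<le> A" using A[of "of_real s"] s0 norm_ge_zero[of "f (of_real s)"] by (simp del: norm_ge_zero)
  have cz: "cmod (?z t) = s" for t using s0 by (simp add: norm_mult)
  have int: "(?g has_integral of_real (2 * pi) * f w ^ m) {0..2 * pi}"
    using circle_Cauchy[of "\<lambda>z. f z ^ m", OF holomorphic_on_power[OF f] s] .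
  have hint: "?h integrable_on {0..2 * pi}" "integral {0..2 * pi} ?h = 2 * pi * integral_mean q f s powr q"
    using set_borel_integral_eq_integral[OF circle_set_integrable[OF holomorphic_on_imp_continuous_on[OF f] q(1), of s]]
      s0 s integral_mean_powr_q[OF q(1), of f s] by auto
  have pt: "norm (?g t) \<le> A powr (real m - q) / (s - cmod w) * ?h t" for t
  proof (cases "f (?z t) = 0")
    case False
    \<comment> \<open>Only the surplus m - q powers of |f| are replaced by the bound A; the
      remaining power q is kept, because it integrates to the mean.\<close>
    have "cmod (f (?z t)) ^ m = cmod (f (?z t)) powr (real m - q) * ?h t"
      using False by (simp flip: powr_add powr_realpow)
    also have "\<dots> \<le> A powr (real m - q) * ?h t"
      using q A[OF cz] by (intro mult_right_mono powr_mono2) auto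
    finally have 1: "cmod (f (?z t)) ^ m \<le> A powr (real m - q) * ?h t" .
    have 2: "s - cmod w \<le> cmod (?z t - w)"
      using norm_triangle_ineq2[of "?z t" w] unfolding cz .
    have "cmod (?z t / (?z t - w)) = s / cmod (?z t - w)"
      unfolding norm_divide cz ..
    also have "\<dots> \<le> s / (s - cmod w)"
      using 2 s s0 by (intro divide_left_mono) (auto intro!: mult_pos_pos)
    also have "\<dots> \<le> 1 / (s - cmod w)"
      using s by (intro divide_right_mono) auto
    finally have 3: "cmod (?z t / (?z t - w)) \<le> 1 / (s - cmod w)" .
    have "norm (?g t) \<le> A powr (real m - q) * ?h t * (1 / (s - cmod w))"
      unfolding norm_mult[of "f (?z t) ^ m"] norm_power[of "f (?z t)"]
      by (intro mult_mono 1 3) auto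
    then show ?thesis by simp
  qed (use q in \<open>auto simp: power_0_left\<close>)
  have "norm (integral {0..2 * pi} ?g) \<le> integral {0..2 * pi} (\<lambda>t. A powr (real m - q) / (s - cmod w) * ?h t)"
    using int by (intro integral_norm_bound_integral integrable_on_mult_right hint(1) pt) (rule has_integral_integrable)
  also have "integral {0..2 * pi} ?g = of_real (2 * pi) * f w ^ m"
    using int by (rule integral_unique)
  finally have "2 * pi * cmod (f w) ^ m \<le> A powr (real m - q) / (s - cmod w) * (2 * pi * integral_mean q f s powr q)"
    using hint by (simp add: norm_mult norm_power)
  then have "2 * pi * cmod (f w) ^ m \<le> 2 * pi * (A powr (real m - q) / (s - cmod w) * integral_mean q f s powr q)"
    by (simp add: mult_ac)
  then show ?thesis by (subst (asm) mult_le_cancel_left_pos) auto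
qed

text \<open>The function (1 + cnj a z) / (1 - cnj a z) is holomorphic with value 1 at 0, and its
  real part on |z| = r is (1 - (|a| r)^2) / |1 - cnj a z|^2. The mean value property therefore
  evaluates the integral exactly.\<close>

lemma Poisson_kernel_integral:
  assumes a: "cmod a < 1" and r: "0 \<le> r" "r < 1"
  shows "((\<lambda>t. 1 / (cmod (1 - cnj a * (of_real r * exp (\<i> * of_real t))))\<^sup>2) has_integral
           2 * pi / (1 - (cmod a * r)\<^sup>2)) {0..2 * pi}"
proof -
  let ?z = "\<lambda>t::real. of_real r * exp (\<i> * of_real t) :: complex"
  have small: "cmod (cnj a * z) < 1" if "cmod z < 1" for z
    using a that by (simp add: norm_mult) (meson mult_le_one norm_ge_zero less_imp_le mult_less_cancel_right2 order.strict_trans1 mult_left_le_one_le)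
  then have nz: "1 - cnj a * z \<noteq> 0" if "cmod z < 1" for z
    using that by (metis norm_one less_irrefl right_minus_eq)
  define F where "F = (\<lambda>z. (1 + cnj a * z) / (1 - cnj a * z))"
  have F: "F holomorphic_on unit_disc"
    unfolding F_def by (intro holomorphic_intros) (use nz in auto)
  have "((\<lambda>t. F (?z t)) has_integral of_real (2 * pi) * F 0) {0..2 * pi}"
  \<comment> \<open>\<open>circle_Cauchy\<close> at w = 0 needs a positive radius, so the degenerate
    circle is treated as a constant integrand.\<close>
  proof (cases "r = 0")
    case True
    then show ?thesis
      using has_integral_const_real[of "F 0" 0 "2 * pi"] by (simp add: scaleR_conv_of_real)
  next
    case False
    then show ?thesis using circle_Cauchy[OF F, of 0 r] r by simp
  qed
  from has_integral_Re[OF this]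
  have "((\<lambda>t. Re (F (?z t))) has_integral 2 * pi) {0..2 * pi}"
    by (simp add: F_def)
  moreover have "Re (F (?z t)) = (1 - (cmod a * r)\<^sup>2) * (1 / (cmod (1 - cnj a * ?z t))\<^sup>2)" for t
  proof -
    define u where "u = cnj a * ?z t"
    have u: "cmod u = cmod a * r" using r by (simp add: u_def norm_mult)
    have "Re ((1 + u) / (1 - u)) = (1 - (cmod u)\<^sup>2) / (cmod (1 - u))\<^sup>2"
      unfolding Re_divide by (simp add: cmod_power2) (simp add: power2_eq_square algebra_simps)
    then show ?thesis by (simp add: F_def u_def[symmetric] u)
  qed
  ultimately have "((\<lambda>t. (1 - (cmod a * r)\<^sup>2) * (1 / (cmod (1 - cnj a * ?z t))\<^sup>2)) has_integral 2 * pi) {0..2 * pi}"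
    by simp
  from has_integral_mult_right[OF this, of "1 / (1 - (cmod a * r)\<^sup>2)"]
  show ?thesis
  proof -
    assume H: "((\<lambda>x. 1 / (1 - (cmod a * r)\<^sup>2) * ((1 - (cmod a * r)\<^sup>2) * (1 / (cmod (1 - cnj a * ?z x))\<^sup>2))) has_integral
       1 / (1 - (cmod a * r)\<^sup>2) * (2 * pi)) {0..2 * pi}"
    have "cmod a * r < 1" using small[of "of_real r"] r by (simp add: norm_mult)
    then have "1 - (cmod a * r)\<^sup>2 \<noteq> 0"
      using r by (smt (verit) norm_ge_zero mult_nonneg_nonneg power_less_one_iff zero_less_numeral pos2)
    then show ?thesis using H by simp
  qed
qed

section \<open>Growth of functions in the mixed-norm space\<close>

text \<open>Quasi-subadditivity for exponents on both sides of 1: the larger of the two arguments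
  carries the estimate. It replaces the triangle inequality in \<open>X_diff\<close>.\<close>

lemma powr_add_le:
  fixes x y e :: real
  assumes "0 \<le> x" "0 \<le> y" "0 < e"
  shows "(x + y) powr e \<le> 2 powr e * (x powr e + y powr e)"
proof -
  have "(x + y) powr e \<le> (2 * max x y) powr e"
    using assms by (intro powr_mono2) auto
  also have "\<dots> = 2 powr e * max x y powr e"
    using assms by (simp add: powr_mult)
  also have "max x y powr e \<le> x powr e + y powr e"
    by (auto simp: max_def)
  finally show ?thesis by simp
qed

lemma powr_le_powr_cancel:
  fixes x y e :: real
  assumes "x powr e \<le> y powr e" "0 \<le> x" "0 \<le> y" "0 < e"
  shows "x \<le> y"
  using assms powr_less_mono2[of e y x] by force

locale normal_weight =
  fixes p q a b :: real and \<phi> :: "real \<Rightarrow> real"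
  assumes p_pos: "p > 0" and q_pos: "q > 0" and a_pos: "a > 0" and ab: "a < b"
    and phi_cont: "continuous_on {0..<1} \<phi>" and phi_pos: "\<And>r. 0 \<le> r \<Longrightarrow> r < 1 \<Longrightarrow> \<phi> r > 0"
    and anti: "antimono_on {0..<1} (\<lambda>r. \<phi> r / (1 - r) powr a)"
    and mono: "mono_on {0..<1} (\<lambda>r. \<phi> r / (1 - r) powr b)"
begin

abbreviation "X \<equiv> mixed_norm_space p q \<phi>"
abbreviation "NX \<equiv> mixed_norm p q \<phi>"

text \<open>\<phi> decays at least like the power a of the distance to the boundary; the companion
  \<open>phi_lower\<close> says that it decays at most like the power b. These two comparisons are
  the form in which normality is applied.\<close>

lemma phi_upper:
  assumes "0 \<le> r" "r \<le> s" "s < 1"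
  shows "\<phi> s \<le> \<phi> r * ((1 - s) / (1 - r)) powr a"
proof -
  have "\<phi> s / (1 - s) powr a \<le> \<phi> r / (1 - r) powr a"
    using monotone_onD[OF anti, of r s] assms by auto
  then show ?thesis using assms by (simp add: powr_divide field_simps)
qed

lemma phi_lower:
  assumes "0 \<le> r" "r \<le> s" "s < 1"
  shows "\<phi> r \<le> \<phi> s * ((1 - r) / (1 - s)) powr b"
proof -
  have "\<phi> r / (1 - r) powr b \<le> \<phi> s / (1 - s) powr b"
    using monotone_onD[OF mono, of r s] assms by auto
  then show ?thesis using assms by (simp add: powr_divide field_simps)
qed

lemma phi_decreasing:
  assumes "0 \<le> r" "r \<le> s" "s < 1"
  shows "\<phi> s \<le> \<phi> r"
proof -
  have "((1 - s) / (1 - r)) powr a \<le> 1"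
    using assms a_pos by (intro powr_le1) auto
  then have "\<phi> r * ((1 - s) / (1 - r)) powr a \<le> \<phi> r"
    using phi_pos[of r] assms by (intro mult_left_le) auto
  then show ?thesis using phi_upper[OF assms] by linarith
qed

text \<open>A doubling property: halving the distance to the boundary changes \<phi> by a bounded
  factor only. It permits estimates at a slightly larger radius to be moved back.\<close>

lemma phi_midpoint:
  assumes "0 \<le> r" "r < 1"
  shows "\<phi> r \<le> \<phi> ((1 + r) / 2) * 2 powr b"
proof -
  have "(1 - r) / (1 - (1 + r) / 2) = 2" using assms by (simp add: field_simps)
  then show ?thesis using phi_lower[of r "(1 + r) / 2"] assms by simp
qed

lemma integrand_nonneg: "0 \<le> r \<Longrightarrow> r < 1 \<Longrightarrow> 0 \<le> mixed_norm_integrand p q \<phi> f r"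
  by (simp add: mixed_norm_integrand_def)

lemma norm_powr_p: "NX f powr p = (LBINT r:{0..<1}. mixed_norm_integrand p q \<phi> f r)"
proof -
  have "0 \<le> (LBINT r:{0..<1}. mixed_norm_integrand p q \<phi> f r)"
    unfolding set_lebesgue_integral_def
    by (intro Bochner_Integration.integral_nonneg) (auto simp: indicator_def integrand_nonneg)
  then show ?thesis using p_pos by (simp add: mixed_norm_def powr_powr)
qed

lemma norm_nonneg: "0 \<le> NX f"
  by (simp add: mixed_norm_def)

lemma X_holomorphic: "f \<in> X \<Longrightarrow> f holomorphic_on unit_disc"
  by (simp add: mixed_norm_space_def HD_def)

text \<open>The integrand is nonnegative and continuous on [0,1), hence measurable, so an integrable
  majorant yields membership and the norm bound at once.\<close>

lemma X_dominated:
  assumes f: "f \<in> HD" and H: "set_integrable lborel {0..<1} H"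
    and le: "\<And>r. 0 \<le> r \<Longrightarrow> r < 1 \<Longrightarrow> mixed_norm_integrand p q \<phi> f r \<le> H r"
  shows "f \<in> X" "NX f powr p \<le> (LBINT r:{0..<1}. H r)"
proof -
  have fc: "continuous_on unit_disc f"
    using f by (auto simp: HD_def intro: holomorphic_on_imp_continuous_on)
  have "continuous_on {0..<1} (mixed_norm_integrand p q \<phi> f)"
    unfolding mixed_norm_integrand_def using p_pos
    by (intro continuous_intros continuous_on_powr' phi_cont continuous_on_integral_mean[OF fc q_pos] ballI)
       (auto simp: integral_mean_nonneg dest: phi_pos)
  then have meas: "set_borel_measurable lborel {0..<1} (mixed_norm_integrand p q \<phi> f)"
    unfolding set_borel_measurable_def
    by (simp add: borel_measurable_continuous_on_indicator del: real_scaleR_def)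
  have int: "set_integrable lborel {0..<1} (mixed_norm_integrand p q \<phi> f)"
    by (rule set_integrable_bound[OF H meas]) (use le integrand_nonneg in force)
  then show "f \<in> X" using f by (simp add: mixed_norm_space_def)
  show "NX f powr p \<le> (LBINT r:{0..<1}. H r)"
    unfolding norm_powr_p by (rule set_integral_mono[OF int H]) (use le in auto)
qed

text \<open>The weighted maximum \<open>K\<close> of \<open>(R - |z|) ^ \<beta> |f z|\<close> over an annulus absorbs the factor
  \<open>A powr (m - q)\<close> of \<open>Cauchy_power_bound\<close>, so that no monotonicity of the integral means is needed.\<close>

lemma growth:
  "\<exists>C>0. \<forall>f\<in>X. \<forall>w\<in>unit_disc. cmod (f w) * \<phi> (cmod w) * (1 - cmod w) powr (1 / q) \<le> C * NX f"
proof -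
  define m where "m = nat \<lceil>q\<rceil> + 1"
  \<comment> \<open>The exponent satisfies \<open>\<beta> * p = p / q + 1\<close>. The part p / q
    cancels the negative power of d produced by the Cauchy estimate; the remaining single factor d
    is matched by the length d / 4 of the interval of radii over which the mean is
    integrated.\<close>
  define \<beta> where "\<beta> = 1 / q + 1 / p"
  define c where "c = (4 * 2 powr (\<beta> * (real m - q))) powr (p / q)"
  define C where "C = 2 powr b * (4 * c * 2 powr (\<beta> * p)) powr (1 / p)"
  have qm: "q < real m" unfolding m_def by linarith
  have \<beta>: "\<beta> > 0" "\<beta> * p = p / q + 1" using p_pos q_pos by (auto simp: \<beta>_def field_simps add_pos_pos)
  have c: "c > 0" by (simp add: c_def)
  have "cmod (f w) * \<phi> (cmod w) * (1 - cmod w) powr (1 / q) \<le> C * NX f"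
    if f: "f \<in> X" and w: "w \<in> unit_disc" for f w
  proof -
    have hol: "f holomorphic_on unit_disc" using X_holomorphic[OF f] .
    define \<rho> where "\<rho> = cmod w"
    define R where "R = (1 + \<rho>) / 2"
    have \<rho>: "0 \<le> \<rho>" "\<rho> < 1" "\<rho> < R" "R < 1" "R - \<rho> = (1 - \<rho>) / 2"
      using w by (auto simp: \<rho>_def R_def field_simps)
    \<comment> \<open>Circles slightly larger than the one through the maximum point still lie in
      this annulus, so maximality of h bounds f on them. Starting the annulus at |w| ensures 1 - s
      \<le> 1 - |w| for all radii s in use.\<close>
    define An where "An = cball 0 R - ball (0::complex) \<rho>"
    define h where "h = (\<lambda>z. (R - cmod z) powr \<beta> * cmod (f z))"
    have wA: "w \<in> An" using \<rho> by (auto simp: An_def \<rho>_def)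
    have "compact An" unfolding An_def by (intro compact_diff) auto
    moreover have "continuous_on An h"
      unfolding h_def using \<beta> \<rho>
      by (intro continuous_intros continuous_on_powr' continuous_on_subset[OF holomorphic_on_imp_continuous_on[OF hol]])
         (auto simp: An_def)
    ultimately obtain z0 where z0: "z0 \<in> An" "\<And>z. z \<in> An \<Longrightarrow> h z \<le> h z0"
      using continuous_attains_sup[of An h] wA by auto
    define K where "K = h z0"
    have hw: "h w \<le> K" using z0(2)[OF wA] by (simp add: K_def)
    have hw_eq: "h w = ((1 - \<rho>) / 2) powr \<beta> * cmod (f w)"
    proof -
      have "R - cmod w = (1 - \<rho>) / 2" using \<rho>(5) by (simp only: \<rho>_def)
      then show ?thesis by (simp only: h_def)
    qed
    have K0: "0 \<le> K" by (simp add: K_def h_def)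
    define I where "I = (LBINT r:{0..<1}. mixed_norm_integrand p q \<phi> f r)"
    have I: "NX f powr p = I" "0 \<le> I" unfolding I_def norm_powr_p[symmetric] by auto
    have main: "K powr p * \<phi> R powr p \<le> 4 * c * (1 - \<rho>) * I"
    proof (cases "K = 0")
      case True
      then show ?thesis using I c \<rho> p_pos by (simp add: powr_def)
    next
      case False
      then have K: "K > 0" using K0 by simp
      define r where "r = cmod z0"
      have r: "\<rho> \<le> r" "r < R"
        using z0(1) K by (auto simp: An_def r_def K_def h_def less_le)
      define d where "d = R - r"
      have d: "d > 0" "r + d = R" using r by (auto simp: d_def)
      define v where "v = cmod (f z0)"
      have Kv: "K = d powr \<beta> * v" by (simp add: K_def h_def d_def r_def v_def)
      have v: "v > 0" using K Kv d by (simp add: zero_less_mult_iff)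
      \<comment> \<open>The left end of the interval keeps s - |z0| \<ge> d / 4, which controls the
        Cauchy kernel. The right end keeps R - s \<ge> d / 2, so that maximality gives |f| \<le> 2
        powr \<beta> * v on the circle of radius s.\<close>
      have low: "K powr p \<le> c * d * integral_mean q f s powr p" if s: "s \<in> {r + d / 4..r + d / 2}" for s
      proof -
        have s': "\<rho> \<le> s" "s < R" "d / 2 \<le> R - s" "d / 4 \<le> s - r" "cmod z0 < s" "s < 1"
          using s r d \<rho>(1-4) unfolding r_def[symmetric] atLeastAtMost_iff by linarith+
        define A where "A = v * 2 powr \<beta>"
        have A: "cmod (f z) \<le> A" if "cmod z = s" for z
        proof -
          have "(d / 2) powr \<beta> * cmod (f z) \<le> (R - s) powr \<beta> * cmod (f z)"
            using d s' \<beta> by (intro mult_right_mono powr_mono2) auto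
          also have "\<dots> = h z" using that by (simp add: h_def)
          also have "\<dots> \<le> K" unfolding K_def using that s' by (intro z0(2)) (auto simp: An_def)
          finally have "d powr \<beta> * cmod (f z) \<le> d powr \<beta> * A"
            using d by (simp add: powr_divide Kv A_def field_simps)
          then show ?thesis using d by simp
        qed
        define M where "M = integral_mean q f s"
        have "v ^ m \<le> A powr (real m - q) / (s - cmod z0) * M powr q"
          unfolding v_def M_def by (rule Cauchy_power_bound[OF hol q_pos qm s'(5,6) A])
        also have "\<dots> \<le> A powr (real m - q) / (d / 4) * M powr q"
          using d s' by (intro mult_right_mono divide_left_mono mult_pos_pos) (auto simp: r_def)
        also have "\<dots> = v powr (real m - q) * (4 * 2 powr (\<beta> * (real m - q)) / d * M powr q)"
          using v by (simp add: A_def powr_mult powr_powr)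
        also have "v ^ m = v powr (real m - q) * v powr q"
          \<comment> \<open>Since A is a multiple of v, the factor v powr (m - q) appears on both
            sides and cancels, which leaves the genuine exponent q.\<close>
          using v by (simp flip: powr_add powr_realpow)
        finally have "v powr q \<le> 4 * 2 powr (\<beta> * (real m - q)) / d * M powr q"
          using v by (simp del: times_divide_eq_left times_divide_eq_right)
        then have "(v powr q) powr (p / q) \<le> (4 * 2 powr (\<beta> * (real m - q)) / d * M powr q) powr (p / q)"
          using p_pos q_pos by (intro powr_mono2) auto
        also have "\<dots> = c * d powr - (p / q) * M powr p"
          using q_pos d by (simp add: c_def powr_mult powr_divide powr_powr powr_minus field_simps)
        also have "(v powr q) powr (p / q) = v powr p"
          using q_pos by (simp add: powr_powr)
        finally have vp: "v powr p \<le> c * d powr - (p / q) * M powr p" .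
        have "K powr p = d powr (p / q + 1) * v powr p"
          using v d \<beta>(2) by (simp add: Kv powr_mult powr_powr)
        also have "\<dots> \<le> d powr (p / q + 1) * (c * d powr - (p / q) * M powr p)"
          by (intro mult_left_mono vp) auto
        also have "\<dots> = c * (d powr (p / q + 1) * d powr - (p / q)) * M powr p"
          by simp
        also have "d powr (p / q + 1) * d powr - (p / q) = d"
          using d by (simp flip: powr_add)
        finally show ?thesis by (simp add: M_def)
      qed
      \<comment> \<open>A constant minorant of the mixed-norm integrand on the whole interval of
        radii: \<open>low\<close> for the mean, \<phi> R \<le> \<phi> s, and 1 - s \<le> 1 -
        |w|.\<close>
      define \<kappa> where "\<kappa> = K powr p / (c * d) * (\<phi> R powr p / (1 - \<rho>))"
      have ge: "\<kappa> \<le> mixed_norm_integrand p q \<phi> f s" if s: "s \<in> {r + d / 4..r + d / 2}" for s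
        unfolding \<kappa>_def mixed_norm_integrand_def
      proof (intro mult_mono frac_le powr_mono2)
        show "K powr p / (c * d) \<le> integral_mean q f s powr p"
          using low[OF s] c d by (simp add: field_simps)
        have s': "0 \<le> s" "s \<le> R" "s < 1" "\<rho> \<le> s"
          using s r d \<rho>(1-4) unfolding atLeastAtMost_iff by linarith+
        then show "\<phi> R \<le> \<phi> s"
          using \<rho>(4) by (intro phi_decreasing)
        show "0 < 1 - s" "1 - s \<le> 1 - \<rho>"
          using s' by auto
      qed (use p_pos \<rho> phi_pos[of R] in auto)
      have sub: "{r + d / 4..r + d / 2} \<subseteq> {0..<1}"
      proof
        fix s assume "s \<in> {r + d / 4..r + d / 2}"
        then have "0 \<le> s" "s < 1" using r d \<rho>(1-4) unfolding atLeastAtMost_iff by linarith+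
        then show "s \<in> {0..<1}" by simp
      qed
      have "\<kappa> * (d / 4) = (LBINT s:{r + d / 4..r + d / 2}. \<kappa>)"
        using d by (subst set_integral_const) (auto simp: field_simps)
      also have "\<dots> \<le> I"
        unfolding I_def set_lebesgue_integral_def
      proof (rule integral_mono)
        show "integrable lborel (\<lambda>s. indicat_real {r + d / 4..r + d / 2} s *\<^sub>R \<kappa>)"
          using borel_integrable_atLeastAtMost'[of "r + d / 4" "r + d / 2" "\<lambda>_. \<kappa>"]
          by (simp add: set_integrable_def)
        show "integrable lborel (\<lambda>r. indicat_real {0..<1} r *\<^sub>R mixed_norm_integrand p q \<phi> f r)"
          using f by (simp add: mixed_norm_space_def set_integrable_def)
        show "indicat_real {r + d / 4..r + d / 2} s *\<^sub>R \<kappa>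
            \<le> indicat_real {0..<1} s *\<^sub>R mixed_norm_integrand p q \<phi> f s" for s
          using ge[of s] sub integrand_nonneg[of s f] by (auto simp: indicator_def)
      qed
      finally have "\<kappa> * (d / 4) \<le> I" .
      moreover have "\<kappa> * (d / 4) = K powr p * \<phi> R powr p / (4 * c * (1 - \<rho>))"
        using d c \<rho> by (simp add: \<kappa>_def field_simps)
      ultimately have "K powr p * \<phi> R powr p / (4 * c * (1 - \<rho>)) \<le> I" by linarith
      moreover have "0 < 4 * c * (1 - \<rho>)" using c \<rho>(2) by simp
      ultimately show ?thesis
        by (simp add: pos_divide_le_eq mult_ac)
    qed
    define x where "x = cmod (f w) * \<phi> R * (1 - \<rho>) powr (1 / q)"
    have \<phi>R: "\<phi> R > 0" using \<rho> by (intro phi_pos) auto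
    have x0: "0 \<le> x" using \<phi>R by (simp add: x_def)
    have "(1 - \<rho>) * x powr p = (((1 - \<rho>) powr \<beta> * cmod (f w)) powr p * \<phi> R powr p)"
    proof -
      have "((1 - \<rho>) powr \<beta>) powr p = (1 - \<rho>) * (1 - \<rho>) powr (p / q)"
        using \<rho> \<beta>(2) by (simp add: powr_powr powr_add)
      then show ?thesis
        using \<rho> \<phi>R by (simp add: x_def powr_mult powr_powr)
    qed
    also have "(1 - \<rho>) powr \<beta> = 2 powr \<beta> * ((1 - \<rho>) / 2) powr \<beta>"
      using \<rho> by (simp add: powr_divide)
    also have "((2 powr \<beta> * ((1 - \<rho>) / 2) powr \<beta> * cmod (f w)) powr p * \<phi> R powr p)
        = 2 powr (\<beta> * p) * (h w powr p * \<phi> R powr p)"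
      by (simp add: hw_eq powr_mult powr_powr)
    also have "\<dots> \<le> 2 powr (\<beta> * p) * (K powr p * \<phi> R powr p)"
      using hw p_pos by (intro mult_left_mono mult_right_mono powr_mono2) (auto simp: h_def)
    also have "\<dots> \<le> 2 powr (\<beta> * p) * (4 * c * (1 - \<rho>) * I)"
      using main by (intro mult_left_mono) auto
    also have "\<dots> = (1 - \<rho>) * (4 * c * 2 powr (\<beta> * p) * I)" by simp
    finally have "x powr p \<le> 4 * c * 2 powr (\<beta> * p) * I"
      using \<rho> by simp
    also have "\<dots> = ((4 * c * 2 powr (\<beta> * p)) powr (1 / p) * NX f) powr p"
      using p_pos c by (simp add: powr_mult powr_powr norm_nonneg I(1))
    finally have "x \<le> (4 * c * 2 powr (\<beta> * p)) powr (1 / p) * NX f"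
      using x0 p_pos norm_nonneg by (elim powr_le_powr_cancel) auto
    then have "2 powr b * x \<le> C * NX f"
      by (simp add: C_def)
    \<comment> \<open>The integral estimate involves \<phi> at R instead of |w|; the doubling
      property moves it back.\<close>
    moreover have "cmod (f w) * \<phi> \<rho> * (1 - \<rho>) powr (1 / q) \<le> 2 powr b * x"
    proof -
      have "(cmod (f w) * (1 - \<rho>) powr (1 / q)) * \<phi> \<rho> \<le> (cmod (f w) * (1 - \<rho>) powr (1 / q)) * (\<phi> R * 2 powr b)"
        using phi_midpoint[of \<rho>] \<rho> by (intro mult_left_mono) (auto simp: R_def)
      then show ?thesis by (simp add: x_def mult_ac)
    qed
    ultimately show ?thesis unfolding \<rho>_def by linarith
  qed
  moreover have "C > 0" using c by (simp add: C_def)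
  ultimately show ?thesis by blast
qed

text \<open>Cauchy's inequality on the disc about w whose radius is half the distance to the
  boundary: each derivative costs one factor 1 / (1 - |w|), and the weight at the largest modulus t
  on that disc is comparable with the weight at |w|.\<close>

lemma deriv_growth:
  "\<exists>C>0. \<forall>f\<in>X. \<forall>w\<in>unit_disc.
     cmod ((deriv ^^ k) f w) * (\<phi> (cmod w) * (1 - cmod w) powr (1 / q + real k)) \<le> C * NX f"
proof -
  obtain C0 where C0: "C0 > 0" and gr: "\<And>f w. f \<in> X \<Longrightarrow> w \<in> unit_disc \<Longrightarrow>
      cmod (f w) * \<phi> (cmod w) * (1 - cmod w) powr (1 / q) \<le> C0 * NX f"
    using growth by blast
  define C where "C = fact k * 2 powr b * 2 powr (1 / q) * 2 ^ k * C0"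
  have "cmod ((deriv ^^ k) f w) * (\<phi> (cmod w) * (1 - cmod w) powr (1 / q + real k)) \<le> C * NX f"
    if f: "f \<in> X" and w: "w \<in> unit_disc" for f w
  proof -
    define \<rho> where "\<rho> = cmod w"
    define t where "t = (1 + \<rho>) / 2"
    define e where "e = (1 - \<rho>) / 2"
    have \<rho>: "0 \<le> \<rho>" "\<rho> < 1" "e > 0" "\<rho> + e = t" "t < 1" "1 - t = e" "1 - \<rho> = 2 * e"
      using w by (auto simp: \<rho>_def t_def e_def field_simps)
    \<comment> \<open>The growth bound evaluated at the largest modulus t. It holds on the whole
      circle because both \<phi> and the power of 1 - |x| decrease with |x|.\<close>
    define B where "B = C0 * NX f / (\<phi> t * e powr (1 / q))"
    have \<phi>t: "\<phi> t > 0" using \<rho> by (intro phi_pos) auto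
    have sub: "cball w e \<subseteq> unit_disc"
    proof
      fix x assume "x \<in> cball w e"
      then have "cmod (x - w) \<le> e" by (simp add: dist_norm norm_minus_commute)
      then have "cmod x \<le> \<rho> + e" using norm_triangle_sub[of x w] by (simp add: \<rho>_def)
      then show "x \<in> unit_disc" using \<rho> by simp
    qed
    have "cmod ((deriv ^^ k) f w) \<le> fact k * B / e ^ k"
    proof (rule Cauchy_inequality)
      show "f holomorphic_on ball w e"
        using X_holomorphic[OF f] sub by (meson ball_subset_cball holomorphic_on_subset order_trans)
      show "continuous_on (cball w e) f"
        using holomorphic_on_imp_continuous_on[OF X_holomorphic[OF f]] sub by (rule continuous_on_subset)
      show "cmod (f x) \<le> B" if "cmod (w - x) = e" for x
      proof -
        have x: "x \<in> unit_disc" using sub that by (auto simp: dist_norm)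
        have xt: "cmod x \<le> t" using norm_triangle_sub[of x w] that \<rho> by (simp add: \<rho>_def norm_minus_commute)
        have "cmod (f x) * (\<phi> t * e powr (1 / q)) \<le> cmod (f x) * (\<phi> (cmod x) * (1 - cmod x) powr (1 / q))"
          using xt \<rho> \<phi>t q_pos phi_decreasing[of "cmod x" t]
          by (intro mult_left_mono mult_mono powr_mono2) auto
        also have "\<dots> \<le> C0 * NX f" using gr[OF f x] by (simp add: mult_ac)
        finally show ?thesis using \<phi>t \<rho> by (simp add: B_def field_simps)
      qed
    qed fact
    also have "\<dots> = fact k * C0 * NX f / (\<phi> t * e powr (1 / q + real k))"
      using \<rho> by (simp add: B_def powr_add powr_realpow)
    finally have "cmod ((deriv ^^ k) f w) * (\<phi> t * e powr (1 / q + real k)) \<le> fact k * C0 * NX f"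
      using \<phi>t \<rho> by (simp add: field_simps)
    moreover have "\<phi> \<rho> * (1 - \<rho>) powr (1 / q + real k) \<le>
      (2 powr b * 2 powr (1 / q) * 2 ^ k) * (\<phi> t * e powr (1 / q + real k))"
    proof -
      have "\<phi> \<rho> * (1 - \<rho>) powr (1 / q + real k) \<le> (\<phi> t * 2 powr b) * (1 - \<rho>) powr (1 / q + real k)"
        using phi_midpoint[of \<rho>] \<rho> by (intro mult_right_mono) (auto simp: t_def)
      also have "\<dots> = (2 powr b * 2 powr (1 / q) * 2 ^ k) * (\<phi> t * e powr (1 / q + real k))"
        unfolding \<rho>(7) using \<rho>(3) by (simp add: powr_mult powr_add powr_realpow)
      finally show ?thesis .
    qed
    ultimately have "cmod ((deriv ^^ k) f w) * (\<phi> \<rho> * (1 - \<rho>) powr (1 / q + real k)) \<le>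
      (2 powr b * 2 powr (1 / q) * 2 ^ k) * (fact k * C0 * NX f)"
      by (smt (verit) mult_left_mono mult.left_commute norm_ge_zero powr_ge_zero zero_le_power mult_nonneg_nonneg)
    then show ?thesis by (simp add: C_def \<rho>_def mult_ac)
  qed
  moreover have "C > 0" using C0 by (simp add: C_def)
  ultimately show ?thesis by blast
qed

end

section \<open>Test functions\<close>

text \<open>With \<open>D = 1 - |u|\<close> this profile dominates the integrand of the mixed norm of a kernel at \<open>u\<close> on both
  sides of \<open>r = |u|\<close>; it has the primitive \<open>- ((1 - r) / (1 - r + D)) powr \<alpha> / \<alpha>\<close>.\<close>

lemma profile_integral:
  fixes D \<alpha> :: real
  assumes D: "D > 0" and \<alpha>: "\<alpha> > 0"
  defines "H \<equiv> \<lambda>r. D * (1 - r) powr (\<alpha> - 1) / (1 - r + D) powr (\<alpha> + 1)"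
  shows "set_integrable lborel {0..<1} H" "(LBINT r:{0..<1}. H r) \<le> 1 / \<alpha>"
proof -
  define F where "F = (\<lambda>r. - (((1 - r) / (1 - r + D)) powr \<alpha>) / \<alpha>)"
  have H0: "0 \<le> H r" if "r \<le> 1" for r using that D by (simp add: H_def)
  \<comment> \<open>The fundamental theorem is applied on the open interval (-1,1), which contains
    the half-open range of radii; nonnegativity of H makes this enlargement harmless.\<close>
  have "((\<lambda>r. (1 - r) / (1 - r + D)) \<longlongrightarrow> (1 - 1) / (1 - 1 + D)) (at_left 1)"
    "((\<lambda>r. (1 - r) / (1 - r + D)) \<longlongrightarrow> (1 - (-1)) / (1 - (-1) + D)) (at_right (-1))"
    using D by (intro tendsto_intros; simp)+
  then have "((\<lambda>r. ((1 - r) / (1 - r + D)) powr \<alpha>) \<longlongrightarrow> 0 powr \<alpha>) (at_left 1)"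
    "((\<lambda>r. ((1 - r) / (1 - r + D)) powr \<alpha>) \<longlongrightarrow> (2 / (2 + D)) powr \<alpha>) (at_right (-1))"
    using D \<alpha> by (intro tendsto_powr'[OF _ tendsto_const];
      auto simp: eventually_at_left_field intro!: exI[of _ 0])+
  then have lim: "(F \<longlongrightarrow> - (0 powr \<alpha>) / \<alpha>) (at_left 1)"
    "(F \<longlongrightarrow> - ((2 / (2 + D)) powr \<alpha>) / \<alpha>) (at_right (-1))"
    unfolding F_def using \<alpha> by (auto intro!: tendsto_divide tendsto_minus simp del: powr_0 minus_divide_left)
  have deriv: "DERIV F r :> H r" if "r < 1" for r
  proof -
    have pos: "0 < 1 - r" "0 < 1 - r + D" "0 < (1 - r) / (1 - r + D)" using that D by auto
    have "((\<lambda>r. (1 - r) / (1 - r + D)) has_real_derivative - D / (1 - r + D)\<^sup>2) (at r)"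
      using pos by (auto intro!: derivative_eq_intros simp: power2_eq_square field_simps)
    from DERIV_fun_powr[OF this pos(3), of \<alpha>]
    have "((\<lambda>r. ((1 - r) / (1 - r + D)) powr \<alpha>) has_real_derivative
       \<alpha> * ((1 - r) / (1 - r + D)) powr (\<alpha> - 1) * (- D / (1 - r + D)\<^sup>2)) (at r)" by simp
    then have "DERIV F r :> - (\<alpha> * ((1 - r) / (1 - r + D)) powr (\<alpha> - 1) * (- D / (1 - r + D)\<^sup>2)) / \<alpha>"
      unfolding F_def by (intro DERIV_cdivide DERIV_minus)
    moreover have "- (\<alpha> * ((1 - r) / (1 - r + D)) powr (\<alpha> - 1) * (- D / (1 - r + D)\<^sup>2)) / \<alpha> = H r"
    proof -
      have "(1 - r + D) powr (\<alpha> + 1) = (1 - r + D) powr (\<alpha> - 1) * (1 - r + D)\<^sup>2"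
        using pos powr_add[of "1 - r + D" "\<alpha> - 1" 2] by (simp add: add.commute)
      then show ?thesis using pos \<alpha> by (simp add: H_def powr_divide)
    qed
    ultimately show ?thesis by simp
  qed
  have cont: "isCont H x" if "- 1 < ereal x" "ereal x < 1" for x
    using that D unfolding H_def by (intro continuous_intros) auto
  have AE: "AE x in lborel. - 1 < ereal x \<longrightarrow> ereal x < 1 \<longrightarrow> 0 \<le> H x"
    using H0 by (auto intro!: AE_I2)
  have lims: "((F \<circ> real_of_ereal) \<longlongrightarrow> - ((2 / (2 + D)) powr \<alpha>) / \<alpha>) (at_right (- 1))"
    "((F \<circ> real_of_ereal) \<longlongrightarrow> - (0 powr \<alpha>) / \<alpha>) (at_left 1)"
    using lim ereal_tendsto_simps(1)[of F _ 1] ereal_tendsto_simps(2)[of F _ "-1"]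
    by (simp_all add: one_ereal_def)
  have deriv': "DERIV F x :> H x" if "- 1 < ereal x" "ereal x < 1" for x
    using that deriv by simp
  have "(- 1 :: ereal) < 1" by (simp add: one_ereal_def)
  note FTC_raw = interval_integral_FTC_nonneg[OF this _ _ AE lims]
  have FTC: "set_integrable lborel (einterval (-1) 1) H"
    "(LBINT x=-1..1. H x) = - (0 powr \<alpha>) / \<alpha> - (- ((2 / (2 + D)) powr \<alpha>) / \<alpha>)"
    by (rule FTC_raw; use deriv' cont in blast)+
  show int: "set_integrable lborel {0..<1} H"
    by (rule set_integrable_subset[OF FTC(1)]) (auto simp: einterval_iff one_ereal_def)
  have "(LBINT r:{0..<1}. H r) \<le> (LBINT r:einterval (-1) 1. H r)"
    unfolding set_lebesgue_integral_def
    using int FTC(1) H0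
    by (intro integral_mono) (auto simp: set_integrable_def indicator_def einterval_iff one_ereal_def)
  also have "\<dots> = (LBINT x=-1..1. H x)"
    by (simp add: interval_lebesgue_integral_def one_ereal_def)
  also have "\<dots> = (2 / (2 + D)) powr \<alpha> / \<alpha>"
    unfolding FTC(2) by simp
  also have "\<dots> \<le> 1 / \<alpha>"
    using D \<alpha> by (intro divide_right_mono powr_le1) auto
  finally show "(LBINT r:{0..<1}. H r) \<le> 1 / \<alpha>" .
qed

lemma disc_kernel_nonzero:
  assumes "u \<in> unit_disc" "cmod z \<le> 1"
  shows "1 - cnj u * z \<noteq> 0"
proof -
  have "cmod (cnj u * z) < 1"
    using assms mult_left_le[of "cmod z" "cmod u"] by (simp add: norm_mult)
  then show ?thesis by (metis norm_one less_irrefl right_minus_eq)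
qed

lemma deriv_kernel:
  fixes \<nu> z c :: complex
  assumes "1 - \<nu> * z \<noteq> 0"
  shows "((\<lambda>z. c / (1 - \<nu> * z) ^ M) has_field_derivative c * of_nat M * \<nu> / (1 - \<nu> * z) ^ Suc M) (at z)"
proof -
  have "((\<lambda>z. c * inverse (1 - \<nu> * z) ^ M) has_field_derivative
      c * (of_nat M * (\<nu> * inverse (1 - \<nu> * z) ^ 2 * inverse (1 - \<nu> * z) ^ (M - 1)))) (at z)"
    using assms by (auto intro!: derivative_eq_intros simp: power2_eq_square)
  moreover have "c * (of_nat M * (\<nu> * inverse (1 - \<nu> * z) ^ 2 * inverse (1 - \<nu> * z) ^ (M - 1)))
      = c * of_nat M * \<nu> / (1 - \<nu> * z) ^ Suc M"
    using assms by (cases M) (simp_all add: field_simps power2_eq_square)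
  moreover have "(\<lambda>z. c * inverse (1 - \<nu> * z) ^ M) = (\<lambda>z. c / (1 - \<nu> * z) ^ M)"
    by (simp add: divide_inverse power_inverse)
  ultimately show ?thesis by (simp only:)
qed

section \<open>Normalised kernels and their uniform boundedness\<close>

context normal_weight
begin

text \<open>At z = u the modulus is (1 - |u|^2) powr (-1 / q) / \<phi>(|u|), the largest order that
  \<open>growth\<close> allows, whatever N is; a larger N only concentrates the kernel more strongly
  near u. The cut-off outside the disc matches the convention of \<open>HD\<close>.\<close>

definition kernel :: "nat \<Rightarrow> complex \<Rightarrow> complex \<Rightarrow> complex" where
  "kernel N u z = (if z \<in> unit_disc
     then of_real ((1 - (cmod u)\<^sup>2) powr (real N - 1 / q) / \<phi> (cmod u)) / (1 - cnj u * z) ^ N else 0)"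

lemma kernel_HD:
  assumes "u \<in> unit_disc"
  shows "kernel N u \<in> HD"
proof -
  have "(\<lambda>z. of_real ((1 - (cmod u)\<^sup>2) powr (real N - 1 / q) / \<phi> (cmod u)) / (1 - cnj u * z) ^ N) holomorphic_on unit_disc"
    using disc_kernel_nonzero[OF assms] by (intro holomorphic_intros) auto
  then have "kernel N u holomorphic_on unit_disc"
    by (rule holomorphic_transform) (simp add: kernel_def)
  then show ?thesis by (auto simp: HD_def kernel_def)
qed

lemma kernel_higher_deriv:
  assumes u: "u \<in> unit_disc" and z: "z \<in> unit_disc"
  shows "(deriv ^^ k) (kernel N u) z =
    of_real ((1 - (cmod u)\<^sup>2) powr (real N - 1 / q) / \<phi> (cmod u)) * pochhammer (of_nat N) k * cnj u ^ k
      / (1 - cnj u * z) ^ (N + k)"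
  using z
proof (induction k arbitrary: z)
  case 0
  then show ?case by (simp add: kernel_def)
next
  case (Suc k)
  let ?c = "of_real ((1 - (cmod u)\<^sup>2) powr (real N - 1 / q) / \<phi> (cmod u)) * pochhammer (of_nat N) k * cnj u ^ k"
  have "1 - cnj u * z \<noteq> 0" using disc_kernel_nonzero[OF u, of z] Suc.prems by simp
  from deriv_kernel[OF this, of ?c "N + k"]
  have "((deriv ^^ k) (kernel N u) has_field_derivative
      ?c * of_nat (N + k) * cnj u / (1 - cnj u * z) ^ Suc (N + k)) (at z)"
    by (rule has_field_derivative_transform_within_open[where S = unit_disc])
       (use Suc in auto)
  from DERIV_imp_deriv[OF this] show ?case
    by (simp add: pochhammer_Suc mult_ac)
qed

text \<open>Two of the N q powers of 1 / |1 - cnj u z| are integrated exactly as a Poisson kernel;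
  the other N q - 2 are bounded through |1 - cnj u z| \<ge> 1 - |u| r. The Poisson integral costs
  only one further power of 1 / (1 - |u| r), whence the exponent 1 - N q.\<close>

lemma kernel_integral_mean:
  assumes u: "u \<in> unit_disc" and r: "0 \<le> r" "r < 1" and N: "real N * q \<ge> 2"
  shows "integral_mean q (kernel N u) r powr q \<le>
    ((1 - (cmod u)\<^sup>2) powr (real N - 1 / q) / \<phi> (cmod u)) powr q * (1 - cmod u * r) powr (1 - real N * q)"
proof -
  define A where "A = (1 - (cmod u)\<^sup>2) powr (real N - 1 / q) / \<phi> (cmod u)"
  define E where "E = 1 - cmod u * r"
  let ?z = "\<lambda>t::real. of_real r * exp (\<i> * of_real t) :: complex"
  let ?P = "\<lambda>t. 1 / (cmod (1 - cnj u * ?z t))\<^sup>2"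
  have A: "A \<ge> 0" using phi_pos[of "cmod u"] u by (simp add: A_def)
  have ur: "cmod u * r < 1" "0 \<le> cmod u * r"
    using u r mult_left_le[of r "cmod u"] by auto
  then have E: "E > 0" by (simp add: E_def)
  have zd: "?z t \<in> unit_disc" for t by (rule circle_mem_disc[OF r])
  have pt: "cmod (kernel N u (?z t)) powr q \<le> A powr q * E powr (2 - real N * q) * ?P t" for t
  proof -
    define x where "x = cmod (1 - cnj u * ?z t)"
    have xE: "E \<le> x"
      using norm_triangle_ineq2[of 1 "cnj u * ?z t"] r by (simp add: x_def E_def norm_mult)
    then have x: "x > 0" using E by simp
    have "cmod (kernel N u (?z t)) = A / x ^ N"
      using zd[of t] A by (simp add: kernel_def norm_divide norm_power x_def A_def[symmetric])
    then have "cmod (kernel N u (?z t)) powr q = A powr q * x powr (- (real N * q))"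
    proof -
      have "A / x ^ N = A * x powr (- real N)" using x by (simp add: powr_minus_divide powr_realpow)
      then show ?thesis using \<open>cmod (kernel N u (?z t)) = A / x ^ N\<close> by (simp add: powr_mult powr_powr)
    qed
    also have "x powr (- (real N * q)) = x powr (2 - real N * q) * (1 / x\<^sup>2)"
      using x by (simp add: powr_diff powr_minus field_simps)
    also have "A powr q * (x powr (2 - real N * q) * (1 / x\<^sup>2)) \<le> A powr q * (E powr (2 - real N * q) * (1 / x\<^sup>2))"
      using E xE N by (intro mult_left_mono mult_right_mono powr_mono2') auto
    finally show ?thesis by (simp add: x_def)
  qed
  have holo: "kernel N u holomorphic_on unit_disc" using kernel_HD[OF u] by (simp add: HD_def)
  note int = set_borel_integral_eq_integral[OF circle_set_integrable[OF holomorphic_on_imp_continuous_on[OF holo] q_pos r]]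
  have P: "(?P has_integral 2 * pi / (1 - (cmod u * r)\<^sup>2)) {0..2 * pi}"
    using Poisson_kernel_integral[of u r] u r by simp
  have "integral {0..2 * pi} (\<lambda>t. cmod (kernel N u (?z t)) powr q)
      \<le> integral {0..2 * pi} (\<lambda>t. A powr q * E powr (2 - real N * q) * ?P t)"
    by (intro integral_le int(1) integrable_on_mult_right has_integral_integrable[OF P]) (use pt in auto)
  also have "\<dots> = A powr q * E powr (2 - real N * q) * (2 * pi / (1 - (cmod u * r)\<^sup>2))"
    using integral_unique[OF has_integral_mult_right[OF P]] .
  also have "\<dots> \<le> A powr q * E powr (2 - real N * q) * (2 * pi / E)"
  proof -
    have "(cmod u * r)\<^sup>2 \<le> cmod u * r"
      using ur by (simp add: power2_eq_square mult_left_le)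
    then show ?thesis
      using E by (intro mult_left_mono divide_left_mono mult_pos_pos) (auto simp: E_def)
  qed
  also have "E powr (2 - real N * q) = E powr (1 - real N * q) * E"
    using E by (simp add: powr_diff power2_eq_square)
  finally show ?thesis
    unfolding integral_mean_powr_q[OF q_pos] int(2) A_def[symmetric] E_def[symmetric]
    using E by (simp add: field_simps)
qed

text \<open>With E = 1 - |u| r, which is at least D and at least 1 - r, the integrand is at most 2
  powr c times (D / E) powr c * (\<phi> r / \<phi> |u|) powr p / (1 - r). The two sides of r = |u|
  use opposite comparisons of \<phi> and meet in one profile, because 1 - r + D is comparable with
  the larger of 1 - r and D.\<close>

lemma kernel_integrand:
  assumes u: "u \<in> unit_disc" and r: "0 \<le> r" "r < 1" and N: "real N * q \<ge> 2"
    and N': "p * (real N - 1 / q) \<ge> b * p + 1"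
  defines "c \<equiv> p * (real N - 1 / q)" and "\<alpha> \<equiv> a * p" and "D \<equiv> 1 - cmod u"
  shows "mixed_norm_integrand p q \<phi> (kernel N u) r \<le>
    2 powr c * 2 powr (\<alpha> + 1) * (D * (1 - r) powr (\<alpha> - 1) / (1 - r + D) powr (\<alpha> + 1))"
proof -
  define y where "y = 1 - r"
  define \<rho> where "\<rho> = cmod u"
  define E where "E = 1 - \<rho> * r"
  have \<rho>: "0 \<le> \<rho>" "\<rho> < 1" using u by (auto simp: \<rho>_def)
  have D: "D > 0" "\<rho> = 1 - D" using \<rho> by (auto simp: D_def \<rho>_def)
  have y: "y > 0" "r = 1 - y" using r by (auto simp: y_def)
  have ED: "D \<le> E" using \<rho> r mult_left_le[of r \<rho>] by (simp add: E_def D_def \<rho>_def)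
  have Ey: "y \<le> E" using \<rho> r mult_left_le_one_le[of r \<rho>] by (simp add: E_def y_def)
  have "b * p > 0" using a_pos ab p_pos by simp
  then have c: "c > 0" "c \<ge> b * p + 1" using N' by (auto simp only: c_def)
  have \<alpha>: "\<alpha> > 0" using a_pos p_pos by (simp add: \<alpha>_def)
  have \<phi>: "\<phi> r > 0" "\<phi> \<rho> > 0" using r \<rho> by (auto intro: phi_pos)
  have key: "(D / E) powr c * (\<phi> r / \<phi> \<rho>) powr p / y \<le> 2 powr (\<alpha> + 1) * (D * y powr (\<alpha> - 1) / (y + D) powr (\<alpha> + 1))"
  proof (cases "y \<le> D")
    \<comment> \<open>Radii beyond |u|: the kernel factor is merely bounded by 1, and integrability
      towards the boundary comes from the decay exponent a.\<close>
    case True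
    have "(D / E) powr c * (\<phi> r / \<phi> \<rho>) powr p \<le> 1 * ((y / D) powr a) powr p"
    proof (intro mult_mono powr_mono2)
      show "(D / E) powr c \<le> 1" using ED D c by (intro powr_le1) auto
      show "\<phi> r / \<phi> \<rho> \<le> (y / D) powr a"
        using phi_upper[of \<rho> r] True \<rho> r \<phi> by (simp add: y_def D_def \<rho>_def field_simps)
    qed (use p_pos \<phi> in auto)
    then have "(D / E) powr c * (\<phi> r / \<phi> \<rho>) powr p / y \<le> (y / D) powr \<alpha> / y"
      using y by (simp add: \<alpha>_def powr_powr divide_right_mono)
    also have "\<dots> = D * y powr (\<alpha> - 1) / D powr (\<alpha> + 1)"
      using y D by (simp add: powr_divide powr_diff powr_add field_simps)
    also have "\<dots> = 2 powr (\<alpha> + 1) * (D * y powr (\<alpha> - 1) / (2 * D) powr (\<alpha> + 1))"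
      by (simp add: powr_mult)
    also have "\<dots> \<le> 2 powr (\<alpha> + 1) * (D * y powr (\<alpha> - 1) / (y + D) powr (\<alpha> + 1))"
      using y D \<alpha> True by (intro mult_left_mono divide_left_mono powr_mono2 mult_pos_pos) auto
    finally show ?thesis .
  next
    \<comment> \<open>Radii below |u|: the ratio of the weights may be as large as (y / D) powr b.
      The hypothesis \<open>N'\<close> leaves at least one power of D / y after this has been
      compensated.\<close>
    case False
    have "(D / E) powr c * (\<phi> r / \<phi> \<rho>) powr p \<le> (D / y) powr c * ((y / D) powr b) powr p"
    proof (intro mult_mono powr_mono2 divide_left_mono)
      show "\<phi> r / \<phi> \<rho> \<le> (y / D) powr b"
        using phi_lower[of r \<rho>] False \<rho> r \<phi> by (simp add: y_def D_def \<rho>_def field_simps)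
    qed (use p_pos \<phi> c D y ED Ey in auto)
    also have "\<dots> = (D / y) powr (c - b * p)"
    proof -
      have "(y / D) powr b = (D / y) powr (- b)"
        using y D by (simp add: powr_divide powr_minus field_simps)
      then show ?thesis by (simp add: powr_powr flip: powr_add)
    qed
    also have "\<dots> \<le> (D / y) powr 1"
      using False c D y by (intro powr_mono') auto
    finally have "(D / E) powr c * (\<phi> r / \<phi> \<rho>) powr p / y \<le> D / y / y"
      using y D by (intro divide_right_mono) auto
    also have "\<dots> = D * y powr (\<alpha> - 1) / y powr (\<alpha> + 1)"
      using y D by (simp add: powr_diff powr_add field_simps)
    also have "\<dots> = 2 powr (\<alpha> + 1) * (D * y powr (\<alpha> - 1) / (2 * y) powr (\<alpha> + 1))"
      by (simp add: powr_mult)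
    also have "\<dots> \<le> 2 powr (\<alpha> + 1) * (D * y powr (\<alpha> - 1) / (y + D) powr (\<alpha> + 1))"
      using y D \<alpha> False by (intro mult_left_mono divide_left_mono powr_mono2 mult_pos_pos) auto
    finally show ?thesis .
  qed
  define A where "A = (1 - \<rho>\<^sup>2) powr (real N - 1 / q) / \<phi> \<rho>"
  have E0: "E > 0" using ED D by simp
  have sq: "0 \<le> 1 - \<rho>\<^sup>2" "1 - \<rho>\<^sup>2 \<le> 2 * D"
  proof -
    have "1 - \<rho>\<^sup>2 = (1 + \<rho>) * D" by (simp add: D power2_eq_square algebra_simps)
    then show "0 \<le> 1 - \<rho>\<^sup>2" "1 - \<rho>\<^sup>2 \<le> 2 * D" using \<rho> D by (auto intro: mult_right_mono)
  qed
  have "integral_mean q (kernel N u) r powr p \<le> (A powr q * E powr (1 - real N * q)) powr (p / q)"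
    using kernel_integral_mean[OF u r N]
    by (intro integral_mean_mono_powr p_pos q_pos) (simp add: A_def E_def \<rho>_def)
  also have "\<dots> = A powr p * E powr (- c)"
  proof -
    have "(1 - real N * q) * (p / q) = - c" using q_pos by (simp add: c_def field_simps)
    moreover have "q * (p / q) = p" using q_pos by simp
    ultimately show ?thesis by (simp only: powr_mult powr_powr)
  qed
  also have "A powr p = (1 - \<rho>\<^sup>2) powr c / \<phi> \<rho> powr p"
    using \<phi> by (simp add: A_def powr_divide powr_powr c_def mult.commute)
  also have "\<dots> * E powr (- c) \<le> (2 * D) powr c / \<phi> \<rho> powr p * E powr (- c)"
    using sq c by (intro mult_right_mono divide_right_mono powr_mono2) auto
  finally have "mixed_norm_integrand p q \<phi> (kernel N u) r
      \<le> (2 * D) powr c / \<phi> \<rho> powr p * E powr (- c) * (\<phi> r powr p / y)"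
    unfolding mixed_norm_integrand_def y_def using r by (intro mult_right_mono) auto
  also have "\<dots> = 2 powr c * ((D / E) powr c * (\<phi> r / \<phi> \<rho>) powr p / y)"
    using D E0 \<phi> by (simp add: powr_mult powr_divide powr_minus field_simps)
  also have "\<dots> \<le> 2 powr c * (2 powr (\<alpha> + 1) * (D * y powr (\<alpha> - 1) / (y + D) powr (\<alpha> + 1)))"
    by (intro mult_left_mono key) auto
  finally show ?thesis by (simp add: y_def mult_ac)
qed

text \<open>The bound is uniform in u because the profile integral is at most 1 / (a p) irrespective
  of D = 1 - |u|.\<close>

lemma kernel_bounded:
  assumes N: "real N * q \<ge> 2" and N': "p * (real N - 1 / q) \<ge> b * p + 1"
  shows "\<exists>C>0. \<forall>u\<in>unit_disc. kernel N u \<in> X \<and> NX (kernel N u) \<le> C"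
proof -
  define c where "c = 2 powr (p * (real N - 1 / q)) * 2 powr (a * p + 1)"
  have c: "c > 0" by (simp add: c_def)
  have \<alpha>: "a * p > 0" using a_pos p_pos by simp
  have "kernel N u \<in> X \<and> NX (kernel N u) \<le> (c / (a * p)) powr (1 / p)" if u: "u \<in> unit_disc" for u
  proof -
    define H where "H = (\<lambda>r. (1 - cmod u) * (1 - r) powr (a * p - 1) / (1 - r + (1 - cmod u)) powr (a * p + 1))"
    have D: "0 < 1 - cmod u" using u by simp
    have H: "set_integrable lborel {0..<1} H" "(LBINT r:{0..<1}. H r) \<le> 1 / (a * p)"
      unfolding H_def by (rule profile_integral[OF D \<alpha>])+
    have cH: "set_integrable lborel {0..<1} (\<lambda>r. c * H r)"
      using H(1) by simp
    have le: "mixed_norm_integrand p q \<phi> (kernel N u) r \<le> c * H r" if "0 \<le> r" "r < 1" for r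
      unfolding c_def H_def by (rule kernel_integrand[OF u that N N'])
    have "NX (kernel N u) powr p \<le> (LBINT r:{0..<1}. c * H r)"
      by (rule X_dominated(2)[OF kernel_HD[OF u] cH le])
    also have "\<dots> = c * (LBINT r:{0..<1}. H r)" by simp
    also have "\<dots> \<le> c * (1 / (a * p))" using c H(2) by (intro mult_left_mono) auto
    also have "\<dots> = ((c / (a * p)) powr (1 / p)) powr p"
      using c \<alpha> p_pos a_pos by (simp add: powr_powr)
    finally have "NX (kernel N u) \<le> (c / (a * p)) powr (1 / p)"
      by (rule powr_le_powr_cancel[OF _ norm_nonneg _ p_pos]) simp
    then show ?thesis using X_dominated(1)[OF kernel_HD[OF u] cH le] by blast
  qed
  moreover have "(c / (a * p)) powr (1 / p) > 0" using c a_pos p_pos by simp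
  ultimately show ?thesis by blast
qed

text \<open>A threshold and not a single exponent, since N and N + 1 are used together.\<close>

lemma large_exponents:
  obtains N0 :: nat where "1 \<le> N0"
    "\<And>N. N \<ge> N0 \<Longrightarrow> real N * q \<ge> 2" "\<And>N. N \<ge> N0 \<Longrightarrow> p * (real N - 1 / q) \<ge> b * p + 1"
proof -
  define c where "c = 2 / q + \<bar>(b * p + 1) / p\<bar> + 1 / q"
  define N0 where "N0 = nat \<lceil>c\<rceil> + 1"
  have big: "real N * q \<ge> 2 \<and> p * (real N - 1 / q) \<ge> b * p + 1" if "N \<ge> N0" for N
  proof -
    have N: "real N \<ge> c" using that unfolding N0_def by linarith
    have "0 < 1 / q" "0 < 2 / q" using q_pos by auto
    then have "real N \<ge> 2 / q" "real N - 1 / q \<ge> (b * p + 1) / p"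
      using N unfolding c_def by linarith+
    then show ?thesis using p_pos q_pos by (simp add: pos_divide_le_eq mult.commute)
  qed
  show thesis by (rule that[of N0]) (use big in \<open>auto simp: N0_def\<close>)
qed

section \<open>Quasi-norm structure of the mixed-norm space\<close>

lemma X_cmult:
  assumes f: "f \<in> X"
  shows "(\<lambda>z. c * f z) \<in> X" "NX (\<lambda>z. c * f z) = cmod c * NX f"
proof -
  have mean: "integral_mean q (\<lambda>z. c * f z) r = cmod c * integral_mean q f r" for r
  proof -
    let ?J = "LBINT t:{0..2 * pi}. cmod (f (of_real r * exp (\<i> * of_real t))) powr q"
    have "integral_mean q (\<lambda>z. c * f z) r = (cmod c powr q * (1 / (2 * pi) * ?J)) powr (1 / q)"
      by (simp add: integral_mean_def norm_mult powr_mult)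
    also have "\<dots> = (cmod c powr q) powr (1 / q) * (1 / (2 * pi) * ?J) powr (1 / q)"
      by (rule powr_mult)
    finally show ?thesis using q_pos by (simp add: integral_mean_def powr_powr)
  qed
  have eq: "mixed_norm_integrand p q \<phi> (\<lambda>z. c * f z) r = cmod c powr p * mixed_norm_integrand p q \<phi> f r" for r
    by (simp add: mixed_norm_integrand_def mean powr_mult integral_mean_nonneg)
  show "(\<lambda>z. c * f z) \<in> X"
    using f unfolding mixed_norm_space_def HD_def mem_Collect_eq eq by (auto intro!: holomorphic_intros)
  show "NX (\<lambda>z. c * f z) = cmod c * NX f"
    using p_pos by (simp add: mixed_norm_def eq powr_mult powr_powr)
qed

text \<open>The constant arises from \<open>powr_add_le\<close> applied twice: with exponent q under
  the circle integral, which contributes 2 powr p after the power p / q is taken, and with exponent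
  p / q to the sum of the two means.\<close>

lemma X_diff:
  "\<exists>C>0. \<forall>f\<in>X. \<forall>h\<in>X. (\<lambda>z. f z - h z) \<in> X \<and> NX (\<lambda>z. f z - h z) powr p \<le> C * (NX f powr p + NX h powr p)"
proof -
  define C where "C = 2 powr p * 2 powr (p / q)"
  have "(\<lambda>z. f z - h z) \<in> X \<and> NX (\<lambda>z. f z - h z) powr p \<le> C * (NX f powr p + NX h powr p)"
    if f: "f \<in> X" and h: "h \<in> X" for f h
  proof -
    let ?k = "\<lambda>z. f z - h z"
    let ?H = "\<lambda>r. C * (mixed_norm_integrand p q \<phi> f r + mixed_norm_integrand p q \<phi> h r)"
    have k: "?k \<in> HD" using f h by (auto simp: mixed_norm_space_def HD_def intro: holomorphic_intros)
    have fi: "set_integrable lborel {0..<1} (mixed_norm_integrand p q \<phi> f)"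
      and hi: "set_integrable lborel {0..<1} (mixed_norm_integrand p q \<phi> h)"
      using f h by (auto simp: mixed_norm_space_def)
    have le: "mixed_norm_integrand p q \<phi> ?k r \<le> ?H r" if r: "0 \<le> r" "r < 1" for r
    proof -
      let ?z = "\<lambda>t::real. of_real r * exp (\<i> * of_real t) :: complex"
      have int: "set_integrable lborel {0..2 * pi} (\<lambda>t. cmod (g (?z t)) powr q)"
        if "g holomorphic_on unit_disc" for g
        by (rule circle_set_integrable[OF holomorphic_on_imp_continuous_on[OF that] q_pos r])
      note ifh = int[OF X_holomorphic[OF f]] int[OF X_holomorphic[OF h]]
      have "(LBINT t:{0..2 * pi}. cmod (?k (?z t)) powr q)
          \<le> (LBINT t:{0..2 * pi}. 2 powr q * (cmod (f (?z t)) powr q + cmod (h (?z t)) powr q))"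
      proof (rule set_integral_mono)
        show "set_integrable lborel {0..2 * pi} (\<lambda>t. cmod (?k (?z t)) powr q)"
          by (rule int) (use k in \<open>simp add: HD_def\<close>)
        show "set_integrable lborel {0..2 * pi} (\<lambda>t. 2 powr q * (cmod (f (?z t)) powr q + cmod (h (?z t)) powr q))"
          using ifh by (simp add: set_integral_add)
        show "cmod (?k (?z t)) powr q \<le> 2 powr q * (cmod (f (?z t)) powr q + cmod (h (?z t)) powr q)" for t
        proof -
          have "cmod (?k (?z t)) powr q \<le> (cmod (f (?z t)) + cmod (h (?z t))) powr q"
            using q_pos by (intro powr_mono2 norm_triangle_ineq4) auto
          then show ?thesis using powr_add_le[of "cmod (f (?z t))" "cmod (h (?z t))" q] q_pos by simp
        qed
      qed
      also have "\<dots> = 2 powr q * ((LBINT t:{0..2 * pi}. cmod (f (?z t)) powr q) + (LBINT t:{0..2 * pi}. cmod (h (?z t)) powr q))"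
        using ifh by (simp add: set_integral_add)
      finally have "integral_mean q ?k r powr q \<le> 2 powr q * (integral_mean q f r powr q + integral_mean q h r powr q)"
        unfolding integral_mean_powr_q[OF q_pos] by (simp add: field_simps)
      then have "integral_mean q ?k r powr p \<le> (2 powr q * (integral_mean q f r powr q + integral_mean q h r powr q)) powr (p / q)"
        by (rule integral_mean_mono_powr[OF p_pos q_pos])
      also have "\<dots> = 2 powr p * (integral_mean q f r powr q + integral_mean q h r powr q) powr (p / q)"
        using q_pos by (simp add: powr_mult powr_powr)
      also have "\<dots> \<le> 2 powr p * (2 powr (p / q) *
          ((integral_mean q f r powr q) powr (p / q) + (integral_mean q h r powr q) powr (p / q)))"
        using p_pos q_pos by (intro mult_left_mono powr_add_le) auto
      finally have "integral_mean q ?k r powr p \<le> C * (integral_mean q f r powr p + integral_mean q h r powr p)"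
        using q_pos by (simp add: powr_powr C_def)
      then have "integral_mean q ?k r powr p * (\<phi> r powr p / (1 - r))
          \<le> C * (integral_mean q f r powr p + integral_mean q h r powr p) * (\<phi> r powr p / (1 - r))"
        using r by (intro mult_right_mono) auto
      then show ?thesis by (simp add: mixed_norm_integrand_def algebra_simps)
    qed
    have H: "set_integrable lborel {0..<1} ?H"
      using fi hi by (simp add: set_integral_add)
    have "(LBINT r:{0..<1}. ?H r) = C * (NX f powr p + NX h powr p)"
      using fi hi unfolding norm_powr_p by (simp add: set_integral_add(2))
    then show ?thesis using X_dominated[OF k H le] by (simp only:)
  qed
  moreover have "C > 0" by (simp add: C_def)
  ultimately show ?thesis by blast
qed

text \<open>Bounds the test functions of \<open>kernel_lower\<close> uniformly over all pairs of
  points, so that the constant does not depend on which kernel is subtracted.\<close>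

lemma kernel_diff_bounded:
  assumes N: "real N * q \<ge> 2" and N': "p * (real N - 1 / q) \<ge> b * p + 1"
  shows "\<exists>D>0. \<forall>u\<in>unit_disc. \<forall>v\<in>unit_disc.
    (\<lambda>z. kernel N u z - kernel N v z) \<in> X \<and> NX (\<lambda>z. kernel N u z - kernel N v z) \<le> D"
proof -
  obtain C where C: "C > 0" "\<And>u. u \<in> unit_disc \<Longrightarrow> kernel N u \<in> X \<and> NX (kernel N u) \<le> C"
    using kernel_bounded[OF N N'] by blast
  obtain A where A: "A > 0" "\<And>f h. f \<in> X \<Longrightarrow> h \<in> X \<Longrightarrow>
      (\<lambda>z. f z - h z) \<in> X \<and> NX (\<lambda>z. f z - h z) powr p \<le> A * (NX f powr p + NX h powr p)"
    using X_diff by blast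
  define D where "D = (A * (C powr p + C powr p)) powr (1 / p)"
  have "NX (\<lambda>z. kernel N u z - kernel N v z) \<le> D" if "u \<in> unit_disc" "v \<in> unit_disc" for u v
  proof -
    have "NX (\<lambda>z. kernel N u z - kernel N v z) powr p \<le> A * (NX (kernel N u) powr p + NX (kernel N v) powr p)"
      using A(2) C(2) that by blast
    also have "\<dots> \<le> A * (C powr p + C powr p)"
      using A(1) C that p_pos by (intro mult_left_mono add_mono powr_mono2) (auto simp: norm_nonneg)
    also have "\<dots> = D powr p"
      using A(1) p_pos by (simp add: D_def powr_powr)
    finally show ?thesis
      by (rule powr_le_powr_cancel[OF _ norm_nonneg _ p_pos]) (simp add: D_def)
  qed
  moreover have "D > 0" using A(1) C(1) by (simp add: D_def)
  ultimately show ?thesis using A(2) C(2) by blast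
qed

end

section \<open>The integration operator\<close>

text \<open>The suprema run over sets that shrink as \<delta> grows, so they decrease and converge
  to their infimum. This establishes that the limit behind \<open>Lim\<close> exists.\<close>

lemma boundary_limsup_eq_INF:
  "boundary_limsup \<psi> F =
    (INF \<delta>\<in>{..<1}. SUP z\<in>{z \<in> unit_disc. \<delta> < cmod (\<psi> z) \<and> cmod (\<psi> z) < 1}. ennreal (F z))"
  (is "_ = (INF \<delta>\<in>_. ?G \<delta>)")
proof -
  have anti: "?G \<delta>' \<le> ?G \<delta>" if "\<delta> \<le> \<delta>'" for \<delta> \<delta>'
    using that by (intro SUP_subset_mono) auto
  have "(?G \<longlongrightarrow> (INF \<delta>\<in>{..<1}. ?G \<delta>)) (at_left 1)"
  proof (rule order_tendstoI)
    fix c assume c: "c < (INF \<delta>\<in>{..<1}. ?G \<delta>)"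
    have "c < ?G \<delta>" if "\<delta> < 1" for \<delta>
      using INF_lower[of \<delta> "{..<1}" ?G] that by (intro less_le_trans[OF c]) simp
    then show "\<forall>\<^sub>F \<delta> in at_left 1. c < ?G \<delta>"
      by (auto simp: eventually_at_left_field intro: exI[of _ 0])
  next
    fix c assume "(INF \<delta>\<in>{..<1}. ?G \<delta>) < c"
    then obtain \<delta>0 where \<delta>0: "\<delta>0 < 1" "?G \<delta>0 < c" unfolding INF_less_iff by auto
    have "?G \<delta> < c" if "\<delta>0 < \<delta>" for \<delta>
      using anti[OF less_imp_le[OF that]] \<delta>0(2) by (rule order.strict_trans1)
    then show "\<forall>\<^sub>F \<delta> in at_left 1. ?G \<delta> < c"
      unfolding eventually_at_left_field using \<delta>0(1) by blast
  qed
  then show ?thesis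
    unfolding boundary_limsup_def by (intro tendsto_Lim) (simp_all add: trivial_limit_at_left_real)
qed

lemma boundary_limsup_le:
  assumes "\<delta> < 1" "\<And>z. z \<in> unit_disc \<Longrightarrow> \<delta> < cmod (\<psi> z) \<Longrightarrow> F z \<le> c"
  shows "boundary_limsup \<psi> F \<le> ennreal c"
  unfolding boundary_limsup_eq_INF
  using assms by (intro INF_lower2[of \<delta>]) (auto intro!: SUP_least ennreal_leI)

lemma boundary_limsup_less_ennrealD:
  assumes "boundary_limsup \<psi> F < ennreal c" "\<psi> ` unit_disc \<subseteq> unit_disc"
  obtains \<delta> where "\<delta> < 1" "\<And>z. z \<in> unit_disc \<Longrightarrow> \<delta> < cmod (\<psi> z) \<Longrightarrow> F z \<le> c"
proof -
  obtain \<delta> where \<delta>: "\<delta> < 1"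
    "(SUP z\<in>{z \<in> unit_disc. \<delta> < cmod (\<psi> z) \<and> cmod (\<psi> z) < 1}. ennreal (F z)) < ennreal c"
    using assms(1) unfolding boundary_limsup_eq_INF INF_less_iff by auto
  have "F z \<le> c" if z: "z \<in> unit_disc" "\<delta> < cmod (\<psi> z)" for z
  proof -
    have "\<psi> z \<in> unit_disc" using assms(2) z by blast
    then have "cmod (\<psi> z) < 1" by simp
    then have "ennreal (F z) \<le> (SUP z\<in>{z \<in> unit_disc. \<delta> < cmod (\<psi> z) \<and> cmod (\<psi> z) < 1}. ennreal (F z))"
      using z by (intro SUP_upper) simp
    then have "ennreal (F z) < ennreal c" using \<delta>(2) by (rule order.strict_trans1)
    then show ?thesis by (metis ennreal_leI linorder_not_le less_imp_le)
  qed
  then show thesis using that \<delta>(1) by blast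
qed

lemma segment_disc:
  assumes "z \<in> unit_disc"
  shows "closed_segment 0 z \<subseteq> unit_disc"
  using assms by (intro closed_segment_subset) auto

section \<open>The operator, its derivatives and its linearity\<close>

locale gen_op = normal_weight p q a b \<phi> for p q a b \<phi> +
  fixes n :: nat and \<mu> :: "complex \<Rightarrow> real" and g \<psi> :: "complex \<Rightarrow> complex"
  assumes weight: "weight \<mu>" and g_hol: "g holomorphic_on unit_disc" and self_map: "analytic_self_map \<psi>"
begin

abbreviation "T \<equiv> gen_integration_op n \<psi> g"
abbreviation "Z \<equiv> zygmund_space \<mu>"
abbreviation "NZ \<equiv> zygmund_norm \<mu>"

definition W :: "complex \<Rightarrow> real" where "W z = \<mu> (of_real (cmod z))"

text \<open>The weighted coefficient of \<open>(deriv ^^ Suc n) f (\<psi> z)\<close> in the second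
  derivative of T f, multiplied by the growth rate of that derivative at \<psi> z. \<open>V\<close>
  is the analogue for \<open>(deriv ^^ n) f (\<psi> z)\<close>.\<close>

definition U :: "complex \<Rightarrow> real" where
  "U z = W z * cmod (deriv \<psi> z * g z) /
     (\<phi> (cmod (\<psi> z)) * (1 - (cmod (\<psi> z))\<^sup>2) powr (1 / q + real n + 1))"

definition V :: "complex \<Rightarrow> real" where
  "V z = W z * cmod (deriv g z) / (\<phi> (cmod (\<psi> z)) * (1 - (cmod (\<psi> z))\<^sup>2) powr (1 / q + real n))"

lemma W_pos: "z \<in> unit_disc \<Longrightarrow> W z > 0"
  using weight by (auto simp: weight_def W_def)

lemma psi_hol: "\<psi> holomorphic_on unit_disc" and psi_disc: "\<psi> ` unit_disc \<subseteq> unit_disc"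
  using self_map by (auto simp: analytic_self_map_def)

lemma psi_in: "z \<in> unit_disc \<Longrightarrow> \<psi> z \<in> unit_disc"
  using psi_disc by blast

definition second_deriv :: "(complex \<Rightarrow> complex) \<Rightarrow> complex \<Rightarrow> complex" where
  "second_deriv f z = (deriv ^^ Suc n) f (\<psi> z) * (deriv \<psi> z * g z) + (deriv ^^ n) f (\<psi> z) * deriv g z"

lemma integrand_hol:
  assumes "f holomorphic_on unit_disc"
  shows "(\<lambda>z. (deriv ^^ n) f (\<psi> z) * g z) holomorphic_on unit_disc"
  using holomorphic_on_compose_gen[OF psi_hol holomorphic_higher_deriv[OF assms open_ball] psi_disc]
  by (intro holomorphic_on_mult g_hol) (simp add: o_def)

lemma integrand_integrable:
  assumes "f holomorphic_on unit_disc" "z \<in> unit_disc"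
  shows "(\<lambda>\<xi>. (deriv ^^ n) f (\<psi> \<xi>) * g \<xi>) contour_integrable_on linepath 0 z"
  by (rule contour_integrable_holomorphic_simple[OF integrand_hol[OF assms(1)] open_ball])
     (use segment_disc[OF assms(2)] in auto)

text \<open>The integrand is holomorphic on a convex set and so has a primitive F there; the
  integral along the segment from 0 to x is F x - F 0.\<close>

lemma op_has_deriv:
  assumes f: "f holomorphic_on unit_disc" and z: "z \<in> unit_disc"
  shows "(T f has_field_derivative (deriv ^^ n) f (\<psi> z) * g z) (at z)"
proof -
  obtain F where F: "\<And>x. x \<in> unit_disc \<Longrightarrow> (F has_field_derivative (deriv ^^ n) f (\<psi> x) * g x) (at x)"
    using holomorphic_convex_primitive'[OF convex_ball open_ball integrand_hol[OF f]]
    by (metis at_within_open open_ball)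
  have eq: "F x - F 0 = T f x" if x: "x \<in> unit_disc" for x
  proof -
    have "((\<lambda>\<xi>. (deriv ^^ n) f (\<psi> \<xi>) * g \<xi>) has_contour_integral F x - F 0) (linepath 0 x)"
      using contour_integral_primitive[of unit_disc F _ "linepath 0 x"] F x
      using segment_disc[OF x] by (auto simp: has_field_derivative_at_within)
    then show ?thesis using x by (simp add: gen_integration_op_def contour_integral_unique)
  qed
  have "((\<lambda>x. F x - F 0) has_field_derivative (deriv ^^ n) f (\<psi> z) * g z) (at z)"
    using DERIV_diff[OF F[OF z] DERIV_const[of "F 0"]] by simp
  then show ?thesis
    by (rule has_field_derivative_transform_within_open[OF _ open_ball z]) (rule eq)
qed

lemma op_HD:
  assumes f: "f holomorphic_on unit_disc"
  shows "T f \<in> HD"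
proof -
  have "T f holomorphic_on unit_disc"
    unfolding holomorphic_on_open[OF open_ball] using op_has_deriv[OF f] by blast
  then show ?thesis by (simp add: HD_def gen_integration_op_def)
qed

lemma op_0: "T f 0 = 0"
  by (simp add: gen_integration_op_def)

lemma op_deriv:
  assumes "f holomorphic_on unit_disc" "z \<in> unit_disc"
  shows "deriv (T f) z = (deriv ^^ n) f (\<psi> z) * g z"
  using op_has_deriv[OF assms] by (rule DERIV_imp_deriv)

lemma op_deriv2:
  assumes f: "f holomorphic_on unit_disc" and z: "z \<in> unit_disc"
  shows "(deriv ^^ 2) (T f) z = second_deriv f z"
proof -
  have "((\<lambda>w. (deriv ^^ n) f (\<psi> w)) has_field_derivative (deriv ^^ Suc n) f (\<psi> z) * deriv \<psi> z) (at z)"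
    by (rule DERIV_chain2[OF has_field_derivative_higher_deriv[OF f open_ball psi_in[OF z]]
          holomorphic_derivI[OF psi_hol open_ball z]])
  from DERIV_mult[OF this holomorphic_derivI[OF g_hol open_ball z]]
  have "((\<lambda>w. (deriv ^^ n) f (\<psi> w) * g w) has_field_derivative second_deriv f z) (at z)"
    by (simp add: second_deriv_def algebra_simps)
  then have "(deriv (T f) has_field_derivative second_deriv f z) (at z)"
    by (rule has_field_derivative_transform_within_open[OF _ open_ball z]) (simp add: op_deriv[OF f])
  then show ?thesis by (simp add: numeral_2_eq_2 DERIV_imp_deriv)
qed

text \<open>Linearity is proved for all holomorphic functions, because dilations and locally uniform
  limits are used without being placed in the mixed-norm space.\<close>

lemma op_combine:
  assumes f: "f holomorphic_on unit_disc" and h: "h holomorphic_on unit_disc"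
  shows "T (\<lambda>z. f z + h z) = (\<lambda>z. T f z + T h z)" "T (\<lambda>z. f z - h z) = (\<lambda>z. T f z - T h z)"
    "T (\<lambda>z. c * f z) = (\<lambda>z. c * T f z)"
proof -
  have eq: "contour_integral (linepath 0 z) (\<lambda>\<xi>. (deriv ^^ n) k (\<psi> \<xi>) * g \<xi>) = contour_integral (linepath 0 z) L"
    if "z \<in> unit_disc" "\<And>\<xi>. \<psi> \<xi> \<in> unit_disc \<Longrightarrow> (deriv ^^ n) k (\<psi> \<xi>) * g \<xi> = L \<xi>" for k L z
  proof (rule contour_integral_eq)
    fix x assume "x \<in> path_image (linepath 0 z)"
    then have "x \<in> unit_disc" using segment_disc[OF that(1)] by auto
    then show "(deriv ^^ n) k (\<psi> x) * g x = L x" using psi_in that(2) by blast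
  qed
  note int = integrand_integrable[OF f] integrand_integrable[OF h]
  show "T (\<lambda>z. f z + h z) = (\<lambda>z. T f z + T h z)"
  proof
    fix z
    show "T (\<lambda>z. f z + h z) z = T f z + T h z"
    proof (cases "z \<in> unit_disc")
      case True
      have "contour_integral (linepath 0 z) (\<lambda>\<xi>. (deriv ^^ n) (\<lambda>z. f z + h z) (\<psi> \<xi>) * g \<xi>) =
          contour_integral (linepath 0 z) (\<lambda>\<xi>. (deriv ^^ n) f (\<psi> \<xi>) * g \<xi> + (deriv ^^ n) h (\<psi> \<xi>) * g \<xi>)"
        by (rule eq[OF True]) (simp add: higher_deriv_add[OF f h open_ball] distrib_right)
      then show ?thesis using True by (simp add: gen_integration_op_def contour_integral_add[OF int[OF True]])
    qed (simp add: gen_integration_op_def)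
  qed
  show "T (\<lambda>z. f z - h z) = (\<lambda>z. T f z - T h z)"
  proof
    fix z
    show "T (\<lambda>z. f z - h z) z = T f z - T h z"
    proof (cases "z \<in> unit_disc")
      case True
      have "contour_integral (linepath 0 z) (\<lambda>\<xi>. (deriv ^^ n) (\<lambda>z. f z - h z) (\<psi> \<xi>) * g \<xi>) =
          contour_integral (linepath 0 z) (\<lambda>\<xi>. (deriv ^^ n) f (\<psi> \<xi>) * g \<xi> - (deriv ^^ n) h (\<psi> \<xi>) * g \<xi>)"
        by (rule eq[OF True]) (simp add: higher_deriv_diff[OF f h open_ball] left_diff_distrib)
      then show ?thesis using True by (simp add: gen_integration_op_def contour_integral_diff[OF int[OF True]])
    qed (simp add: gen_integration_op_def)
  qed
  show "T (\<lambda>z. c * f z) = (\<lambda>z. c * T f z)"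
  proof
    fix z
    show "T (\<lambda>z. c * f z) z = c * T f z"
    proof (cases "z \<in> unit_disc")
      case True
      have "contour_integral (linepath 0 z) (\<lambda>\<xi>. (deriv ^^ n) (\<lambda>z. c * f z) (\<psi> \<xi>) * g \<xi>) =
          contour_integral (linepath 0 z) (\<lambda>\<xi>. c * ((deriv ^^ n) f (\<psi> \<xi>) * g \<xi>))"
        by (rule eq[OF True]) (simp add: higher_deriv_cmult[OF f _ open_ball] mult.assoc)
      then show ?thesis using True by (simp add: gen_integration_op_def contour_integral_lmul[OF int(1)[OF True]])
    qed (simp add: gen_integration_op_def)
  qed
qed

section \<open>Pointwise control by the weighted Zygmund norm\<close>

lemma zygmund_pointwise:
  assumes "F \<in> Z" "z \<in> unit_disc"
  shows "W z * cmod ((deriv ^^ 2) F z) \<le> NZ F"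
proof -
  have "W z * cmod ((deriv ^^ 2) F z) \<le> (SUP z\<in>unit_disc. W z * cmod ((deriv ^^ 2) F z))"
    using assms by (intro cSUP_upper) (auto simp: zygmund_space_def W_def)
  then show ?thesis
    unfolding zygmund_norm_def W_def using norm_ge_zero[of "F 0"] norm_ge_zero[of "deriv F 0"] by linarith
qed

lemma zygmund_bound:
  assumes "F \<in> HD" "\<And>z. z \<in> unit_disc \<Longrightarrow> W z * cmod ((deriv ^^ 2) F z) \<le> B"
  shows "F \<in> Z" "NZ F \<le> cmod (F 0) + cmod (deriv F 0) + B"
proof -
  show "F \<in> Z" using assms by (auto simp: zygmund_space_def W_def intro!: bdd_aboveI2)
  have "(SUP z\<in>unit_disc. W z * cmod ((deriv ^^ 2) F z)) \<le> B"
    using assms by (intro cSUP_least) auto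
  then show "NZ F \<le> cmod (F 0) + cmod (deriv F 0) + B"
    by (simp add: zygmund_norm_def W_def)
qed

lemma zygmund_diff:
  assumes "F \<in> Z" "G \<in> Z"
  shows "(\<lambda>z. F z - G z) \<in> Z"
    "z \<in> unit_disc \<Longrightarrow> (deriv ^^ 2) (\<lambda>z. F z - G z) z = (deriv ^^ 2) F z - (deriv ^^ 2) G z"
proof -
  have hol: "F holomorphic_on unit_disc" "G holomorphic_on unit_disc"
    using assms by (auto simp: zygmund_space_def HD_def)
  have d: "(deriv ^^ 2) (\<lambda>z. F z - G z) z = (deriv ^^ 2) F z - (deriv ^^ 2) G z" if "z \<in> unit_disc" for z
    by (rule higher_deriv_diff[OF hol open_ball that])
  then show "z \<in> unit_disc \<Longrightarrow> (deriv ^^ 2) (\<lambda>z. F z - G z) z = (deriv ^^ 2) F z - (deriv ^^ 2) G z" .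
  show "(\<lambda>z. F z - G z) \<in> Z"
  proof (rule zygmund_bound(1))
    show "(\<lambda>z. F z - G z) \<in> HD"
      using assms by (auto simp: zygmund_space_def HD_def intro: holomorphic_intros)
    fix z :: complex assume z: "z \<in> unit_disc"
    have "W z * cmod ((deriv ^^ 2) F z - (deriv ^^ 2) G z)
        \<le> W z * (cmod ((deriv ^^ 2) F z) + cmod ((deriv ^^ 2) G z))"
      using W_pos[OF z] by (intro mult_left_mono norm_triangle_ineq4) auto
    then show "W z * cmod ((deriv ^^ 2) (\<lambda>z. F z - G z) z) \<le> NZ F + NZ G"
      using zygmund_pointwise[OF assms(1) z] zygmund_pointwise[OF assms(2) z] d[OF z]
      by (simp add: distrib_left)
  qed
qed

text \<open>Once the common factor is pulled out, the two summands are weighted N + n to 1, so that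
  changing N changes their proportion.\<close>

lemma kernel_second_deriv:
  assumes u: "u \<in> unit_disc" and z: "z \<in> unit_disc"
  shows "second_deriv (kernel N u) z =
    of_real ((1 - (cmod u)\<^sup>2) powr (real N - 1 / q) / \<phi> (cmod u)) * pochhammer (of_nat N) n * cnj u ^ n
      / (1 - cnj u * \<psi> z) ^ (N + n)
    * (of_nat (N + n) * (cnj u * (deriv \<psi> z * g z) / (1 - cnj u * \<psi> z)) + deriv g z)"
proof -
  have nz: "1 - cnj u * \<psi> z \<noteq> 0" using disc_kernel_nonzero[OF u, of "\<psi> z"] psi_in[OF z] by simp
  define y where "y = 1 - cnj u * \<psi> z"
  define A where "A = complex_of_real ((1 - (cmod u)\<^sup>2) powr (real N - 1 / q) / \<phi> (cmod u))"
  show ?thesis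
    unfolding second_deriv_def kernel_higher_deriv[OF u psi_in[OF z]] y_def[symmetric] A_def[symmetric]
    using nz unfolding y_def[symmetric] by (simp add: pochhammer_Suc field_simps)
qed

end

locale bounded_gen_op = gen_op +
  assumes bounded: "bounded_operator X NX Z NZ T"
begin

lemma op_in_Z: "f \<in> X \<Longrightarrow> T f \<in> Z"
  using bounded by (auto simp: bounded_operator_def linear_operator_def)

text \<open>Two kernels with consecutive exponents separate the two summands of the second derivative.\<close>

lemma symbols_bounded:
  obtains B where "B \<ge> 0" "\<And>z. z \<in> unit_disc \<Longrightarrow> W z * cmod (deriv \<psi> z * g z) \<le> B"
    "\<And>z. z \<in> unit_disc \<Longrightarrow> W z * cmod (deriv g z) \<le> B"
proof -
  obtain N0 where N0: "1 \<le> N0" "\<And>N. N \<ge> N0 \<Longrightarrow> real N * q \<ge> 2"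
    "\<And>N. N \<ge> N0 \<Longrightarrow> p * (real N - 1 / q) \<ge> b * p + 1"
    by (rule large_exponents) (rule that)
  \<comment> \<open>A fixed nonzero point is enough: \<open>cnj u\<close> is a factor of
    \<open>x\<close>, so it must not vanish, and |1 - cnj u \<psi> z| \<le> 2 bounds the
    denominators uniformly in z.\<close>
  define u :: complex where "u = 1 / 2"
  have u: "u \<in> unit_disc" "u \<noteq> 0" "cnj u = 1 / 2" by (auto simp: u_def)
  define x where "x = (\<lambda>z. cnj u * (deriv \<psi> z * g z) / (1 - cnj u * \<psi> z))"
  have ex: "\<exists>B. \<forall>z\<in>unit_disc. W z * cmod (of_nat (N + n) * x z + deriv g z) \<le> B"
    if N: "N \<ge> N0" for N
  proof -
    have kX: "kernel N u \<in> X" using kernel_bounded[OF N0(2)[OF N] N0(3)[OF N]] u by blast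
    define A where "A = cmod (of_real ((1 - (cmod u)\<^sup>2) powr (real N - 1 / q) / \<phi> (cmod u)) * pochhammer (of_nat N) n * cnj u ^ n)"
    have "N \<ge> 1" using N N0(1) by simp
    then have "pochhammer (of_nat N :: complex) n \<noteq> 0"
      using pochhammer_pos[of N n] by (simp add: pochhammer_of_nat)
    moreover have "(1 - (cmod u)\<^sup>2) powr (real N - 1 / q) / \<phi> (cmod u) > 0"
      using phi_pos[of "cmod u"] by (simp add: u_def power2_eq_square)
    then have "complex_of_real ((1 - (cmod u)\<^sup>2) powr (real N - 1 / q) / \<phi> (cmod u)) \<noteq> 0"
      by (simp only: of_real_eq_0_iff)
    moreover have "cnj u ^ n \<noteq> 0" using u by simp
    ultimately have A: "A > 0" unfolding A_def zero_less_norm_iff by (simp only: mult_eq_0_iff) simp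
    have "W z * cmod (of_nat (N + n) * x z + deriv g z) \<le> 2 ^ (N + n) * NZ (T (kernel N u)) / A"
      if z: "z \<in> unit_disc" for z
    proof -
      have "cmod (1 - cnj u * \<psi> z) \<le> 1 + cmod (cnj u * \<psi> z)"
        using norm_triangle_ineq4[of 1 "cnj u * \<psi> z"] by simp
      also have "\<dots> \<le> 2" using psi_in[OF z] by (simp add: u norm_mult norm_divide)
      finally have le: "cmod (1 - cnj u * \<psi> z) ^ (N + n) \<le> 2 ^ (N + n)"
        by (intro power_mono) auto
      have pos: "0 < cmod (1 - cnj u * \<psi> z) ^ (N + n)"
        using disc_kernel_nonzero[OF u(1), of "\<psi> z"] psi_in[OF z] by simp
      have "W z * cmod (second_deriv (kernel N u) z) \<le> NZ (T (kernel N u))"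
        using zygmund_pointwise[OF op_in_Z[OF kX] z] by (simp add: op_deriv2[OF X_holomorphic[OF kX] z])
      then have 1: "W z * (A / cmod (1 - cnj u * \<psi> z) ^ (N + n) * cmod (of_nat (N + n) * x z + deriv g z)) \<le> NZ (T (kernel N u))"
        unfolding kernel_second_deriv[OF u(1) z] by (simp only: norm_mult norm_divide norm_power A_def x_def)
      have "A / 2 ^ (N + n) \<le> A / cmod (1 - cnj u * \<psi> z) ^ (N + n)"
        using le pos A by (intro divide_left_mono) auto
      then have "W z * (A / 2 ^ (N + n) * cmod (of_nat (N + n) * x z + deriv g z)) \<le>
        W z * (A / cmod (1 - cnj u * \<psi> z) ^ (N + n) * cmod (of_nat (N + n) * x z + deriv g z))"
        using W_pos[OF z] by (intro mult_left_mono mult_right_mono) auto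
      with 1 have "W z * (A / 2 ^ (N + n) * cmod (of_nat (N + n) * x z + deriv g z)) \<le> NZ (T (kernel N u))"
        by linarith
      then show ?thesis using A by (simp add: field_simps)
    qed
    then show ?thesis by blast
  qed
  obtain B1 where B1: "\<And>z. z \<in> unit_disc \<Longrightarrow> W z * cmod (of_nat (N0 + n) * x z + deriv g z) \<le> B1"
    using ex[OF le_refl] by blast
  obtain B2 where B2: "\<And>z. z \<in> unit_disc \<Longrightarrow> W z * cmod (of_nat (Suc N0 + n) * x z + deriv g z) \<le> B2"
    using ex[OF le_SucI[OF le_refl]] by blast
  define R where "R = real (N0 + n) * (B1 + B2)"
  define B where "B = 4 * (B1 + B2) + B1 + R"
  have res: "W z * cmod (deriv \<psi> z * g z) \<le> 4 * (B1 + B2)"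
    "W z * cmod (deriv g z) \<le> B1 + R" "0 \<le> B1" "0 \<le> B2" if z: "z \<in> unit_disc" for z
  proof -
    have W: "W z > 0" by (rule W_pos[OF z])
    show B0: "0 \<le> B1" "0 \<le> B2"
      using B1[OF z] B2[OF z] W by (smt (verit) mult_nonneg_nonneg norm_ge_zero)+
    have "x z = (of_nat (Suc N0 + n) * x z + deriv g z) - (of_nat (N0 + n) * x z + deriv g z)"
      by (simp add: algebra_simps)
    then have "cmod (x z) \<le> cmod (of_nat (Suc N0 + n) * x z + deriv g z) + cmod (of_nat (N0 + n) * x z + deriv g z)"
      by (metis norm_triangle_ineq4)
    then have "W z * cmod (x z) \<le> W z * (cmod (of_nat (Suc N0 + n) * x z + deriv g z) + cmod (of_nat (N0 + n) * x z + deriv g z))"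
      using W by (intro mult_left_mono) auto
    then have Wx: "W z * cmod (x z) \<le> B1 + B2"
      using B1[OF z] B2[OF z] by (simp only: distrib_left)
    \<comment> \<open>One factor 2 comes from |u| = 1 / 2, the other from |1 - cnj u \<psi> z| \<le>
      2.\<close>
    have "cmod (deriv \<psi> z * g z) \<le> 4 * cmod (x z)"
    proof -
      have "cmod (1 - cnj u * \<psi> z) \<le> 2"
        using norm_triangle_ineq4[of 1 "cnj u * \<psi> z"] psi_in[OF z] by (simp add: u norm_mult norm_divide)
      moreover have "cmod (1 - cnj u * \<psi> z) > 0"
        using disc_kernel_nonzero[OF u(1), of "\<psi> z"] psi_in[OF z] by simp
      moreover have "cmod (x z) = cmod (deriv \<psi> z * g z) / 2 / cmod (1 - cnj u * \<psi> z)"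
        by (simp only: x_def norm_divide norm_mult[of "cnj u"]) (simp add: u norm_divide)
      moreover have "cmod (deriv \<psi> z * g z) / 2 / 2 \<le> cmod (deriv \<psi> z * g z) / 2 / cmod (1 - cnj u * \<psi> z)"
        using calculation(1,2) by (intro divide_left_mono) auto
      ultimately show ?thesis by linarith
    qed
    then have "W z * cmod (deriv \<psi> z * g z) \<le> W z * (4 * cmod (x z))"
      using W by (intro mult_left_mono) auto
    also have "\<dots> = 4 * (W z * cmod (x z))" by simp
    also have "\<dots> \<le> 4 * (B1 + B2)" using Wx by (intro mult_left_mono) auto
    finally show "W z * cmod (deriv \<psi> z * g z) \<le> 4 * (B1 + B2)" .
    have "cmod (deriv g z) \<le> cmod (of_nat (N0 + n) * x z + deriv g z) + real (N0 + n) * cmod (x z)"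
      using norm_triangle_ineq4[of "of_nat (N0 + n) * x z + deriv g z" "of_nat (N0 + n) * x z"]
      by (simp del: of_nat_add add: norm_mult)
    then have "W z * cmod (deriv g z) \<le> W z * (cmod (of_nat (N0 + n) * x z + deriv g z) + real (N0 + n) * cmod (x z))"
      using W by (intro mult_left_mono) auto
    also have "\<dots> = W z * cmod (of_nat (N0 + n) * x z + deriv g z) + real (N0 + n) * (W z * cmod (x z))"
      by (simp add: algebra_simps)
    also have "\<dots> \<le> B1 + R"
      unfolding R_def by (intro add_mono B1[OF z] mult_left_mono Wx) auto
    finally show "W z * cmod (deriv g z) \<le> B1 + R" .
  qed
  have B0: "0 \<le> B1" "0 \<le> B2" using res(3,4)[of 0] by auto
  have nn: "0 \<le> R" using B0 by (simp add: R_def)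
  show thesis
  proof (rule that[of B])
    show "0 \<le> B" using B0 nn by (simp add: B_def)
    show "W z * cmod (deriv \<psi> z * g z) \<le> B" "W z * cmod (deriv g z) \<le> B" if "z \<in> unit_disc" for z
      by (rule order_trans[OF res(1)[OF that]], use B0 nn in \<open>simp add: B_def\<close>)
         (rule order_trans[OF res(2)[OF that]], use B0 nn in \<open>simp add: B_def\<close>)
  qed
qed

end

section \<open>Upper estimate\<close>

definition dilate :: "real \<Rightarrow> (complex \<Rightarrow> complex) \<Rightarrow> complex \<Rightarrow> complex" where
  "dilate r f z = (if z \<in> unit_disc then f (of_real r * z) else 0)"

lemma dilate_in_disc:
  assumes "0 \<le> r" "r \<le> 1" "z \<in> unit_disc"
  shows "of_real r * z \<in> unit_disc" "cmod (of_real r * z) \<le> cmod z"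
  using assms mult_left_le_one_le[of "cmod z" r] by (auto simp: norm_mult)

lemma dilate_hol_aux:
  assumes "f holomorphic_on unit_disc" "0 \<le> r" "r \<le> 1"
  shows "(\<lambda>z. f (of_real r * z)) holomorphic_on unit_disc"
  by (rule holomorphic_on_compose_gen[OF _ assms(1), unfolded o_def])
     (use dilate_in_disc[OF assms(2,3)] in \<open>auto intro!: holomorphic_intros\<close>)

lemma dilate_HD:
  assumes "f holomorphic_on unit_disc" "0 \<le> r" "r \<le> 1"
  shows "dilate r f \<in> HD"
proof -
  have "dilate r f holomorphic_on unit_disc"
    by (rule holomorphic_transform[OF dilate_hol_aux[OF assms]]) (simp add: dilate_def)
  then show ?thesis by (simp add: HD_def dilate_def)
qed

lemma dilate_higher_deriv:
  assumes f: "f holomorphic_on unit_disc" and r: "0 \<le> r" "r \<le> 1" and z: "z \<in> unit_disc"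
  shows "(deriv ^^ k) (dilate r f) z = of_real r ^ k * (deriv ^^ k) f (of_real r * z)"
proof -
  have "(deriv ^^ k) (dilate r f) z = (deriv ^^ k) (\<lambda>z. f (of_real r * z)) z"
    using dilate_HD[OF f r] by (intro higher_deriv_transform_within_open[OF _ dilate_hol_aux[OF f r] open_ball z])
      (auto simp: HD_def dilate_def)
  also have "\<dots> = of_real r ^ k * (deriv ^^ k) f (of_real r * z)"
    by (rule higher_deriv_compose_linear[OF f open_ball open_ball z]) (use dilate_in_disc[OF r] in auto)
  finally show ?thesis .
qed

text \<open>Cauchy's inequality on the circle of radius (1 - r) / 2 about r w, which stays within
  |z| \<le> (1 + r) / 2. A bound on that compact disc thus controls derivatives of the dilation on
  the entire open disc.\<close>

lemma dilate_deriv_bound: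
  assumes h: "h holomorphic_on unit_disc" and r: "0 < r" "r < 1"
    and M: "\<And>z. cmod z \<le> (1 + r) / 2 \<Longrightarrow> cmod (h z) \<le> M" and w: "w \<in> unit_disc"
  shows "cmod ((deriv ^^ k) (dilate r h) w) \<le> fact k * M / ((1 - r) / 2) ^ k"
proof -
  let ?v = "of_real r * w"
  have rw: "r * cmod w \<le> r" using r w by (simp add: mult_left_le)
  have v: "cmod ?v \<le> r" using r rw by (simp add: norm_mult)
  have in_cball: "cmod x \<le> (1 + r) / 2" if "cmod (?v - x) \<le> (1 - r) / 2" for x
    using norm_triangle_sub[of x ?v] v that norm_minus_commute[of x ?v] by simp
  have sub: "cball ?v ((1 - r) / 2) \<subseteq> unit_disc"
  proof
    fix x assume "x \<in> cball ?v ((1 - r) / 2)"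
    then have "cmod x \<le> (1 + r) / 2" by (intro in_cball) (simp add: dist_norm)
    then show "x \<in> unit_disc" using r by simp
  qed
  have "cmod ((deriv ^^ k) h ?v) \<le> fact k * M / ((1 - r) / 2) ^ k"
  proof (rule Cauchy_inequality)
    show "h holomorphic_on ball ?v ((1 - r) / 2)"
      using h by (rule holomorphic_on_subset) (use sub ball_subset_cball in blast)
    show "continuous_on (cball ?v ((1 - r) / 2)) h"
      by (rule continuous_on_subset[OF holomorphic_on_imp_continuous_on[OF h] sub])
    show "cmod (h x) \<le> M" if "cmod (?v - x) = (1 - r) / 2" for x
      using in_cball[of x] that by (intro M) simp
  qed (use r in simp)
  moreover have "cmod ((deriv ^^ k) (dilate r h) w) \<le> cmod ((deriv ^^ k) h ?v)"
    using r w by (simp add: dilate_higher_deriv[OF h _ _ w] norm_mult norm_power mult_left_le_one_le power_le_one)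
  ultimately show ?thesis by linarith
qed

context normal_weight
begin

text \<open>The weight of the growth estimate decreases with the modulus. Hence its least value on a
  closed disc is attained at the rim, and an estimate at r w carries over to w.\<close>

lemma growth_weight_mono:
  assumes "0 \<le> s" "s \<le> t" "t < 1"
  shows "\<phi> t * (1 - t) powr (1 / q + real k) \<le> \<phi> s * (1 - s) powr (1 / q + real k)"
  using assms q_pos phi_decreasing[OF assms] phi_pos[of s]
  by (intro mult_mono powr_mono2) auto

lemma locally_bounded:
  assumes \<delta>: "0 \<le> \<delta>" "\<delta> < 1"
  shows "\<exists>M\<ge>0. \<forall>f\<in>X. \<forall>w. cmod w \<le> \<delta> \<longrightarrow> cmod ((deriv ^^ k) f w) \<le> M * NX f"
proof -
  obtain C where C: "C > 0" and gr: "\<And>f w. f \<in> X \<Longrightarrow> w \<in> unit_disc \<Longrightarrow>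
     cmod ((deriv ^^ k) f w) * (\<phi> (cmod w) * (1 - cmod w) powr (1 / q + real k)) \<le> C * NX f"
    using deriv_growth[of k] by blast
  define D where "D = \<phi> \<delta> * (1 - \<delta>) powr (1 / q + real k)"
  have D: "D > 0" using \<delta> phi_pos[OF \<delta>] by (simp add: D_def)
  have "cmod ((deriv ^^ k) f w) \<le> C / D * NX f" if f: "f \<in> X" and w: "cmod w \<le> \<delta>" for f w
  proof -
    have "cmod ((deriv ^^ k) f w) * D \<le> cmod ((deriv ^^ k) f w) * (\<phi> (cmod w) * (1 - cmod w) powr (1 / q + real k))"
      unfolding D_def using w \<delta> by (intro mult_left_mono growth_weight_mono) auto
    also have "\<dots> \<le> C * NX f" using f w \<delta> by (intro gr) auto
    finally show ?thesis using D by (simp add: field_simps)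
  qed
  moreover have "0 \<le> C / D" using C D by simp
  ultimately show ?thesis by blast
qed

text \<open>The difference is f^(k)(w) - r^k f^(k)(r w). The change of argument is controlled by the
  derivative of order k + 1, and the change of the factor by Bernoulli's inequality 1 - r^k \<le> k
  (1 - r). Both bounds are uniform on the unit ball by \<open>locally_bounded\<close>.\<close>

lemma dilate_close:
  assumes \<delta>: "0 \<le> \<delta>" "\<delta> < 1" and \<eta>: "\<eta> > 0"
  shows "\<exists>r0<1. \<forall>r f w. r0 < r \<longrightarrow> r < 1 \<longrightarrow> 0 < r \<longrightarrow> f \<in> X \<longrightarrow> NX f \<le> 1 \<longrightarrow> cmod w \<le> \<delta> \<longrightarrow>
     cmod ((deriv ^^ k) f w - (deriv ^^ k) (dilate r f) w) \<le> \<eta>"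
proof -
  obtain M1 where M1: "M1 \<ge> 0" "\<And>f w. f \<in> X \<Longrightarrow> cmod w \<le> \<delta> \<Longrightarrow> cmod ((deriv ^^ k) f w) \<le> M1 * NX f"
    using locally_bounded[OF \<delta>, of k] by blast
  obtain M2 where M2: "M2 \<ge> 0" "\<And>f w. f \<in> X \<Longrightarrow> cmod w \<le> \<delta> \<Longrightarrow> cmod ((deriv ^^ Suc k) f w) \<le> M2 * NX f"
    using locally_bounded[OF \<delta>, of "Suc k"] by blast
  define Q where "Q = M2 + real k * M1 + 1"
  have Q: "Q > 0" using M1(1) M2(1) by (simp add: Q_def add_nonneg_pos)
  have "cmod ((deriv ^^ k) f w - (deriv ^^ k) (dilate r f) w) \<le> \<eta>"
    if r: "1 - \<eta> / Q < r" "r < 1" "0 < r" and f: "f \<in> X" "NX f \<le> 1" and w: "cmod w \<le> \<delta>" for r f w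
  proof -
    have hol: "f holomorphic_on unit_disc" by (rule X_holomorphic[OF f(1)])
    have wd: "w \<in> unit_disc" using w \<delta> by simp
    let ?v = "of_real r * w"
    have v: "cmod ?v \<le> \<delta>" using dilate_in_disc(2)[of r w] r wd w by simp
    have b1: "cmod ((deriv ^^ k) f z) \<le> M1" if "cmod z \<le> \<delta>" for z
      using M1(2)[OF f(1) that] mult_left_le[OF f(2) M1(1)] by linarith
    have b2: "cmod ((deriv ^^ Suc k) f z) \<le> M2" if "cmod z \<le> \<delta>" for z
      using M2(2)[OF f(1) that] mult_left_le[OF f(2) M2(1)] by linarith
    have "cmod ((deriv ^^ k) f w - (deriv ^^ k) f ?v) \<le> M2 * cmod (w - ?v)"
    proof (rule field_differentiable_bound[OF convex_cball])
      show "((deriv ^^ k) f has_field_derivative (deriv ^^ Suc k) f z) (at z within cball 0 \<delta>)"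
        if "z \<in> cball 0 \<delta>" for z
        by (rule has_field_derivative_at_within[OF has_field_derivative_higher_deriv[OF hol open_ball]])
           (use that \<delta> in auto)
    qed (use b2 w v in auto)
    also have "cmod (w - ?v) = (1 - r) * cmod w"
    proof -
      have "w - ?v = of_real (1 - r) * w" by (simp add: algebra_simps)
      then show ?thesis using r by (simp only: norm_mult norm_of_real)
    qed
    also have "M2 * ((1 - r) * cmod w) \<le> M2 * (1 - r)"
      using r w \<delta> M2(1) by (intro mult_left_mono mult_left_le) auto
    finally have 1: "cmod ((deriv ^^ k) f w - (deriv ^^ k) f ?v) \<le> M2 * (1 - r)" .
    have "1 - r ^ k \<le> real k * (1 - r)"
      using Bernoulli_inequality[of "r - 1" k] r by (simp add: algebra_simps)
    then have 2: "(1 - r ^ k) * cmod ((deriv ^^ k) f ?v) \<le> real k * (1 - r) * M1"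
      using r b1[OF v] by (intro mult_mono) (auto simp: power_le_one)
    have "cmod ((deriv ^^ k) f w - (deriv ^^ k) (dilate r f) w)
      = cmod (((deriv ^^ k) f w - (deriv ^^ k) f ?v) + of_real (1 - r ^ k) * (deriv ^^ k) f ?v)"
      using r by (simp add: dilate_higher_deriv[OF hol _ _ wd] algebra_simps)
    also have "\<dots> \<le> cmod ((deriv ^^ k) f w - (deriv ^^ k) f ?v) + cmod (of_real (1 - r ^ k) * (deriv ^^ k) f ?v)"
      by (rule norm_triangle_ineq)
    also have "cmod (of_real (1 - r ^ k) * (deriv ^^ k) f ?v) = (1 - r ^ k) * cmod ((deriv ^^ k) f ?v)"
      using r power_le_one[of r k] by (simp only: norm_mult norm_of_real) simp
    finally have "cmod ((deriv ^^ k) f w - (deriv ^^ k) (dilate r f) w) \<le> M2 * (1 - r) + real k * (1 - r) * M1"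
      using 1 2 by linarith
    also have "\<dots> = (M2 + real k * M1) * (1 - r)" by (simp add: algebra_simps)
    also have "\<dots> \<le> Q * (1 - r)" using r by (intro mult_right_mono) (auto simp: Q_def)
    also have "\<dots> \<le> Q * (\<eta> / Q)" using r Q by (intro mult_left_mono) auto
    also have "\<dots> = \<eta>" using Q by simp
    finally show ?thesis .
  qed
  moreover have "1 - \<eta> / Q < 1" using \<eta> Q by simp
  ultimately show ?thesis by blast
qed

end

section \<open>Compact approximants and the upper bound\<close>

context bounded_gen_op
begin

lemma second_deriv_estimate:
  assumes z: "z \<in> unit_disc" and B: "W z * cmod (deriv \<psi> z * g z) \<le> B" "W z * cmod (deriv g z) \<le> B"
    and M: "cmod ((deriv ^^ n) h (\<psi> z)) \<le> M" "cmod ((deriv ^^ Suc n) h (\<psi> z)) \<le> M"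
  shows "W z * cmod (second_deriv h z) \<le> 2 * (M * B)"
proof -
  have W: "W z > 0" by (rule W_pos[OF z])
  have M0: "0 \<le> M" using M(1) norm_ge_zero order_trans by blast
  have "cmod (second_deriv h z) \<le> cmod ((deriv ^^ Suc n) h (\<psi> z)) * cmod (deriv \<psi> z * g z) + cmod ((deriv ^^ n) h (\<psi> z)) * cmod (deriv g z)"
    unfolding second_deriv_def using norm_triangle_ineq by (metis norm_mult)
  also have "\<dots> \<le> M * cmod (deriv \<psi> z * g z) + M * cmod (deriv g z)"
    by (intro add_mono mult_right_mono M) auto
  finally have "W z * cmod (second_deriv h z) \<le> W z * (M * cmod (deriv \<psi> z * g z) + M * cmod (deriv g z))"
    using W by (intro mult_left_mono) auto
  also have "\<dots> = M * (W z * cmod (deriv \<psi> z * g z)) + M * (W z * cmod (deriv g z))"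
    by (simp add: algebra_simps)
  also have "\<dots> \<le> M * B + M * B"
    by (intro add_mono mult_left_mono B M0)
  finally show ?thesis by (simp only: mult_2)
qed

text \<open>Of the three terms of the Zygmund norm the value at 0 vanishes, the first derivative at
  0 contributes M |g 0|, and the two summands of the second derivative contribute M B each.\<close>

lemma op_bounded_derivs:
  assumes B: "\<And>z. z \<in> unit_disc \<Longrightarrow> W z * cmod (deriv \<psi> z * g z) \<le> B"
     "\<And>z. z \<in> unit_disc \<Longrightarrow> W z * cmod (deriv g z) \<le> B"
    and h: "h holomorphic_on unit_disc"
    and M: "\<And>z. z \<in> unit_disc \<Longrightarrow> cmod ((deriv ^^ n) h z) \<le> M"
     "\<And>z. z \<in> unit_disc \<Longrightarrow> cmod ((deriv ^^ Suc n) h z) \<le> M"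
  shows "T h \<in> Z" "NZ (T h) \<le> M * (cmod (g 0) + 2 * B)"
proof -
  have pt: "W z * cmod ((deriv ^^ 2) (T h) z) \<le> 2 * (M * B)" if z: "z \<in> unit_disc" for z
    unfolding op_deriv2[OF h z] by (rule second_deriv_estimate[OF z B[OF z] M[OF psi_in[OF z]]])
  note bd = zygmund_bound[OF op_HD[OF h] pt]
  show "T h \<in> Z" by (rule bd(1))
  have "cmod (deriv (T h) 0) \<le> M * cmod (g 0)"
    using M(1)[OF psi_in, of 0] by (simp add: op_deriv[OF h] norm_mult mult_right_mono)
  then show "NZ (T h) \<le> M * (cmod (g 0) + 2 * B)"
    using bd(2) by (simp add: op_0 algebra_simps)
qed

lemma op_dilate:
  assumes h: "h holomorphic_on unit_disc" and r: "0 < r" "r < 1"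
    and M: "\<And>z. cmod z \<le> (1 + r) / 2 \<Longrightarrow> cmod (h z) \<le> M" "0 \<le> M"
    and B: "\<And>z. z \<in> unit_disc \<Longrightarrow> W z * cmod (deriv \<psi> z * g z) \<le> B"
     "\<And>z. z \<in> unit_disc \<Longrightarrow> W z * cmod (deriv g z) \<le> B"
  shows "T (dilate r h) \<in> Z"
    "NZ (T (dilate r h)) \<le> M * (fact (Suc n) / ((1 - r) / 2) ^ Suc n) * (cmod (g 0) + 2 * B)"
proof -
  have bound: "cmod ((deriv ^^ k) (dilate r h) w) \<le> M * (fact (Suc n) / ((1 - r) / 2) ^ Suc n)"
    if w: "w \<in> unit_disc" and k: "k \<le> Suc n" for w k
  proof -
    \<comment> \<open>Since (1 - r) / 2 \<le> 1, the Cauchy constant increases with k, so the one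
      for n + 1 serves both orders n and n + 1.\<close>
    have "(fact k :: real) / ((1 - r) / 2) ^ k \<le> fact (Suc n) / ((1 - r) / 2) ^ Suc n"
      using r k by (intro frac_le fact_mono power_decreasing) auto
    from mult_left_mono[OF this M(2)] show ?thesis
      using dilate_deriv_bound[OF h r M(1) w, of k] by (simp add: mult.commute)
  qed
  have hol: "dilate r h holomorphic_on unit_disc" using dilate_HD[OF h] r by (simp add: HD_def)
  show "T (dilate r h) \<in> Z"
    by (rule op_bounded_derivs(1)[OF B hol bound bound]) auto
  show "NZ (T (dilate r h)) \<le> M * (fact (Suc n) / ((1 - r) / 2) ^ Suc n) * (cmod (g 0) + 2 * B)"
    by (rule op_bounded_derivs(2)[OF B hol bound bound]) auto
qed

text \<open>By \<open>est\<close>, the norm of \<open>T (dilate r h)\<close> is controlled by the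
  maximum of |h| on the disc of radius (1 + r) / 2. Locally uniform convergence of a subsequence
  therefore turns into convergence in norm. Boundedness of T enters through
  \<open>symbols_bounded\<close>.\<close>

lemma compact_dilate:
  assumes r: "0 < r" "r < 1"
  shows "compact_operator X NX Z NZ (\<lambda>f. T (dilate r f))"
proof -
  obtain B where B: "B \<ge> 0" "\<And>z. z \<in> unit_disc \<Longrightarrow> W z * cmod (deriv \<psi> z * g z) \<le> B"
    "\<And>z. z \<in> unit_disc \<Longrightarrow> W z * cmod (deriv g z) \<le> B"
    by (rule symbols_bounded) (rule that)
  define t where "t = (1 + r) / 2"
  have t: "0 \<le> t" "t < 1" using r by (auto simp: t_def)
  define Q where "Q = fact (Suc n) / ((1 - r) / 2) ^ Suc n * (cmod (g 0) + 2 * B)"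
  have Q: "Q \<ge> 0" using r B by (simp add: Q_def)
  have est: "T (dilate r h) \<in> Z \<and> NZ (T (dilate r h)) \<le> M * Q"
    if h: "h holomorphic_on unit_disc" and M: "\<And>z. cmod z \<le> t \<Longrightarrow> cmod (h z) \<le> M" "0 \<le> M" for h M
    using op_dilate[OF h r M(1)[unfolded t_def] M(2) B(2,3)] by (simp add: Q_def mult.assoc)
  have in_Z: "T (dilate r h) \<in> Z" if h: "h holomorphic_on unit_disc" for h
  proof -
    have "compact (h ` cball 0 t)"
      using t by (intro compact_continuous_image continuous_on_subset[OF holomorphic_on_imp_continuous_on[OF h]]) auto
    from compact_imp_bounded[OF this] obtain M where "\<forall>x\<in>h ` cball 0 t. cmod x \<le> M"
      unfolding bounded_iff by auto
    then have M: "cmod (h z) \<le> M" if "cmod z \<le> t" for z using that by simp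
    moreover have "0 \<le> M" using M[of 0] t order_trans[OF norm_ge_zero[of "h 0"]] by simp
    ultimately show ?thesis using est[OF h] by blast
  qed
  have hold: "dilate r f holomorphic_on unit_disc" if "f holomorphic_on unit_disc" for f
    using dilate_HD[OF that] r by (simp add: HD_def)
  have lin: "linear_operator X Z (\<lambda>f. T (dilate r f))"
    unfolding linear_operator_def
  proof (intro conjI ballI allI)
    fix f h c assume f: "f \<in> X"
    show "T (dilate r f) \<in> Z" by (rule in_Z[OF X_holomorphic[OF f]])
    have "dilate r (\<lambda>z. c * f z) = (\<lambda>z. c * dilate r f z)" by (auto simp: dilate_def)
    then show "T (dilate r (\<lambda>z. c * f z)) = (\<lambda>z. c * T (dilate r f) z)"
      using op_combine(3)[OF hold[OF X_holomorphic[OF f]] hold[OF X_holomorphic[OF f]]] by simp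
    assume h: "h \<in> X"
    have "dilate r (\<lambda>z. f z + h z) = (\<lambda>z. dilate r f z + dilate r h z)" by (auto simp: dilate_def)
    then show "T (dilate r (\<lambda>z. f z + h z)) = (\<lambda>z. T (dilate r f) z + T (dilate r h) z)"
      using op_combine(1)[OF hold[OF X_holomorphic[OF f]] hold[OF X_holomorphic[OF h]]] by simp
  qed
  interpret ZM: Metric_space Z "norm_dist Z NZ" by (rule Metric_space_zygmund[OF weight])
  have "relatively_compact Z NZ ((\<lambda>f. T (dilate r f)) ` A)"
    if A: "A \<subseteq> X" and A_bdd: "\<exists>M. \<forall>f\<in>A. NX f \<le> M" for A
  proof -
    let ?S = "(\<lambda>f. T (dilate r f)) ` A"
    have SZ: "?S \<subseteq> Z" using A in_Z X_holomorphic by blast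
    obtain M where M: "\<And>f. f \<in> A \<Longrightarrow> NX f \<le> M" using A_bdd by blast
    have seq: "\<exists>l \<rho>. l \<in> Z \<and> strict_mono \<rho> \<and> limitin ZM.mtopology (\<sigma> \<circ> \<rho>) l sequentially"
      if \<sigma>: "range \<sigma> \<subseteq> ?S" for \<sigma> :: "nat \<Rightarrow> complex \<Rightarrow> complex"
    proof -
      have "\<forall>k. \<exists>f\<in>A. \<sigma> k = T (dilate r f)" using \<sigma> by blast
      then obtain F where F: "\<And>k. F k \<in> A" "\<And>k. \<sigma> k = T (dilate r (F k))" by metis
      have bdd: "\<exists>C. \<forall>h\<in>A. \<forall>z\<in>K. cmod (h z) \<le> C" if K: "compact K" "K \<subseteq> unit_disc" for K
      proof (cases "K = {}")
        case False
        obtain z0 where z0: "z0 \<in> K" "\<And>z. z \<in> K \<Longrightarrow> cmod z \<le> cmod z0"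
          using continuous_attains_sup[OF K(1) False continuous_on_norm_id] by auto
        have \<delta>: "0 \<le> cmod z0" "cmod z0 < 1" using z0(1) K(2) by auto
        obtain C where C: "C \<ge> 0" "\<forall>f\<in>X. \<forall>w. cmod w \<le> cmod z0 \<longrightarrow> cmod ((deriv ^^ 0) f w) \<le> C * NX f"
          using locally_bounded[OF \<delta>, of 0] by blast
        have "cmod (h z) \<le> C * M" if "h \<in> A" "z \<in> K" for h z
        proof -
          have "cmod (h z) \<le> C * NX h" using C(2) that A z0(2) by auto
          also have "\<dots> \<le> C * M" using C(1) M[OF that(1)] by (rule mult_left_mono[rotated])
          finally show ?thesis .
        qed
        then show ?thesis by blast
      qed simp
      \<comment> \<open>The limit f is only known to be holomorphic. This is enough, because
        \<open>in_Z\<close> and \<open>est\<close> are formulated for every holomorphic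
        function.\<close>
      obtain f \<rho> where f: "f holomorphic_on unit_disc" and \<rho>: "strict_mono (\<rho> :: nat \<Rightarrow> nat)"
        and unif: "\<And>K. compact K \<Longrightarrow> K \<subseteq> unit_disc \<Longrightarrow> uniform_limit K (F \<circ> \<rho>) f sequentially"
      proof (rule Montel[of unit_disc A F])
        show "h holomorphic_on unit_disc" if "h \<in> A" for h using that A X_holomorphic by blast
        show "range F \<subseteq> A" using F(1) by blast
      qed (use bdd in blast)+
      have "limitin ZM.mtopology (\<sigma> \<circ> \<rho>) (T (dilate r f)) sequentially"
        unfolding ZM.limitin_metric
      proof (intro conjI allI impI in_Z f)
        fix \<epsilon> :: real assume \<epsilon>: "\<epsilon> > 0"
        \<comment> \<open>The summand 1 keeps the denominator positive even if Q = 0 and makes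
          \<eta> Q < \<epsilon> strict.\<close>
        define \<eta> where "\<eta> = \<epsilon> / (Q + 1)"
        have \<eta>: "\<eta> > 0" "\<eta> * Q < \<epsilon>" using \<epsilon> Q by (auto simp: \<eta>_def field_simps)
        have "\<forall>\<^sub>F k in sequentially. \<forall>x\<in>cball 0 t. dist ((F \<circ> \<rho>) k x) (f x) < \<eta>"
          using t by (intro uniform_limitD[OF unif] \<eta>) auto
        then show "\<forall>\<^sub>F k in sequentially. (\<sigma> \<circ> \<rho>) k \<in> Z \<and> norm_dist Z NZ ((\<sigma> \<circ> \<rho>) k) (T (dilate r f)) < \<epsilon>"
        proof eventually_elim
          case (elim k)
          have Fh: "F (\<rho> k) holomorphic_on unit_disc" using F(1) A X_holomorphic by blast
          have "dilate r (\<lambda>z. F (\<rho> k) z - f z) = (\<lambda>z. dilate r (F (\<rho> k)) z - dilate r f z)"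
            by (auto simp: dilate_def)
          then have eq: "(\<lambda>z. T (dilate r (F (\<rho> k))) z - T (dilate r f) z) = T (dilate r (\<lambda>z. F (\<rho> k) z - f z))"
            using op_combine(2)[OF hold[OF Fh] hold[OF f]] by simp
          have "NZ (T (dilate r (\<lambda>z. F (\<rho> k) z - f z))) \<le> \<eta> * Q"
            using est[of "\<lambda>z. F (\<rho> k) z - f z" \<eta>] elim \<eta>(1) Fh f
            by (auto simp: dist_norm less_imp_le intro: holomorphic_intros)
          then show ?case using in_Z[OF Fh] in_Z[OF f] \<eta>(2) by (simp add: norm_dist_def F(2) eq)
        qed
      qed
      then show ?thesis using \<rho> in_Z[OF f] by blast
    qed
    have "\<forall>T'. T' \<subseteq> ?S \<and> infinite T' \<longrightarrow> Z \<inter> ZM.mtopology derived_set_of T' \<noteq> {}"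
      using ZM.Bolzano_Weierstrass_property[OF SZ SZ] seq by blast
    then show ?thesis
      unfolding relatively_compact_def ZM.compact_closure_of_eq_Bolzano_Weierstrass by blast
  qed
  then show ?thesis unfolding compact_operator_def using lin by blast
qed

text \<open>Origin of the factor: near the boundary f and its dilation each contribute C, the
  passage from 1 - |w| to 1 - |w|^2 costs at most 2 powr (1 / q + n + 1), and the two summands of
  the second derivative double the result. Everything else is absorbed in \<epsilon>.\<close>

lemma essential_norm_upper_real:
  assumes C: "C \<ge> 0" "\<And>f w k. f \<in> X \<Longrightarrow> w \<in> unit_disc \<Longrightarrow> k \<in> {n, Suc n} \<Longrightarrow>
     cmod ((deriv ^^ k) f w) * (\<phi> (cmod w) * (1 - cmod w) powr (1 / q + real k)) \<le> C * NX f"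
    and \<delta>: "\<delta> < 1" and l: "\<And>z. z \<in> unit_disc \<Longrightarrow> \<delta> < cmod (\<psi> z) \<Longrightarrow> U z \<le> l"
      "\<And>z. z \<in> unit_disc \<Longrightarrow> \<delta> < cmod (\<psi> z) \<Longrightarrow> V z \<le> l" "0 \<le> l" and \<epsilon>: "\<epsilon> > 0"
  shows "essential_norm X NX Z NZ T \<le> ennreal (4 * C * 2 powr (1 / q + real n + 1) * l + \<epsilon>)"
proof -
  obtain B where B: "B \<ge> 0" "\<And>z. z \<in> unit_disc \<Longrightarrow> W z * cmod (deriv \<psi> z * g z) \<le> B"
    "\<And>z. z \<in> unit_disc \<Longrightarrow> W z * cmod (deriv g z) \<le> B"
    by (rule symbols_bounded) (rule that)
  \<comment> \<open>The radius also covers \<psi> 0, so that the first derivative of T h at 0, which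
    is part of the Zygmund norm, falls into the region where h is small.\<close>
  define \<delta>' where "\<delta>' = max \<delta> (cmod (\<psi> 0))"
  have \<delta>': "0 \<le> \<delta>'" "\<delta>' < 1" "cmod (\<psi> 0) \<le> \<delta>'" "\<delta> \<le> \<delta>'"
    using psi_in[of 0] \<delta> norm_ge_zero[of "\<psi> 0"] unfolding \<delta>'_def by (auto simp: le_max_iff_disj)
  define \<eta> where "\<eta> = \<epsilon> / (cmod (g 0) + 2 * B + 1)"
  have den: "0 < cmod (g 0) + 2 * B + 1" using B(1) by (simp add: add_nonneg_pos)
  have \<eta>: "\<eta> > 0" using \<epsilon> den by (simp add: \<eta>_def)
  have "\<eta> * (cmod (g 0) + 2 * B + 1) = \<epsilon>" using den by (simp add: \<eta>_def)
  then have \<eta>\<epsilon>: "\<eta> * cmod (g 0) + 2 * (\<eta> * B) \<le> \<epsilon>" using \<eta> by (simp add: algebra_simps)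
  obtain r1 where r1: "r1 < 1" "\<And>r f w. r1 < r \<Longrightarrow> r < 1 \<Longrightarrow> 0 < r \<Longrightarrow> f \<in> X \<Longrightarrow> NX f \<le> 1 \<Longrightarrow> cmod w \<le> \<delta>' \<Longrightarrow>
     cmod ((deriv ^^ n) f w - (deriv ^^ n) (dilate r f) w) \<le> \<eta>"
    using dilate_close[OF \<delta>'(1,2) \<eta>, of n] by blast
  obtain r2 where r2: "r2 < 1" "\<And>r f w. r2 < r \<Longrightarrow> r < 1 \<Longrightarrow> 0 < r \<Longrightarrow> f \<in> X \<Longrightarrow> NX f \<le> 1 \<Longrightarrow> cmod w \<le> \<delta>' \<Longrightarrow>
     cmod ((deriv ^^ Suc n) f w - (deriv ^^ Suc n) (dilate r f) w) \<le> \<eta>"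
    using dilate_close[OF \<delta>'(1,2) \<eta>, of "Suc n"] by blast
  obtain r where r: "max 0 (max r1 r2) < r" "r < 1"
    using dense[of "max 0 (max r1 r2)" 1] r1(1) r2(1) by auto
  then have r': "0 < r" "r < 1" "r1 < r" "r2 < r" by auto
  define P where "P = 2 powr (1 / q + real n + 1)"
  have P: "P > 0" by (simp add: P_def)
  define K where "K = 4 * C * P * l"
  have K: "K \<ge> 0" using C(1) P l(3) by (simp add: K_def)
  have bound: "NZ (\<lambda>z. T f z - T (dilate r f) z) \<le> K + \<epsilon>" if f: "f \<in> X" "NX f \<le> 1" for f
  proof -
    have hol: "f holomorphic_on unit_disc" by (rule X_holomorphic[OF f(1)])
    have dhol: "dilate r f holomorphic_on unit_disc" using dilate_HD[OF hol] r' by (simp add: HD_def)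
    define h where "h = (\<lambda>z. f z - dilate r f z)"
    have h: "h holomorphic_on unit_disc" unfolding h_def by (intro holomorphic_intros hol dhol)
    have hd: "(deriv ^^ k) h w = (deriv ^^ k) f w - (deriv ^^ k) (dilate r f) w" if "w \<in> unit_disc" for k w
      unfolding h_def by (rule higher_deriv_diff[OF hol dhol open_ball that])
    have small: "cmod ((deriv ^^ n) h w) \<le> \<eta>" "cmod ((deriv ^^ Suc n) h w) \<le> \<eta>" if "cmod w \<le> \<delta>'" for w
    proof -
      have w: "w \<in> unit_disc" using that \<delta>'(2) by simp
      show "cmod ((deriv ^^ n) h w) \<le> \<eta>" "cmod ((deriv ^^ Suc n) h w) \<le> \<eta>"
        unfolding hd[OF w] by (rule r1(2)[OF r'(3,2,1) f that], rule r2(2)[OF r'(4,2,1) f that])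
    qed
    have big: "cmod ((deriv ^^ k) h w) * (\<phi> (cmod w) * (1 - (cmod w)\<^sup>2) powr (1 / q + real k)) \<le> 2 * C * P"
      if w: "w \<in> unit_disc" and k: "k \<in> {n, Suc n}" for w k
    proof -
      let ?D = "\<phi> (cmod w) * (1 - cmod w) powr (1 / q + real k)"
      let ?v = "of_real r * w"
      have v: "?v \<in> unit_disc" "cmod ?v \<le> cmod w" using dilate_in_disc[of r w] r' w by auto
      have D: "?D > 0" using w phi_pos[of "cmod w"] by simp
      have CN: "C * NX f \<le> C" using C(1) f(2) by (simp add: mult_left_le)
      have 1: "cmod ((deriv ^^ k) f w) * ?D \<le> C" using C(2)[OF f(1) w k] CN by linarith
      have "cmod ((deriv ^^ k) (dilate r f) w) \<le> cmod ((deriv ^^ k) f ?v)"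
        using r' by (simp add: dilate_higher_deriv[OF hol _ _ w] norm_mult norm_power mult_left_le_one_le power_le_one)
      \<comment> \<open>The growth estimate is applied to f at r w, not to the dilation; since |r w|
        \<le> |w|, the weight there is at least the weight at w.\<close>
      then have "cmod ((deriv ^^ k) (dilate r f) w) * ?D \<le>
          cmod ((deriv ^^ k) f ?v) * (\<phi> (cmod ?v) * (1 - cmod ?v) powr (1 / q + real k))"
        using v w D by (intro mult_mono growth_weight_mono) auto
      also have "\<dots> \<le> C" using C(2)[OF f(1) v(1) k] CN by linarith
      finally have 2: "cmod ((deriv ^^ k) (dilate r f) w) * ?D \<le> C" .
      have "cmod ((deriv ^^ k) h w) * ?D \<le> (cmod ((deriv ^^ k) f w) + cmod ((deriv ^^ k) (dilate r f) w)) * ?D"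
        unfolding hd[OF w] using D by (intro mult_right_mono norm_triangle_ineq4) auto
      also have "\<dots> \<le> 2 * C" using 1 2 unfolding distrib_right by linarith
      finally have 3: "cmod ((deriv ^^ k) h w) * ?D \<le> 2 * C" .
      have "(1 - (cmod w)\<^sup>2) powr (1 / q + real k) \<le> P * (1 - cmod w) powr (1 / q + real k)"
      proof -
        have "1 - (cmod w)\<^sup>2 = (1 + cmod w) * (1 - cmod w)" by (simp add: power2_eq_square algebra_simps)
        moreover have "(1 + cmod w) * (1 - cmod w) \<le> 2 * (1 - cmod w)"
          using w by (intro mult_right_mono) auto
        ultimately have s: "0 \<le> 1 - (cmod w)\<^sup>2" "1 - (cmod w)\<^sup>2 \<le> 2 * (1 - cmod w)"
          using w by auto
        then have "(1 - (cmod w)\<^sup>2) powr (1 / q + real k) \<le> (2 * (1 - cmod w)) powr (1 / q + real k)"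
          using q_pos by (intro powr_mono2) auto
        also have "\<dots> = 2 powr (1 / q + real k) * (1 - cmod w) powr (1 / q + real k)"
          by (rule powr_mult)
        also have "\<dots> \<le> P * (1 - cmod w) powr (1 / q + real k)"
          unfolding P_def using k by (intro mult_right_mono powr_mono) auto
        finally show ?thesis .
      qed
      then have "cmod ((deriv ^^ k) h w) * (\<phi> (cmod w) * (1 - (cmod w)\<^sup>2) powr (1 / q + real k))
        \<le> cmod ((deriv ^^ k) h w) * (\<phi> (cmod w) * (P * (1 - cmod w) powr (1 / q + real k)))"
        using phi_pos[of "cmod w"] w by (intro mult_left_mono) auto
      also have "\<dots> = P * (cmod ((deriv ^^ k) h w) * ?D)" by simp
      also have "\<dots> \<le> P * (2 * C)" using 3 P by (intro mult_left_mono) auto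
      finally show ?thesis by (simp only: mult_ac)
    qed
    have eq: "(\<lambda>z. T f z - T (dilate r f) z) = T h"
      unfolding h_def using op_combine(2)[OF hol dhol] by simp
    have "W z * cmod (second_deriv h z) \<le> K + 2 * (\<eta> * B)" if z: "z \<in> unit_disc" for z
    proof (cases "cmod (\<psi> z) \<le> \<delta>'")
      case True
      have "W z * cmod (second_deriv h z) \<le> 2 * (\<eta> * B)"
        by (rule second_deriv_estimate[OF z B(2,3)[OF z] small[OF True]])
      then show ?thesis using K by linarith
    next
      case False
      let ?w = "\<psi> z"
      have wz: "?w \<in> unit_disc" by (rule psi_in[OF z])
      have Dpos: "\<phi> (cmod ?w) * (1 - (cmod ?w)\<^sup>2) powr e > 0" for e
      proof -
        have "(cmod ?w)\<^sup>2 \<noteq> 1" using wz by (simp add: power2_eq_1_iff) (smt (verit) norm_ge_zero)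
        then show ?thesis using phi_pos[of "cmod ?w"] wz by simp
      qed
      have cancel: "x = x / d * d" if "d > 0" for x d :: real using that by simp
      have UV: "U z \<le> l" "V z \<le> l" using l(1,2)[OF z] False \<delta>' by auto
      have a1: "W z * (cmod ((deriv ^^ Suc n) h ?w) * cmod (deriv \<psi> z * g z)) \<le> 2 * C * P * l"
      proof -
        let ?D = "\<phi> (cmod ?w) * (1 - (cmod ?w)\<^sup>2) powr (1 / q + real n + 1)"
        have eq: "W z * cmod (deriv \<psi> z * g z) = U z * ?D"
          unfolding U_def by (rule cancel[OF Dpos])
        have "W z * (cmod ((deriv ^^ Suc n) h ?w) * cmod (deriv \<psi> z * g z)) = (cmod ((deriv ^^ Suc n) h ?w) * ?D) * U z"
          unfolding mult.left_commute[of "W z"] eq by (simp only: mult_ac)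
        also have "\<dots> \<le> (2 * C * P) * l"
        proof (rule mult_mono[OF _ UV(1)])
          have "1 / q + real (Suc n) = 1 / q + real n + 1" by simp
          then show "cmod ((deriv ^^ Suc n) h ?w) * ?D \<le> 2 * C * P"
            using big[OF wz, of "Suc n"] by (simp only: insert_iff simp_thms)
          show "0 \<le> 2 * C * P" using C(1) P by simp
          show "0 \<le> U z"
            unfolding U_def using W_pos[OF z] Dpos[of "1 / q + real n + 1"] by (intro divide_nonneg_pos) auto
        qed
        finally show ?thesis .
      qed
      have a2: "W z * (cmod ((deriv ^^ n) h ?w) * cmod (deriv g z)) \<le> 2 * C * P * l"
      proof -
        let ?D = "\<phi> (cmod ?w) * (1 - (cmod ?w)\<^sup>2) powr (1 / q + real n)"
        have eq: "W z * cmod (deriv g z) = V z * ?D"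
          unfolding V_def by (rule cancel[OF Dpos])
        have "W z * (cmod ((deriv ^^ n) h ?w) * cmod (deriv g z)) = (cmod ((deriv ^^ n) h ?w) * ?D) * V z"
          unfolding mult.left_commute[of "W z"] eq by (simp only: mult_ac)
        also have "\<dots> \<le> (2 * C * P) * l"
        proof (rule mult_mono[OF _ UV(2)])
          show "cmod ((deriv ^^ n) h ?w) * ?D \<le> 2 * C * P"
            using big[OF wz, of n] by simp
          show "0 \<le> 2 * C * P" using C(1) P by simp
          show "0 \<le> V z"
            unfolding V_def using W_pos[OF z] Dpos[of "1 / q + real n"] by (intro divide_nonneg_pos) auto
        qed
        finally show ?thesis .
      qed
      have "cmod (second_deriv h z) \<le> cmod ((deriv ^^ Suc n) h ?w) * cmod (deriv \<psi> z * g z) + cmod ((deriv ^^ n) h ?w) * cmod (deriv g z)"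
        unfolding second_deriv_def using norm_triangle_ineq by (metis norm_mult)
      then have "W z * cmod (second_deriv h z) \<le> W z * (cmod ((deriv ^^ Suc n) h ?w) * cmod (deriv \<psi> z * g z) + cmod ((deriv ^^ n) h ?w) * cmod (deriv g z))"
        using W_pos[OF z] by (intro mult_left_mono) auto
      also have "\<dots> \<le> 2 * C * P * l + 2 * C * P * l"
        unfolding distrib_left by (intro add_mono a1 a2)
      also have "\<dots> = K" by (simp add: K_def)
      finally have "W z * cmod (second_deriv h z) \<le> K" .
      moreover have "0 \<le> 2 * (\<eta> * B)" using \<eta> B(1) by simp
      ultimately show ?thesis by linarith
    qed
    then have "NZ (T h) \<le> cmod (T h 0) + cmod (deriv (T h) 0) + (K + 2 * (\<eta> * B))"
      by (intro zygmund_bound(2)[OF op_HD[OF h]]) (simp add: op_deriv2[OF h])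
    moreover have "cmod (deriv (T h) 0) \<le> \<eta> * cmod (g 0)"
      using small(1)[OF \<delta>'(3)] by (simp add: op_deriv[OF h] norm_mult mult_right_mono)
    ultimately show ?thesis unfolding eq using \<eta>\<epsilon> by (simp add: op_0)
  qed
  have "essential_norm X NX Z NZ T \<le> operator_norm X NX NZ (\<lambda>f z. T f z - T (dilate r f) z)"
    unfolding essential_norm_def by (rule INF_lower) (use compact_dilate[OF r'(1,2)] in simp)
  also have "\<dots> \<le> ennreal (K + \<epsilon>)"
    unfolding operator_norm_def using bound by (intro SUP_least ennreal_leI) auto
  finally show ?thesis by (simp add: K_def P_def)
qed

text \<open>The additional 1 makes the factor positive even when C = 0, so that the right-hand side
  is infinite whenever the limit superior is.\<close>

lemma essential_norm_upper:
  assumes C: "C \<ge> 0" "\<And>f w k. f \<in> X \<Longrightarrow> w \<in> unit_disc \<Longrightarrow> k \<in> {n, Suc n} \<Longrightarrow>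
     cmod ((deriv ^^ k) f w) * (\<phi> (cmod w) * (1 - cmod w) powr (1 / q + real k)) \<le> C * NX f"
  shows "essential_norm X NX Z NZ T \<le>
    ennreal (4 * C * 2 powr (1 / q + real n + 1) + 1) * max (boundary_limsup \<psi> U) (boundary_limsup \<psi> V)"
    (is "?E \<le> ennreal (?c + 1) * ?L")
proof (cases "?L = \<infinity>")
  case True
  have "?c + 1 > 0" using C(1) by (intro add_nonneg_pos) auto
  then have "ennreal (?c + 1) \<noteq> 0" by (metis less_irrefl ennreal_eq_0_iff not_le)
  then show ?thesis by (simp only: True infinity_ennreal_def ennreal_mult_top if_False top_greatest)
next
  case False
  then obtain L where L: "L \<ge> 0" "?L = ennreal L" by (cases ?L) auto
  have c: "0 \<le> ?c" using C(1) by simp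
  have "?E \<le> ennreal (?c * L) + ennreal e" if e: "e > 0" for e
  proof -
    \<comment> \<open>Replacing L by L + \<epsilon> costs ?c * \<epsilon>, and
      \<open>essential_norm_upper_real\<close> adds another \<epsilon>; together they make exactly
      e.\<close>
    define \<epsilon> where "\<epsilon> = e / (?c + 1)"
    have "?c + 1 > 0" using c by linarith
    then have \<epsilon>: "\<epsilon> > 0" "(?c + 1) * \<epsilon> = e" using e by (auto simp: \<epsilon>_def)
    have lt: "ennreal L < ennreal (L + \<epsilon>)" using L \<epsilon> by (intro ennreal_lessI) auto
    have "boundary_limsup \<psi> U \<le> ennreal L" "boundary_limsup \<psi> V \<le> ennreal L" using L(2) by (metis max.cobounded1, metis max.cobounded2)
    then have "boundary_limsup \<psi> U < ennreal (L + \<epsilon>)" "boundary_limsup \<psi> V < ennreal (L + \<epsilon>)"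
      using lt by (auto intro: order.strict_trans1)
    then obtain \<delta>1 \<delta>2 where d: "\<delta>1 < 1" "\<And>z. z \<in> unit_disc \<Longrightarrow> \<delta>1 < cmod (\<psi> z) \<Longrightarrow> U z \<le> L + \<epsilon>"
      "\<delta>2 < 1" "\<And>z. z \<in> unit_disc \<Longrightarrow> \<delta>2 < cmod (\<psi> z) \<Longrightarrow> V z \<le> L + \<epsilon>"
      using boundary_limsup_less_ennrealD[OF _ psi_disc] by metis
    have "?E \<le> ennreal (?c * (L + \<epsilon>) + \<epsilon>)"
      by (rule essential_norm_upper_real[OF C, of "max \<delta>1 \<delta>2"]) (use d L \<epsilon> in auto)
    also have "?c * (L + \<epsilon>) + \<epsilon> = ?c * L + e" unfolding \<epsilon>(2)[symmetric] by (simp add: algebra_simps)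
    finally show ?thesis using L c e by (simp add: ennreal_plus)
  qed
  then have "?E \<le> ennreal (?c * L)" by (rule ennreal_le_epsilon)
  also have "\<dots> \<le> ennreal ((?c + 1) * L)" using L c by (intro ennreal_leI mult_right_mono) auto
  also have "\<dots> = ennreal (?c + 1) * ?L" unfolding L(2) using L(1) c by (intro ennreal_mult) auto
  finally show ?thesis .
qed

end

section \<open>Lower estimate\<close>

context gen_op
begin

text \<open>At u = \<psi> z the denominator 1 - cnj u \<psi> z is the real number s = 1 - |u|^2. The
  powers of s from the normalisation and from the kernel then combine to the denominators of
  \<open>U\<close> and \<open>V\<close>, free of N.\<close>

lemma kernel_second_deriv_diagonal:
  assumes z: "z \<in> unit_disc"
  defines "u \<equiv> \<psi> z"
  defines "s \<equiv> 1 - (cmod u)\<^sup>2"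
  defines "x \<equiv> of_real (W z / (\<phi> (cmod u) * s powr (1 / q + real n + 1))) * (cnj u * (deriv \<psi> z * g z))"
    and "y \<equiv> of_real (W z / (\<phi> (cmod u) * s powr (1 / q + real n))) * deriv g z"
  shows "W z * cmod (second_deriv (kernel N u) z) = real (pochhammer N n) * cmod u ^ n * cmod (of_nat (N + n) * x + y)"
proof -
  have u: "u \<in> unit_disc" unfolding u_def by (rule psi_in[OF z])
  have s: "s > 0"
    using u power_less_one_iff[of "cmod u" 2] by (simp add: s_def)
  have one: "1 - cnj u * \<psi> z = of_real s"
    unfolding u_def[symmetric] s_def using complex_norm_square[of u] by (simp add: mult.commute)
  have e1: "s powr (1 / q + real n + 1) = s powr (1 / q + real n) * s"
    using s by (simp add: powr_add)
  have e2: "s powr (real N - 1 / q) / s ^ (N + n) = 1 / s powr (1 / q + real n)"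
  proof -
    have "s powr (real N - 1 / q) * s powr (1 / q + real n) = s ^ (N + n)"
      using s by (simp flip: powr_add powr_realpow)
    then show ?thesis using s by (simp add: field_simps)
  qed
  have W: "cmod (of_real (W z)) = W z" using W_pos[OF z] by simp
  have \<phi>: "\<phi> (cmod u) > 0" using u by (intro phi_pos) auto
  let ?d = "deriv \<psi> z * g z"
  have "of_real (W z) * second_deriv (kernel N u) z = of_real (W z) * (pochhammer (of_nat N) n * cnj u ^ n)
    * of_real (s powr (real N - 1 / q) / s ^ (N + n)) / of_real (\<phi> (cmod u))
    * (of_nat (N + n) * (cnj u * ?d / of_real s) + deriv g z)"
    unfolding kernel_second_deriv[OF u z] one s_def[symmetric] by (simp add: mult_ac)
  also have "\<dots> = (pochhammer (of_nat N) n * cnj u ^ n) * (of_nat (N + n) * x + y)"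
    unfolding e2 x_def y_def e1 using s \<phi> by (simp add: field_simps)
  finally have eq: "of_real (W z) * second_deriv (kernel N u) z =
      (pochhammer (of_nat N) n * cnj u ^ n) * (of_nat (N + n) * x + y)" .
  have "W z * cmod (second_deriv (kernel N u) z) = cmod (of_real (W z) * second_deriv (kernel N u) z)"
    unfolding norm_mult W ..
  also have "\<dots> = cmod (pochhammer (of_nat N) n) * cmod u ^ n * cmod (of_nat (N + n) * x + y)"
    unfolding eq norm_mult norm_power complex_mod_cnj ..
  also have "cmod (pochhammer (of_nat N) n) = real (pochhammer N n)"
    unfolding pochhammer_of_nat by simp
  finally show ?thesis .
qed

text \<open>Here |x| = |u| U z and |y| = V z. Subtracting the expressions for N and N + 1 isolates
  x, and subtracting (N + n) x then recovers y, which costs the factor N + n + 1. The condition |u|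
  \<ge> 1 / 2 bounds |u|^n and the extra |u| from below and produces the power of 2.\<close>

lemma U_V_le_kernels:
  assumes z: "z \<in> unit_disc" and half: "1 / 2 \<le> cmod (\<psi> z)" and N: "1 \<le> N"
  defines "Y \<equiv> \<lambda>M. W z * cmod (second_deriv (kernel M (\<psi> z)) z)"
  shows "U z \<le> 2 ^ Suc n * real (Suc (N + n)) * (Y N + Y (Suc N))"
    "V z \<le> 2 ^ Suc n * real (Suc (N + n)) * (Y N + Y (Suc N))"
proof -
  define u where "u = \<psi> z"
  define s where "s = 1 - (cmod u)\<^sup>2"
  define x where "x = of_real (W z / (\<phi> (cmod u) * s powr (1 / q + real n + 1))) * (cnj u * (deriv \<psi> z * g z))"
  define y where "y = of_real (W z / (\<phi> (cmod u) * s powr (1 / q + real n))) * deriv g z"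
  have u: "cmod u < 1" "1 / 2 \<le> cmod u" using psi_in[OF z] half by (auto simp: u_def)
  have \<phi>: "\<phi> (cmod u) > 0" using u by (intro phi_pos) auto
  have W: "W z > 0" by (rule W_pos[OF z])
  have cx: "cmod x = cmod u * U z"
    unfolding x_def U_def u_def[symmetric] s_def[symmetric] norm_mult norm_of_real complex_mod_cnj
    using W \<phi> by simp
  have cy: "cmod y = V z"
    unfolding y_def V_def u_def[symmetric] s_def[symmetric] norm_mult norm_of_real
    using W \<phi> by simp
  have Y: "cmod (of_nat (M + n) * x + y) \<le> 2 ^ n * Y M" if M: "1 \<le> M" for M
  proof -
    have "Y M = real (pochhammer M n) * cmod u ^ n * cmod (of_nat (M + n) * x + y)"
      unfolding Y_def x_def y_def s_def u_def by (rule kernel_second_deriv_diagonal[OF z])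
    moreover have "1 \<le> real (pochhammer M n)"
      using pochhammer_pos[of M n] M by simp
    moreover have "(1 / 2) ^ n \<le> cmod u ^ n" using u by (intro power_mono) auto
    ultimately have "1 * (1 / 2) ^ n * cmod (of_nat (M + n) * x + y) \<le> Y M"
      by (simp only:) (intro mult_mono mult_nonneg_nonneg; simp)
    then show ?thesis by (simp add: field_simps)
  qed
  define y1 where "y1 = Y N"
  define y2 where "y2 = Y (Suc N)"
  have y12: "0 \<le> y1" "0 \<le> y2" using W by (auto simp: y1_def y2_def Y_def)
  have Y1: "cmod (of_nat (N + n) * x + y) \<le> 2 ^ n * y1" and Y2: "cmod (of_nat (Suc N + n) * x + y) \<le> 2 ^ n * y2"
    using Y[OF N] Y[of "Suc N"] by (auto simp: y1_def y2_def)
  have "x = (of_nat (Suc N + n) * x + y) - (of_nat (N + n) * x + y)" by (simp add: algebra_simps)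
  then have "cmod x \<le> cmod (of_nat (Suc N + n) * x + y) + cmod (of_nat (N + n) * x + y)"
    by (metis norm_triangle_ineq4)
  also have "\<dots> \<le> 2 ^ n * (y1 + y2)" using Y1 Y2 unfolding distrib_left by linarith
  finally have x_le: "cmod x \<le> 2 ^ n * (y1 + y2)" .
  have U0: "0 \<le> U z" using W \<phi> by (auto simp: U_def u_def)
  have "U z = 2 * (1 / 2 * U z)" by simp
  also have "\<dots> \<le> 2 * cmod x" unfolding cx using u U0 by (intro mult_left_mono mult_right_mono) auto
  also have "\<dots> \<le> 2 * (2 ^ n * (y1 + y2))" using x_le by simp
  also have "\<dots> \<le> 2 * (2 ^ n * (y1 + y2)) * real (Suc (N + n))"
    using y12 mult_left_mono[of 1 "real (Suc (N + n))" "2 * (2 ^ n * (y1 + y2))"] by simp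
  finally show "U z \<le> 2 ^ Suc n * real (Suc (N + n)) * (Y N + Y (Suc N))"
    by (simp add: y1_def y2_def mult_ac)
  have "V z \<le> cmod (of_nat (N + n) * x + y) + real (N + n) * cmod x"
    using norm_triangle_ineq4[of "of_nat (N + n) * x + y" "of_nat (N + n) * x"]
    unfolding cy[symmetric] norm_mult norm_of_nat by simp
  also have "\<dots> \<le> 2 ^ n * (y1 + y2) + real (N + n) * (2 ^ n * (y1 + y2))"
  proof (intro add_mono mult_left_mono x_le)
    show "cmod (of_nat (N + n) * x + y) \<le> 2 ^ n * (y1 + y2)"
      by (rule order_trans[OF Y1]) (use y12 in \<open>intro mult_left_mono; simp\<close>)
  qed auto
  also have "\<dots> = 2 ^ n * (y1 + y2) * real (Suc (N + n))" by (simp add: algebra_simps)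
  also have "\<dots> \<le> 2 * (2 ^ n * (y1 + y2) * real (Suc (N + n)))" using y12 by simp
  finally show "V z \<le> 2 ^ Suc n * real (Suc (N + n)) * (Y N + Y (Suc N))"
    by (simp add: y1_def y2_def mult_ac)
qed

text \<open>Homogeneity moves f / C into the unit ball, where the operator norm applies. The
  operator R is left abstract because the lemma serves both T and T - S.\<close>

lemma scaled_pointwise:
  assumes R: "\<And>f. f \<in> X \<Longrightarrow> R f \<in> Z" "\<And>c f. f \<in> X \<Longrightarrow> R (\<lambda>z. c * f z) = (\<lambda>z. c * R f z)"
    and K: "operator_norm X NX NZ R \<le> ennreal K" "0 \<le> K"
    and f: "f \<in> X" "NX f \<le> C" "0 < C" and z: "z \<in> unit_disc"
  shows "W z * cmod ((deriv ^^ 2) (R f) z) \<le> C * K"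
proof -
  let ?c = "of_real (1 / C) :: complex"
  let ?f = "\<lambda>z. ?c * f z"
  have fX: "?f \<in> X" "NX ?f \<le> 1"
  proof -
    show "?f \<in> X" by (rule X_cmult(1)[OF f(1)])
    have "NX ?f = 1 / C * NX f"
      unfolding X_cmult(2)[OF f(1)] norm_of_real using f(3) by simp
    moreover have "1 / C * NX f \<le> 1" using f(2,3) by simp
    ultimately show "NX ?f \<le> 1" by (simp only:)
  qed
  have hol: "R f holomorphic_on unit_disc" using R(1)[OF f(1)] by (simp add: zygmund_space_def HD_def)
  have "ennreal (NZ (R ?f)) \<le> operator_norm X NX NZ R"
    unfolding operator_norm_def using fX by (intro SUP_upper) simp
  then have "NZ (R ?f) \<le> K" using K by (metis ennreal_le_iff order_trans)
  then have "W z * cmod ((deriv ^^ 2) (R ?f) z) \<le> K"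
    using zygmund_pointwise[OF R(1)[OF fX(1)] z] by linarith
  moreover have "(deriv ^^ 2) (R ?f) z = ?c * (deriv ^^ 2) (R f) z"
    unfolding R(2)[OF f(1)] by (rule higher_deriv_cmult[OF hol z open_ball])
  ultimately have "W z * (cmod ((deriv ^^ 2) (R f) z) / C) \<le> K"
    using f(3) by (simp add: norm_mult norm_divide)
  then show ?thesis using f(3) by (simp add: field_simps)
qed

end

section \<open>Boundary behaviour of the symbols and the compactness argument\<close>

context bounded_gen_op
begin

lemma op_cmult: "f \<in> X \<Longrightarrow> T (\<lambda>z. c * f z) = (\<lambda>z. c * T f z)"
  using op_combine(3)[OF X_holomorphic X_holomorphic] by blast

text \<open>Testing T on the kernels at \<psi> z bounds \<open>U\<close> and \<open>V\<close> where
  |\<psi> z| \<ge> 1 / 2. The weighted symbols are these quantities times \<phi>(|\<psi> z|) and a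
  positive power of 1 - |\<psi> z|^2; since \<phi> \<le> \<phi> 0, the products tend to 0.\<close>

lemma symbols_vanish:
  assumes \<epsilon>: "\<epsilon> > 0"
  shows "\<exists>\<delta><1. \<forall>z\<in>unit_disc. \<delta> < cmod (\<psi> z) \<longrightarrow>
     W z * cmod (deriv \<psi> z * g z) \<le> \<epsilon> \<and> W z * cmod (deriv g z) \<le> \<epsilon>"
proof -
  obtain N where N: "1 \<le> N" "\<And>M. M \<ge> N \<Longrightarrow> real M * q \<ge> 2"
    "\<And>M. M \<ge> N \<Longrightarrow> p * (real M - 1 / q) \<ge> b * p + 1"
    by (rule large_exponents) (rule that)
  obtain K where K: "0 \<le> K" "operator_norm X NX NZ T \<le> ennreal K"
    using bounded by (cases "operator_norm X NX NZ T") (auto simp: bounded_operator_def)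
  have ex: "\<exists>B\<ge>0. \<forall>z\<in>unit_disc. W z * cmod (second_deriv (kernel M (\<psi> z)) z) \<le> B" if M: "M \<ge> N" for M
  proof -
    obtain C where C: "C > 0" "\<And>u. u \<in> unit_disc \<Longrightarrow> kernel M u \<in> X \<and> NX (kernel M u) \<le> C"
      using kernel_bounded[OF N(2)[OF M] N(3)[OF M]] by blast
    have "W z * cmod (second_deriv (kernel M (\<psi> z)) z) \<le> C * K" if z: "z \<in> unit_disc" for z
      using scaled_pointwise[OF op_in_Z op_cmult K(2,1) _ _ C(1) z] C(2)[OF psi_in[OF z]]
      by (metis X_holomorphic op_deriv2 z)
    moreover have "0 \<le> C * K" using C(1) K(1) by simp
    ultimately show ?thesis by blast
  qed
  obtain B1 where B1: "B1 \<ge> 0" "\<And>z. z \<in> unit_disc \<Longrightarrow> W z * cmod (second_deriv (kernel N (\<psi> z)) z) \<le> B1"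
    using ex[OF le_refl] by blast
  obtain B2 where B2: "B2 \<ge> 0" "\<And>z. z \<in> unit_disc \<Longrightarrow> W z * cmod (second_deriv (kernel (Suc N) (\<psi> z)) z) \<le> B2"
    using ex[OF le_SucI[OF le_refl]] by blast
  define B where "B = 2 ^ Suc n * real (Suc (N + n)) * (B1 + B2) + 1"
  have B: "B > 0" using B1(1) B2(1) by (simp add: B_def add_nonneg_pos)
  have UV: "U z \<le> B" "V z \<le> B" if z: "z \<in> unit_disc" "1 / 2 \<le> cmod (\<psi> z)" for z
  proof -
    have "2 ^ Suc n * real (Suc (N + n)) * (W z * cmod (second_deriv (kernel N (\<psi> z)) z) + W z * cmod (second_deriv (kernel (Suc N) (\<psi> z)) z)) \<le> B - 1"
      unfolding B_def using B1(2)[OF z(1)] B2(2)[OF z(1)] by (simp add: mult_left_mono)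
    then show "U z \<le> B" "V z \<le> B"
      using U_V_le_kernels[OF z N(1)] by linarith+
  qed
  define e where "e = 1 / q + real n"
  have e: "e > 0" using q_pos by (simp add: e_def add_pos_nonneg)
  have \<phi>0: "\<phi> 0 > 0" by (intro phi_pos) auto
  \<comment> \<open>Solves B * \<phi> 0 * \<eta> powr e = \<epsilon>. The choice of
    \<open>\<delta>\<close> below ensures 1 - t^2 \<le> 2 (1 - t) \<le> \<eta>.\<close>
  define \<eta> where "\<eta> = (\<epsilon> / (B * \<phi> 0)) powr (1 / e)"
  have \<eta>: "\<eta> > 0" "\<eta> powr e = \<epsilon> / (B * \<phi> 0)" using \<epsilon> B \<phi>0 e by (auto simp: \<eta>_def powr_powr)
  define \<delta> where "\<delta> = max (1 / 2) (1 - \<eta> / 2)"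
  have "\<delta> < 1" using \<eta> by (simp add: \<delta>_def)
  moreover have "W z * cmod (deriv \<psi> z * g z) \<le> \<epsilon> \<and> W z * cmod (deriv g z) \<le> \<epsilon>"
    if z: "z \<in> unit_disc" "\<delta> < cmod (\<psi> z)" for z
  proof -
    define t where "t = cmod (\<psi> z)"
    define s where "s = 1 - t\<^sup>2"
    have t: "0 \<le> t" "t < 1" "1 / 2 \<le> t" "1 - t \<le> \<eta> / 2"
      using psi_in[OF z(1)] z(2) by (auto simp: t_def \<delta>_def)
    have s_eq: "s = (1 + t) * (1 - t)" by (simp add: s_def power2_eq_square algebra_simps)
    have "(1 + t) * (1 - t) \<le> 2 * (\<eta> / 2)" using t by (intro mult_mono) auto
    moreover have "0 < (1 + t) * (1 - t)" using t by (intro mult_pos_pos) auto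
    moreover have "s \<le> 1" by (simp add: s_def)
    ultimately have s: "0 < s" "s \<le> \<eta>" "s \<le> 1" unfolding s_eq by auto
    have \<phi>t: "0 < \<phi> t" "\<phi> t \<le> \<phi> 0" using t phi_decreasing[of 0 t] by (auto intro: phi_pos)
    have "s powr e \<le> \<epsilon> / (B * \<phi> 0)"
      using \<eta>(2) powr_mono2[of e s \<eta>] s e by simp
    then have "\<phi> t * s powr e \<le> \<phi> 0 * (\<epsilon> / (B * \<phi> 0))"
      using \<phi>t s by (intro mult_mono) auto
    also have "\<dots> = \<epsilon> / B" using \<phi>0 by simp
    finally have small: "\<phi> t * s powr e \<le> \<epsilon> / B" .
    have "s powr (e + 1) \<le> s powr e" using s by (intro powr_mono') auto
    then have small': "\<phi> t * s powr (e + 1) \<le> \<epsilon> / B"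
      using small \<phi>t by (intro order_trans[OF mult_left_mono small]) auto
    have "W z * cmod (deriv g z) = V z * (\<phi> t * s powr e)"
      using \<phi>t s by (simp add: V_def t_def[symmetric] s_def[symmetric] e_def)
    also have "\<dots> \<le> B * (\<epsilon> / B)"
      using UV(2)[OF z(1)] t small B \<phi>t by (intro mult_mono) (auto simp: t_def)
    also have "\<dots> = \<epsilon>" using B by simp
    finally have a: "W z * cmod (deriv g z) \<le> \<epsilon>" .
    have "W z * cmod (deriv \<psi> z * g z) = U z * (\<phi> t * s powr (e + 1))"
      using \<phi>t s by (simp add: U_def t_def[symmetric] s_def[symmetric] e_def)
    also have "\<dots> \<le> B * (\<epsilon> / B)"
      using UV(1)[OF z(1)] t small' B \<phi>t by (intro mult_mono) (auto simp: t_def)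
    also have "\<dots> = \<epsilon>" using B by simp
    finally show ?thesis using a by blast
  qed
  ultimately show ?thesis by blast
qed

text \<open>A fixed kernel is smooth up to the boundary because |1 - cnj u w| \<ge> 1 - |u|. The
  bound deteriorates as |u| tends to 1, so it is meant for one kernel at a time.\<close>

lemma kernel_derivs_bounded:
  assumes u: "u \<in> unit_disc"
  shows "\<exists>M\<ge>0. \<forall>w\<in>unit_disc. cmod ((deriv ^^ k) (kernel N u) w) \<le> M"
proof -
  define A where "A = cmod (of_real ((1 - (cmod u)\<^sup>2) powr (real N - 1 / q) / \<phi> (cmod u)) * pochhammer (of_nat N) k * cnj u ^ k)"
  have "cmod ((deriv ^^ k) (kernel N u) w) \<le> A / (1 - cmod u) ^ (N + k)" if w: "w \<in> unit_disc" for w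
  proof -
    have "cmod u * cmod w \<le> cmod u" using w by (intro mult_left_le) auto
    then have le: "1 - cmod u \<le> cmod (1 - cnj u * w)"
      using norm_triangle_ineq2[of 1 "cnj u * w"] by (simp add: norm_mult)
    have "A / cmod (1 - cnj u * w) ^ (N + k) \<le> A / (1 - cmod u) ^ (N + k)"
      using u le by (intro divide_left_mono power_mono mult_pos_pos zero_less_power) (auto simp: A_def)
    then show ?thesis
      unfolding kernel_higher_deriv[OF u w] A_def norm_divide norm_power .
  qed
  moreover have "0 \<le> A / (1 - cmod u) ^ (N + k)" using u by (simp add: A_def)
  ultimately show ?thesis by blast
qed

text \<open>A compact operator need not map the kernels to a null sequence (for small \<open>p\<close> they are not weakly null),
  so differences of kernels are used: along a subsequence \<open>S\<close> is almost constant, while the contribution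
  of a fixed kernel to \<open>T\<close> vanishes at the boundary.\<close>

lemma kernel_lower:
  assumes kX: "\<And>u. u \<in> unit_disc \<Longrightarrow> kernel N u \<in> X \<and> NX (kernel N u) \<le> C"
    and D: "D > 0" "\<And>u v. u \<in> unit_disc \<Longrightarrow> v \<in> unit_disc \<Longrightarrow>
      (\<lambda>z. kernel N u z - kernel N v z) \<in> X \<and> NX (\<lambda>z. kernel N u z - kernel N v z) \<le> D"
    and S: "compact_operator X NX Z NZ S"
    and E: "operator_norm X NX NZ (\<lambda>f z. T f z - S f z) \<le> ennreal E" "0 \<le> E"
    and \<epsilon>: "\<epsilon> > 0"
  shows "\<exists>\<delta><1. \<forall>z\<in>unit_disc. \<delta> < cmod (\<psi> z) \<longrightarrow>
     W z * cmod (second_deriv (kernel N (\<psi> z)) z) \<le> D * E + \<epsilon>"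
proof (rule ccontr)
  assume neg: "\<not> ?thesis"
  have "\<exists>z\<in>unit_disc. 1 - inverse (real (Suc k)) < cmod (\<psi> z) \<and>
      D * E + \<epsilon> < W z * cmod (second_deriv (kernel N (\<psi> z)) z)" for k
  proof -
    have "1 - inverse (real (Suc k)) < 1" by simp
    then have "\<not> (\<forall>z\<in>unit_disc. 1 - inverse (real (Suc k)) < cmod (\<psi> z) \<longrightarrow>
        W z * cmod (second_deriv (kernel N (\<psi> z)) z) \<le> D * E + \<epsilon>)"
      using neg by blast
    then show ?thesis unfolding Bex_def Ball_def not_all not_imp not_le by blast
  qed
  then obtain \<zeta> where \<zeta>: "\<And>k. \<zeta> k \<in> unit_disc" "\<And>k. 1 - inverse (real (Suc k)) < cmod (\<psi> (\<zeta> k))"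
    "\<And>k. D * E + \<epsilon> < W (\<zeta> k) * cmod (second_deriv (kernel N (\<psi> (\<zeta> k))) (\<zeta> k))"
    by metis
  define F where "F = (\<lambda>k. kernel N (\<psi> (\<zeta> k)))"
  have ud: "\<psi> (\<zeta> k) \<in> unit_disc" for k by (rule psi_in[OF \<zeta>(1)])
  have FX: "F k \<in> X" "NX (F k) \<le> C" for k using kX[OF ud] by (auto simp: F_def)
  have S_lin: "linear_operator X Z S" using S by (simp add: compact_operator_def)
  have SZ: "S f \<in> Z" if "f \<in> X" for f using S_lin that by (simp add: linear_operator_def)
  have S_cmult: "S (\<lambda>z. c * f z) = (\<lambda>z. c * S f z)" if "f \<in> X" for c f
    using S_lin that by (simp add: linear_operator_def)
  have S_diff: "S (\<lambda>z. f z - h z) = (\<lambda>z. S f z - S h z)" if "f \<in> X" "h \<in> X" for f h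
  proof -
    \<comment> \<open>\<open>linear_operator\<close> speaks of sums and scalar multiples, so the
      difference is written as f + (-1) h.\<close>
    have "S (\<lambda>z. f z + (-1) * h z) = (\<lambda>z. S f z + S (\<lambda>z. (-1) * h z) z)"
    proof -
      have "\<forall>f\<in>X. \<forall>h\<in>X. S (\<lambda>z. f z + h z) = (\<lambda>z. S f z + S h z)"
        using S_lin by (simp add: linear_operator_def)
      from bspec[OF bspec[OF this that(1)] X_cmult(1)[OF that(2), of "-1"]] show ?thesis .
    qed
    then show ?thesis unfolding S_cmult[OF that(2)] by simp
  qed
  interpret ZM: Metric_space Z "norm_dist Z NZ" by (rule Metric_space_zygmund[OF weight])
  have "relatively_compact Z NZ (S ` range F)"
  proof -
    have "range F \<subseteq> X" "\<exists>M. \<forall>f\<in>range F. NX f \<le> M" using FX by auto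
    then show ?thesis using S unfolding compact_operator_def by blast
  qed
  then have "compactin ZM.mtopology (ZM.mtopology closure_of (S ` range F))"
    by (simp add: relatively_compact_def)
  moreover have "range (\<lambda>k. S (F k)) \<subseteq> ZM.mtopology closure_of (S ` range F)"
  proof -
    have "S ` range F \<subseteq> topspace ZM.mtopology" using SZ FX by auto
    from closure_of_subset[OF this] show ?thesis by auto
  qed
  ultimately obtain l \<rho> where l: "strict_mono (\<rho> :: nat \<Rightarrow> nat)"
    "limitin ZM.mtopology ((\<lambda>k. S (F k)) \<circ> \<rho>) l sequentially"
    unfolding ZM.compactin_sequentially by blast
  have "l \<in> Z" using l(2) by (simp add: ZM.limitin_metric)
  have "\<forall>\<^sub>F k in sequentially. S (F (\<rho> k)) \<in> Z \<and> norm_dist Z NZ (S (F (\<rho> k))) l < \<epsilon> / 4"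
  proof -
    have "\<forall>e>0. \<forall>\<^sub>F k in sequentially. S (F (\<rho> k)) \<in> Z \<and> norm_dist Z NZ (S (F (\<rho> k))) l < e"
      using l(2) unfolding ZM.limitin_metric o_def by blast
    moreover have "\<epsilon> / 4 > 0" using \<epsilon> by simp
    ultimately show ?thesis by blast
  qed
  then obtain k0 where k0: "\<And>k. k \<ge> k0 \<Longrightarrow> norm_dist Z NZ (S (F (\<rho> k))) l < \<epsilon> / 4"
    unfolding eventually_sequentially by blast
  \<comment> \<open>Two distances to the limit l, each below \<epsilon> / 4, are added; afterwards l
    is no longer needed and the term of index k0 is the fixed comparison kernel.\<close>
  have close: "NZ (\<lambda>z. S (F (\<rho> k)) z - S (F (\<rho> k0)) z) \<le> \<epsilon> / 2" if "k \<ge> k0" for k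
  proof -
    have "norm_dist Z NZ (S (F (\<rho> k))) (S (F (\<rho> k0)))
        \<le> norm_dist Z NZ (S (F (\<rho> k))) l + norm_dist Z NZ l (S (F (\<rho> k0)))"
      using SZ FX \<open>l \<in> Z\<close> by (intro ZM.triangle) auto
    also have "norm_dist Z NZ l (S (F (\<rho> k0))) = norm_dist Z NZ (S (F (\<rho> k0))) l"
      by (rule ZM.commute)
    finally show ?thesis
      using k0[OF that] k0[OF le_refl] SZ FX by (simp add: norm_dist_def)
  qed
  define h where "h = F (\<rho> k0)"
  have h: "h \<in> X" "h holomorphic_on unit_disc" unfolding h_def using FX X_holomorphic by auto
  obtain M1 where M1: "M1 \<ge> 0" "\<And>w. w \<in> unit_disc \<Longrightarrow> cmod ((deriv ^^ n) h w) \<le> M1"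
    unfolding h_def F_def using kernel_derivs_bounded[OF ud, where k = n] by blast
  obtain M2 where M2: "M2 \<ge> 0" "\<And>w. w \<in> unit_disc \<Longrightarrow> cmod ((deriv ^^ Suc n) h w) \<le> M2"
    unfolding h_def F_def using kernel_derivs_bounded[OF ud, where k = "Suc n"] by blast
  define M where "M = max M1 M2"
  have M: "M \<ge> 0" "\<And>w. w \<in> unit_disc \<Longrightarrow> cmod ((deriv ^^ n) h w) \<le> M"
    "\<And>w. w \<in> unit_disc \<Longrightarrow> cmod ((deriv ^^ Suc n) h w) \<le> M"
    using M1 M2 unfolding M_def by (auto simp: le_max_iff_disj)
  \<comment> \<open>Chosen so that a function whose derivatives of orders n and n + 1 are at most M
    contributes at most \<epsilon> / 2 to the weighted second derivative once both symbols are below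
    \<eta>.\<close>
  define \<eta> where "\<eta> = \<epsilon> / (4 * (M + 1))"
  have \<eta>: "\<eta> > 0" using \<epsilon> M by (simp add: \<eta>_def)
  have "2 * (M * \<eta>) \<le> 2 * ((M + 1) * \<eta>)" using \<eta> by simp
  also have "\<dots> = \<epsilon> / 2" using M(1) by (simp add: \<eta>_def field_simps)
  finally have M\<eta>: "2 * (M * \<eta>) \<le> \<epsilon> / 2" .
  obtain \<delta> where \<delta>: "\<delta> < 1" "\<And>z. z \<in> unit_disc \<Longrightarrow> \<delta> < cmod (\<psi> z) \<Longrightarrow>
     W z * cmod (deriv \<psi> z * g z) \<le> \<eta> \<and> W z * cmod (deriv g z) \<le> \<eta>"
    using symbols_vanish[OF \<eta>] by blast
  obtain k1 where k1: "inverse (real (Suc k1)) < 1 - \<delta>"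
    using reals_Archimedean[of "1 - \<delta>"] \<delta>(1) by auto
  \<comment> \<open>The index is late enough for two purposes: k \<ge> k0 makes the S-images close,
    and \<rho> k \<ge> k1 puts |\<psi> z| beyond \<delta>.\<close>
  define k where "k = max k0 k1"
  define z where "z = \<zeta> (\<rho> k)"
  have z: "z \<in> unit_disc" unfolding z_def by (rule \<zeta>(1))
  have "k1 \<le> \<rho> k" using strict_mono_imp_increasing[OF l(1), of k] by (simp add: k_def)
  then have "inverse (real (Suc (\<rho> k))) \<le> inverse (real (Suc k1))" by (intro le_imp_inverse_le) auto
  then have "\<delta> < cmod (\<psi> z)" using k1 \<zeta>(2)[of "\<rho> k"] unfolding z_def by linarith
  note W\<eta> = \<delta>(2)[OF z this]
  have hz: "W z * cmod (second_deriv h z) \<le> \<epsilon> / 2"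
    using second_deriv_estimate[OF z, of \<eta> h M] W\<eta> M psi_in[OF z] M\<eta> by force
  let ?f = "F (\<rho> k)"
  let ?d = "\<lambda>z. ?f z - h z"
  have dX: "?d \<in> X" "NX ?d \<le> D" using D(2)[OF ud ud] by (auto simp: F_def h_def)
  have f_hol: "?f holomorphic_on unit_disc" by (rule X_holomorphic[OF FX(1)])
  have Td: "T ?d = (\<lambda>z. T ?f z - T h z)" using op_combine(2)[OF f_hol h(2)] by simp
  have "W z * cmod ((deriv ^^ 2) (\<lambda>z. T ?d z - S ?d z) z) \<le> D * E"
  proof (rule scaled_pointwise[OF _ _ E dX D(1) z])
    show "(\<lambda>z. T f z - S f z) \<in> Z" if "f \<in> X" for f
      by (rule zygmund_diff(1)[OF op_in_Z[OF that] SZ[OF that]])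
    show "(\<lambda>z. T (\<lambda>z. c * f z) z - S (\<lambda>z. c * f z) z) = (\<lambda>z. c * (T f z - S f z))" if "f \<in> X" for c f
      by (simp add: op_cmult[OF that] S_cmult[OF that] right_diff_distrib)
  qed
  moreover have "(deriv ^^ 2) (\<lambda>z. T ?d z - S ?d z) z = (deriv ^^ 2) (T ?d) z - (deriv ^^ 2) (S ?d) z"
    by (rule zygmund_diff(2)[OF op_in_Z[OF dX(1)] SZ[OF dX(1)] z])
  ultimately have 1: "W z * cmod ((deriv ^^ 2) (T ?d) z - (deriv ^^ 2) (S ?d) z) \<le> D * E" by simp
  have 2: "W z * cmod ((deriv ^^ 2) (S ?d) z) \<le> \<epsilon> / 2"
    using zygmund_pointwise[OF SZ[OF dX(1)] z] close[of k]
    unfolding S_diff[OF FX(1) h(1)] by (simp add: h_def k_def)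
  have 3: "(deriv ^^ 2) (T ?d) z = second_deriv ?f z - second_deriv h z"
    unfolding Td using zygmund_diff(2)[OF op_in_Z[OF FX(1)] op_in_Z[OF h(1)] z]
    by (simp add: op_deriv2[OF f_hol z] op_deriv2[OF h(2) z])
  have Wz: "W z > 0" by (rule W_pos[OF z])
  \<comment> \<open>The budget: D E for T - S on the difference of kernels, \<epsilon> / 2 for S on
    that difference, and \<epsilon> / 2 for T on the fixed kernel h. The sum contradicts the choice
    of the points \<zeta>.\<close>
  have "cmod (second_deriv ?f z) \<le> cmod ((deriv ^^ 2) (T ?d) z - (deriv ^^ 2) (S ?d) z) + cmod ((deriv ^^ 2) (S ?d) z) + cmod (second_deriv h z)"
    unfolding 3 by norm
  then have "W z * cmod (second_deriv ?f z) \<le> W z * (cmod ((deriv ^^ 2) (T ?d) z - (deriv ^^ 2) (S ?d) z) + cmod ((deriv ^^ 2) (S ?d) z) + cmod (second_deriv h z))"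
    using Wz by (intro mult_left_mono) auto
  also have "\<dots> \<le> D * E + \<epsilon> / 2 + \<epsilon> / 2"
    unfolding distrib_left by (intro add_mono 1 2 hz)
  finally show False using \<zeta>(3)[of "\<rho> k"] by (simp add: F_def z_def)
qed

text \<open>Each of the kernels for N and N + 1 contributes at most D E + \<epsilon>, which gives
  the factor 2 D; the rest of c is the constant of \<open>U_V_le_kernels\<close>. The argument runs
  for every compact S separately, with c independent of S.\<close>

lemma essential_norm_lower:
  assumes N: "1 \<le> N" and D: "D > 0"
    and kX: "\<And>M u. M \<in> {N, Suc N} \<Longrightarrow> u \<in> unit_disc \<Longrightarrow> kernel M u \<in> X \<and> NX (kernel M u) \<le> C"
    and kD: "\<And>M u v. M \<in> {N, Suc N} \<Longrightarrow> u \<in> unit_disc \<Longrightarrow> v \<in> unit_disc \<Longrightarrow>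
      (\<lambda>z. kernel M u z - kernel M v z) \<in> X \<and> NX (\<lambda>z. kernel M u z - kernel M v z) \<le> D"
  defines "c \<equiv> 2 ^ Suc n * real (Suc (N + n)) * (2 * D)"
  shows "ennreal (1 / c) * max (boundary_limsup \<psi> U) (boundary_limsup \<psi> V) \<le> essential_norm X NX Z NZ T"
  unfolding essential_norm_def
proof (rule INF_greatest)
  fix S assume "S \<in> {S. compact_operator X NX Z NZ S}"
  then have S: "compact_operator X NX Z NZ S" by simp
  let ?O = "operator_norm X NX NZ (\<lambda>f z. T f z - S f z)"
  let ?L = "max (boundary_limsup \<psi> U) (boundary_limsup \<psi> V)"
  have c: "c > 0" using D by (simp add: c_def)
  show "ennreal (1 / c) * ?L \<le> ?O"
  proof (cases ?O)
    case (real E)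
    have "?L \<le> ennreal (c * E) + ennreal e" if e: "e > 0" for e
    proof -
      define k where "k = 2 ^ Suc n * real (Suc (N + n)) * 2"
      have k: "k > 0" "c = k * D" by (auto simp: k_def c_def)
      define \<epsilon> where "\<epsilon> = e / k"
      have \<epsilon>: "\<epsilon> > 0" "k * \<epsilon> = e" using e k by (auto simp: \<epsilon>_def)
      have ex: "\<exists>\<delta><1. \<forall>z\<in>unit_disc. \<delta> < cmod (\<psi> z) \<longrightarrow>
          W z * cmod (second_deriv (kernel M (\<psi> z)) z) \<le> D * E + \<epsilon>" if "M \<in> {N, Suc N}" for M
        using kernel_lower[OF kX[OF that] D kD[OF that] S _ real(1) \<epsilon>(1)] real(2) by simp
      obtain \<delta>1 where \<delta>1: "\<delta>1 < 1" "\<And>z. z \<in> unit_disc \<Longrightarrow> \<delta>1 < cmod (\<psi> z) \<Longrightarrow>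
          W z * cmod (second_deriv (kernel N (\<psi> z)) z) \<le> D * E + \<epsilon>" using ex[of N] by blast
      obtain \<delta>2 where \<delta>2: "\<delta>2 < 1" "\<And>z. z \<in> unit_disc \<Longrightarrow> \<delta>2 < cmod (\<psi> z) \<Longrightarrow>
          W z * cmod (second_deriv (kernel (Suc N) (\<psi> z)) z) \<le> D * E + \<epsilon>" using ex[of "Suc N"] by blast
      define \<delta> where "\<delta> = max (1 / 2) (max \<delta>1 \<delta>2)"
      have \<delta>: "\<delta> < 1" using \<delta>1 \<delta>2 by (simp add: \<delta>_def)
      have UV: "U z \<le> c * E + e" "V z \<le> c * E + e" if z: "z \<in> unit_disc" "\<delta> < cmod (\<psi> z)" for z
      proof -
        have "\<delta>1 < cmod (\<psi> z)" "\<delta>2 < cmod (\<psi> z)" "1 / 2 \<le> cmod (\<psi> z)"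
          using z(2) by (auto simp: \<delta>_def)
        note r = U_V_le_kernels[OF z(1) this(3) N] \<delta>1(2)[OF z(1) this(1)] \<delta>2(2)[OF z(1) this(2)]
        have "2 ^ Suc n * real (Suc (N + n)) * (W z * cmod (second_deriv (kernel N (\<psi> z)) z) + W z * cmod (second_deriv (kernel (Suc N) (\<psi> z)) z))
            \<le> 2 ^ Suc n * real (Suc (N + n)) * ((D * E + \<epsilon>) + (D * E + \<epsilon>))"
          by (intro mult_left_mono add_mono r) auto
        also have "\<dots> = k * (D * E + \<epsilon>)" by (simp add: k_def)
        also have "\<dots> = c * E + e" unfolding \<epsilon>(2)[symmetric] k(2) by (simp add: algebra_simps)
        finally show "U z \<le> c * E + e" "V z \<le> c * E + e" using r(1,2) by linarith+
      qed
      have "?L \<le> ennreal (c * E + e)"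
        using boundary_limsup_le[OF \<delta> UV(1)] boundary_limsup_le[OF \<delta> UV(2)] by simp
      then show ?thesis using c real(1) e by (simp add: ennreal_plus)
    qed
    then have "?L \<le> ennreal (c * E)" by (rule ennreal_le_epsilon)
    then have "ennreal (1 / c) * ?L \<le> ennreal (1 / c) * ennreal (c * E)" by (rule mult_left_mono) simp
    also have "\<dots> = ennreal E" using c real(1) by (simp flip: ennreal_mult)
    finally show ?thesis by (simp add: real(2))
  qed simp
qed

end

theorem theorem2p4:
  fixes p q :: real and \<phi> :: "real \<Rightarrow> real" and n :: nat
  assumes "p > 0" and "q > 0" and "normal_function \<phi>"
  shows "\<exists>C1 C2 :: real. C1 > 0 \<and> C2 > 0 \<and>
    (\<forall>(\<mu> :: complex \<Rightarrow> real) (g :: complex \<Rightarrow> complex) (\<psi> :: complex \<Rightarrow> complex).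
       weight \<mu> \<longrightarrow> g holomorphic_on unit_disc \<longrightarrow> analytic_self_map \<psi> \<longrightarrow>
       bounded_operator (mixed_norm_space p q \<phi>) (mixed_norm p q \<phi>)
         (zygmund_space \<mu>) (zygmund_norm \<mu>) (gen_integration_op n \<psi> g) \<longrightarrow>
       (let E = essential_norm (mixed_norm_space p q \<phi>) (mixed_norm p q \<phi>)
                  (zygmund_space \<mu>) (zygmund_norm \<mu>) (gen_integration_op n \<psi> g);
            L = max
              (boundary_limsup \<psi> (\<lambda>z.
                 \<mu> (of_real (cmod z)) * cmod (deriv \<psi> z * g z) /
                 (\<phi> (cmod (\<psi> z)) * (1 - (cmod (\<psi> z))\<^sup>2) powr (1 / q + real n + 1))))
              (boundary_limsup \<psi> (\<lambda>z.
                 \<mu> (of_real (cmod z)) * cmod (deriv g z) /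
                 (\<phi> (cmod (\<psi> z)) * (1 - (cmod (\<psi> z))\<^sup>2) powr (1 / q + real n))))
        in ennreal C1 * L \<le> E \<and> E \<le> ennreal C2 * L))"
proof -
  obtain a b where ab: "0 < a" "a < b"
    "antimono_on {0..<1} (\<lambda>r. \<phi> r / (1 - r) powr a)" "mono_on {0..<1} (\<lambda>r. \<phi> r / (1 - r) powr b)"
    using assms(3) unfolding normal_function_def by blast
  interpret normal_weight p q a b \<phi>
    by unfold_locales (use assms ab in \<open>auto simp: normal_function_def\<close>)
  obtain Ca where Ca: "Ca > 0" "\<And>f w. f \<in> X \<Longrightarrow> w \<in> unit_disc \<Longrightarrow>
     cmod ((deriv ^^ n) f w) * (\<phi> (cmod w) * (1 - cmod w) powr (1 / q + real n)) \<le> Ca * NX f"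
    using deriv_growth[of n] by blast
  obtain Cb where Cb: "Cb > 0" "\<And>f w. f \<in> X \<Longrightarrow> w \<in> unit_disc \<Longrightarrow>
     cmod ((deriv ^^ Suc n) f w) * (\<phi> (cmod w) * (1 - cmod w) powr (1 / q + real (Suc n))) \<le> Cb * NX f"
    using deriv_growth[of "Suc n"] by blast
  define C where "C = max Ca Cb"
  have C0: "C > 0" using Ca(1) by (simp add: C_def)
  have C: "cmod ((deriv ^^ k) f w) * (\<phi> (cmod w) * (1 - cmod w) powr (1 / q + real k)) \<le> C * NX f"
    if "f \<in> X" "w \<in> unit_disc" "k \<in> {n, Suc n}" for f w k
  proof -
    have "Ca * NX f \<le> C * NX f" "Cb * NX f \<le> C * NX f"
      unfolding C_def by (intro mult_right_mono norm_nonneg; simp)+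
    note * = order_trans[OF Ca(2)[OF that(1,2)] this(1)] order_trans[OF Cb(2)[OF that(1,2)] this(2)]
    from that(3) consider "k = n" | "k = Suc n" by blast
    then show ?thesis by cases (use * in \<open>simp_all only:\<close>)
  qed
  obtain N where N: "1 \<le> N" "\<And>M. M \<ge> N \<Longrightarrow> real M * q \<ge> 2"
    "\<And>M. M \<ge> N \<Longrightarrow> p * (real M - 1 / q) \<ge> b * p + 1"
    by (rule large_exponents) (rule that)
  have le: "N \<le> N" "N \<le> Suc N" by auto
  obtain K1 where K1: "\<And>u. u \<in> unit_disc \<Longrightarrow> kernel N u \<in> X \<and> NX (kernel N u) \<le> K1"
    using kernel_bounded[OF N(2)[OF le(1)] N(3)[OF le(1)]] by blast
  obtain K2 where K2: "\<And>u. u \<in> unit_disc \<Longrightarrow> kernel (Suc N) u \<in> X \<and> NX (kernel (Suc N) u) \<le> K2"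
    using kernel_bounded[OF N(2)[OF le(2)] N(3)[OF le(2)]] by blast
  obtain D1 where D1: "D1 > 0" "\<And>u v. u \<in> unit_disc \<Longrightarrow> v \<in> unit_disc \<Longrightarrow>
      (\<lambda>z. kernel N u z - kernel N v z) \<in> X \<and> NX (\<lambda>z. kernel N u z - kernel N v z) \<le> D1"
    using kernel_diff_bounded[OF N(2)[OF le(1)] N(3)[OF le(1)]] by blast
  obtain D2 where D2: "D2 > 0" "\<And>u v. u \<in> unit_disc \<Longrightarrow> v \<in> unit_disc \<Longrightarrow>
      (\<lambda>z. kernel (Suc N) u z - kernel (Suc N) v z) \<in> X \<and> NX (\<lambda>z. kernel (Suc N) u z - kernel (Suc N) v z) \<le> D2"
    using kernel_diff_bounded[OF N(2)[OF le(2)] N(3)[OF le(2)]] by blast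
  define K where "K = max K1 K2"
  define D where "D = max D1 D2"
  have D0: "D > 0" using D1(1) by (simp add: D_def)
  have kX: "kernel M u \<in> X \<and> NX (kernel M u) \<le> K" if "M \<in> {N, Suc N}" "u \<in> unit_disc" for M u
    using that K1[of u] K2[of u] by (auto simp: K_def le_max_iff_disj)
  have kD: "(\<lambda>z. kernel M u z - kernel M v z) \<in> X \<and> NX (\<lambda>z. kernel M u z - kernel M v z) \<le> D"
    if "M \<in> {N, Suc N}" "u \<in> unit_disc" "v \<in> unit_disc" for M u v
    using that D1(2)[of u v] D2(2)[of u v] by (auto simp: D_def le_max_iff_disj)
  define C1 where "C1 = 1 / (2 ^ Suc n * real (Suc (N + n)) * (2 * D))"
  define C2 where "C2 = 4 * C * 2 powr (1 / q + real n + 1) + 1"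
  have "C1 > 0" "C2 > 0" using D0 C0 by (auto simp: C1_def C2_def add_pos_pos)
  moreover have "ennreal C1 * max (boundary_limsup \<psi> (gen_op.U q \<phi> n \<mu> g \<psi>)) (boundary_limsup \<psi> (gen_op.V q \<phi> n \<mu> g \<psi>))
        \<le> essential_norm X NX (zygmund_space \<mu>) (zygmund_norm \<mu>) (gen_integration_op n \<psi> g) \<and>
      essential_norm X NX (zygmund_space \<mu>) (zygmund_norm \<mu>) (gen_integration_op n \<psi> g)
        \<le> ennreal C2 * max (boundary_limsup \<psi> (gen_op.U q \<phi> n \<mu> g \<psi>)) (boundary_limsup \<psi> (gen_op.V q \<phi> n \<mu> g \<psi>))"
    and "gen_op.U q \<phi> n \<mu> g \<psi> = (\<lambda>z. \<mu> (of_real (cmod z)) * cmod (deriv \<psi> z * g z) /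
                 (\<phi> (cmod (\<psi> z)) * (1 - (cmod (\<psi> z))\<^sup>2) powr (1 / q + real n + 1)))"
    and "gen_op.V q \<phi> n \<mu> g \<psi> = (\<lambda>z. \<mu> (of_real (cmod z)) * cmod (deriv g z) /
                 (\<phi> (cmod (\<psi> z)) * (1 - (cmod (\<psi> z))\<^sup>2) powr (1 / q + real n)))"
    if "weight \<mu>" "g holomorphic_on unit_disc" "analytic_self_map \<psi>"
      "bounded_operator X NX (zygmund_space \<mu>) (zygmund_norm \<mu>) (gen_integration_op n \<psi> g)" for \<mu> g \<psi>
  proof -
    \<comment> \<open>The weight and the two symbols enter only here, after \<open>C1\<close> and
      \<open>C2\<close> have been fixed, which gives the required uniformity of the
      constants.\<close>
    interpret bounded_gen_op p q a b \<phi> n \<mu> g \<psi>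
      by unfold_locales (use that in auto)
    show "ennreal C1 * max (boundary_limsup \<psi> U) (boundary_limsup \<psi> V) \<le> essential_norm X NX Z NZ T \<and>
        essential_norm X NX Z NZ T \<le> ennreal C2 * max (boundary_limsup \<psi> U) (boundary_limsup \<psi> V)"
      unfolding C1_def C2_def
      using essential_norm_lower[OF N(1) D0 kX kD] essential_norm_upper[OF less_imp_le[OF C0] C] by blast
    show "U = (\<lambda>z. \<mu> (of_real (cmod z)) * cmod (deriv \<psi> z * g z) /
                 (\<phi> (cmod (\<psi> z)) * (1 - (cmod (\<psi> z))\<^sup>2) powr (1 / q + real n + 1)))"
      "V = (\<lambda>z. \<mu> (of_real (cmod z)) * cmod (deriv g z) /
                 (\<phi> (cmod (\<psi> z)) * (1 - (cmod (\<psi> z))\<^sup>2) powr (1 / q + real n)))"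
      by (auto simp: U_def V_def W_def)
  qed
  ultimately show ?thesis
    unfolding Let_def by (intro exI[of _ C1] exI[of _ C2] conjI allI impI) simp_all
qed

end
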